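(* Let $(B_t)_{t\ge 0}$ be a standard Brownian motion, $(L_t)_{t\ge 0}$ its local time at $0$, $\tau_1=\inf\{t\ge 0:\ L_t>1\}$, and let $U$ be a uniform random variable on $[0,1]$ independent of $B$. Then the following identity in law holds: $$\Big(\frac{B_{U\tau_1}}{\sqrt{\tau_1}},\ \frac{1}{\sqrt{\tau_1}},\ L_{U\tau_1}\Big)\ \underset{\mathcal{L}}{=}\ \Big(\tfrac12 B_1,\ L_1,\ \Lambda\Big),$$ where $\Lambda$ is a uniform random variable on $[0,1]$ independent of $(B_1,L_1)$.
   Context: $\underset{\mathcal{L}}{=}$ denotes equality in law. Brownian motion starts from $0$. The local time $L$ at $0$ is normalized in the usual way (so that $|B_t|-L_t$ is a martingale); with this normalization, for $s>0$ the density of $(B_s,L_s)$ at $(x,l)\in\mathbb{R}\times\mathbb{R}^+$ is $\frac{1}{\sqrt{2\pi s^3}}(|x|+l)\exp\big(-\frac{(l+|x|)^2}{2s}\big)$. *)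

theory Defs
  imports "HOL-Probability.Probability"
begin

text \<open>
  Processes indexed by \<open>[0, \<infinity>)\<close> are functions \<open>real \<Rightarrow> 'a \<Rightarrow> real\<close> of which only the values at
  nonnegative times matter. Path properties are only required almost surely.
\<close>

definition standard_brownian_motion :: "'a measure \<Rightarrow> (real \<Rightarrow> 'a \<Rightarrow> real) \<Rightarrow> bool" where
  "standard_brownian_motion M B \<longleftrightarrow>
     (\<forall>t\<ge>0. B t \<in> borel_measurable M) \<and>
     (AE \<omega> in M. B 0 \<omega> = 0) \<and>
     (AE \<omega> in M. continuous_on {0..} (\<lambda>t. B t \<omega>)) \<and>
     (\<forall>s t. 0 \<le> s \<and> s < t \<longrightarrow>
        distributed M lborel (\<lambda>\<omega>. B t \<omega> - B s \<omega>) (normal_density 0 (sqrt (t - s)))) \<and>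
     (\<forall>(t :: nat \<Rightarrow> real) n. 0 \<le> t 0 \<and> mono t \<longrightarrow>
        prob_space.indep_vars M (\<lambda>_. borel) (\<lambda>i \<omega>. B (t (Suc i)) \<omega> - B (t i) \<omega>) {..<n})"

text \<open>
  The local time at \<open>0\<close> is the continuous version of the density at \<open>0\<close> of the occupation measure
  of \<open>B\<close> with respect to Lebesgue measure. The factor \<open>1 / (2 * \<epsilon>)\<close> is the normalization for which
  \<open>\<bar>B t\<bar> - L t\<close> is a martingale.
\<close>

definition local_time_at_0 ::
    "'a measure \<Rightarrow> (real \<Rightarrow> 'a \<Rightarrow> real) \<Rightarrow> (real \<Rightarrow> 'a \<Rightarrow> real) \<Rightarrow> bool" where
  "local_time_at_0 M B L \<longleftrightarrow>
     (\<forall>t\<ge>0. L t \<in> borel_measurable M) \<and>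
     (AE \<omega> in M. continuous_on {0..} (\<lambda>t. L t \<omega>)) \<and>
     (AE \<omega> in M. \<forall>t\<ge>0.
        ((\<lambda>\<epsilon>. measure lborel {s \<in> {0..t}. \<bar>B s \<omega>\<bar> < \<epsilon>} / (2 * \<epsilon>)) \<longlongrightarrow> L t \<omega>) (at_right 0))"

text \<open>
  For the local time \<open>L\<close> of a Brownian motion the set below is almost surely nonempty; where it is
  empty, the infimum is an unspecified real number.
\<close>

definition inverse_local_time :: "(real \<Rightarrow> 'a \<Rightarrow> real) \<Rightarrow> real \<Rightarrow> 'a \<Rightarrow> real" where
  "inverse_local_time L l \<omega> = Inf {t. 0 \<le> t \<and> L t \<omega> > l}"

definition uniform_on_unit_interval :: "'a measure \<Rightarrow> ('a \<Rightarrow> real) \<Rightarrow> bool" where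
  "uniform_on_unit_interval M U \<longleftrightarrow> distributed M lborel U (indicator {0..1})"

text \<open>
  Independence of two random elements whose value spaces may have different types, which
  \<^const>\<open>prob_space.indep_var\<close> does not allow.
\<close>

definition independent_rvs ::
    "'a measure \<Rightarrow> 'b measure \<Rightarrow> ('a \<Rightarrow> 'b) \<Rightarrow> 'c measure \<Rightarrow> ('a \<Rightarrow> 'c) \<Rightarrow> bool" where
  "independent_rvs M N X K Y \<longleftrightarrow>
     X \<in> measurable M N \<and> Y \<in> measurable M K \<and>
     prob_space.indep_set M (sets (vimage_algebra (space M) X N))
                            (sets (vimage_algebra (space M) Y K))"

text \<open>The process \<open>B\<close> as a random element of \<open>\<real>\<^bsup>[0, \<infinity>)\<^esup>\<close> with the product \<open>\<sigma>\<close>-algebra.\<close>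

definition process_map :: "(real \<Rightarrow> 'a \<Rightarrow> real) \<Rightarrow> 'a \<Rightarrow> real \<Rightarrow> real" where
  "process_map B \<omega> = (\<lambda>t\<in>{0..}. B t \<omega>)"

abbreviation path_algebra :: "(real \<Rightarrow> real) measure" where
  "path_algebra \<equiv> \<Pi>\<^sub>M t\<in>{0..}. borel"

text \<open>
  Since paths are only almost surely continuous, a process evaluated at a random time need only be
  measurable up to a null set. Laws are therefore taken with respect to the completed measure; for
  random elements that are measurable with respect to \<open>M\<close> itself this is the usual law.
\<close>

definition equal_in_law :: "'a measure \<Rightarrow> ('a \<Rightarrow> 'b::topological_space) \<Rightarrow> ('a \<Rightarrow> 'b) \<Rightarrow> bool" where
  "equal_in_law M X Y \<longleftrightarrow>
     X \<in> borel_measurable (completion M) \<and> Y \<in> borel_measurable (completion M) \<and>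
     distr (completion M) borel X = distr (completion M) borel Y"

end

theory Submission
  imports Defs
begin

text \<open>
  The law of \<open>(B t, L t)\<close> comes from a Volterra equation. With the occupation density of
  \<open>(- \<epsilon>, \<epsilon>)\<close> in place of \<open>L\<close>, the Markov property gives a Duhamel equation for the transform
  \<open>E (\<phi> (B t) * exp (- lam * L t))\<close>, and as \<open>\<epsilon>\<close> tends to \<open>0\<close> its solutions converge to the solution
  of the limiting equation, which is the transform of the density
  \<open>hit t (\<bar>x\<bar> + l) = (\<bar>x\<bar> + l) / t * heat t (\<bar>x\<bar> + l)\<close>. The same argument, applied after a time \<open>s\<close>, shows that
  given \<open>B s = x\<close> and \<open>L s = l < 1\<close> the remaining time \<open>\<tau>\<^sub>1 - s\<close> has density \<open>hit r (\<bar>x\<bar> + 1 - l)\<close>.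

  Averaging over \<open>U\<close> turns the left-hand side of the theorem into
  \<open>\<integral> E (1\<^bsub>s \<le> \<tau>\<^sub>1\<^esub> f (B s / sqrt \<tau>\<^sub>1, 1 / sqrt \<tau>\<^sub>1, L s) / \<tau>\<^sub>1) ds\<close>. Since hitting densities convolve,
  \<open>hit (\<bar>x\<bar> + l) * hit (\<bar>x\<bar> + 1 - l) = hit (2 \<bar>x\<bar> + 1)\<close>, the dependence on \<open>l\<close> disappears, and the
  substitution \<open>t = 1 / c\<^sup>2\<close>, \<open>x = y / (2 c)\<close> produces the density of \<open>(B 1 / 2, L 1)\<close>.
\<close>


section \<open>Substitution rules\<close>

text \<open>Everything happens at fixed times. The event \<open>t \<le> \<tau>\<^sub>1\<close> is
  \<open>L t \<le> 1\<close>, so the joint law of \<open>(B s, L s)\<close> and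
  \<open>\<tau>\<^sub>1\<close> on \<open>s \<le> \<tau>\<^sub>1\<close> is read off from
  \<open>(B s, L s)\<close> and the value of \<open>L\<close> at one later time, and the Markov
  property is applied at deterministic times.

  The obstacle is that the local time is given only as a limit of occupation densities. For positive
  \<epsilon> the Duhamel equation does not close at the origin: the path restarts anywhere in
  \<open>(- \<epsilon>, \<epsilon>)\<close>. The transform is therefore compared with the limiting
  solution uniformly over starting points \<open>\<bar>y\<bar> \<le> \<epsilon>\<close>, in a
  supremum norm with an exponential weight for which the Volterra operator is a contraction. The
  resulting error is of order \<open>sqrt \<epsilon>\<close>.

  Since \<open>U\<close> is independent of the process as a random element of a product space,
  position, local time and inverse local time must all be written as measurable functionals of the
  path, although the path properties hold only almost surely. The processes are first modified on a
  null set for this purpose.\<close>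

lemma nn_integral_substitution_greaterThan:
  fixes f :: "real \<Rightarrow> ennreal" and g g' :: "real \<Rightarrow> real"
  assumes [measurable]: "f \<in> borel_measurable borel"
    and deriv: "\<And>x. 0 < x \<Longrightarrow> (g has_real_derivative g' x) (at x)"
    and cont: "continuous_on {0<..} g'"
    and pos: "\<And>x. 0 < x \<Longrightarrow> 0 < g' x"
  shows "(\<integral>\<^sup>+x. f x * indicator (g ` {0<..}) x \<partial>lborel) =
         (\<integral>\<^sup>+x. f (g x) * ennreal (g' x) * indicator {0<..} x \<partial>lborel)"
proof -
  \<comment> \<open>Compact intervals that exhaust the half-line and whose images exhaust the image
    of \<open>g\<close>; both sides are then monotone limits. The shift by 2 gives
    \<open>a n < b n\<close> already at \<open>n = 0\<close>.\<close>
  define a b :: "nat \<Rightarrow> real" where "a n = 1 / (real n + 2)" and "b n = real n + 2" for n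
  have ab: "0 < a n" "a n < b n" for n
    using divide_le_eq_1_pos[of "real n + 2" 1] by (simp_all add: a_def b_def, linarith)
  have mono: "incseq (\<lambda>n. {a n..b n})"
    by (auto simp: incseq_def a_def b_def intro: order_trans[rotated] divide_left_mono)
  have g_mono: "g x \<le> g y" if "0 < x" "x \<le> y" for x y
    by (rule DERIV_nonneg_imp_nondecreasing[OF \<open>x \<le> y\<close>])
       (use that deriv pos less_imp_le in \<open>meson less_le_trans\<close>)
  have gmono: "incseq (\<lambda>n. {g (a n)..g (b n)})"
  proof (rule monoI)
    fix m n :: nat assume "m \<le> n"
    with mono have "{a m..b m} \<subseteq> {a n..b n}" by (simp add: incseq_def)
    then have "a n \<le> a m" "b m \<le> b n" using ab[of m] by auto
    then show "{g (a m)..g (b m)} \<subseteq> {g (a n)..g (b n)}"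
      using ab[of m] ab[of n] g_mono[of "a n" "a m"] g_mono[of "b m" "b n"] by fastforce
  qed
  have UN: "(\<Union>n. {a n..b n}) = {0<..}"
  proof safe
    fix x :: real assume "0 < x"
    obtain n :: nat where n: "1 / x + x < real n" using reals_Archimedean2 by blast
    with \<open>0 < x\<close> have "x \<le> b n" using divide_pos_pos[of 1 x] unfolding b_def by linarith
    moreover have "1 / x \<le> real n + 2" using n \<open>0 < x\<close> by linarith
    then have "a n \<le> x" using \<open>0 < x\<close> by (simp add: a_def field_simps)
    ultimately show "x \<in> (\<Union>n. {a n..b n})" by auto
  qed (use ab in \<open>auto intro: less_le_trans\<close>)
  have cg: "continuous_on {0<..} g"
    using deriv by (auto intro!: continuous_at_imp_continuous_on DERIV_isCont)
  have gUN: "(\<Union>n. {g (a n)..g (b n)}) = g ` {0<..}"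
  proof safe
    fix y n assume "y \<in> {g (a n)..g (b n)}"
    moreover have "continuous_on {a n..b n} g"
      by (rule continuous_on_subset[OF cg]) (use ab[of n] in auto)
    ultimately obtain x where "a n \<le> x" "g x = y"
      using IVT'[of g "a n" y "b n"] ab[of n] by auto
    then show "y \<in> g ` {0<..}" using ab[of n] by auto
  next
    fix x :: real assume "0 < x"
    then have "x \<in> (\<Union>n. {a n..b n})" by (simp add: UN)
    then obtain n where "x \<in> {a n..b n}" by blast
    then have "g (a n) \<le> g x" "g x \<le> g (b n)" using ab[of n] \<open>0 < x\<close> by (auto intro: g_mono)
    then show "g x \<in> (\<Union>n. {g (a n)..g (b n)})" by auto
  qed
  \<comment> \<open>\<open>g\<close> and \<open>g'\<close> are continuous only on the open
    half-line; the indicator extends them by 0 to measurable functions on the line.\<close>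
  have [measurable]: "(\<lambda>x. indicator {0<..} x * g x) \<in> borel_measurable borel"
      "(\<lambda>x. indicator {0<..} x * g' x) \<in> borel_measurable borel"
    using borel_measurable_continuous_on_indicator[OF _ cg]
      borel_measurable_continuous_on_indicator[OF _ cont] by auto
  let ?h = "\<lambda>x. f (indicator {0<..} x * g x) * ennreal (indicator {0<..} x * g' x)"
  have SUPI: "(SUP n. c * indicator (A n) x) = c * indicator (\<Union>n. A n) x"
    for c :: ennreal and A :: "nat \<Rightarrow> real set" and x
    by (rule antisym; cases "x \<in> (\<Union>n. A n)")
       (auto intro!: SUP_least intro: SUP_upper2 split: split_indicator)
  have inc: "incseq (\<lambda>n x. c x * indicator (A n) x)"
    if "incseq A" for c :: "real \<Rightarrow> ennreal" and A :: "nat \<Rightarrow> real set"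
  proof (intro monoI le_funI)
    fix m n :: nat and x :: real assume "m \<le> n"
    then have "A m \<subseteq> A n" using that by (simp add: incseq_def)
    then show "c x * indicator (A m) x \<le> c x * indicator (A n) x"
      by (intro mult_left_mono) (auto split: split_indicator)
  qed
  have "(\<integral>\<^sup>+x. f x * indicator (g ` {0<..}) x \<partial>lborel)
      = (\<integral>\<^sup>+x. (SUP n. f x * indicator {g (a n)..g (b n)} x) \<partial>lborel)"
    by (simp add: SUPI gUN)
  also have "\<dots> = (SUP n. \<integral>\<^sup>+x. f x * indicator {g (a n)..g (b n)} x \<partial>lborel)"
    by (rule nn_integral_monotone_convergence_SUP)
       (use inc[OF gmono] in auto)
  also have "\<dots> = (SUP n. \<integral>\<^sup>+x. ?h x * indicator {a n..b n} x \<partial>lborel)"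
  proof (rule SUP_cong[OF refl])
    fix n :: nat
    have "(\<integral>\<^sup>+x. f x * indicator {g (a n)..g (b n)} x \<partial>lborel)
        = (\<integral>\<^sup>+x. f (g x) * g' x * indicator {a n..b n} x \<partial>lborel)"
    proof (rule nn_integral_substitution_aux)
      fix x assume "x \<in> {a n..b n}"
      then have "0 < x" using ab[of n] by auto
      then show "(g has_real_derivative g' x) (at x)" "0 \<le> g' x"
        using deriv pos[of x] by auto
    next
      show "continuous_on {a n..b n} g'"
        by (rule continuous_on_subset[OF cont]) (use ab[of n] in auto)
    qed (use ab in auto)
    also have "\<dots> = (\<integral>\<^sup>+x. ?h x * indicator {a n..b n} x \<partial>lborel)"
      using ab[of n] by (intro nn_integral_cong) (auto split: split_indicator)
    finally show "(\<integral>\<^sup>+x. f x * indicator {g (a n)..g (b n)} x \<partial>lborel)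
        = (\<integral>\<^sup>+x. ?h x * indicator {a n..b n} x \<partial>lborel)" .
  qed
  also have "\<dots> = (\<integral>\<^sup>+x. (SUP n. ?h x * indicator {a n..b n} x) \<partial>lborel)"
    by (rule nn_integral_monotone_convergence_SUP[symmetric])
       (use inc[OF mono] in auto)
  also have "\<dots> = (\<integral>\<^sup>+x. ?h x * indicator {0<..} x \<partial>lborel)"
    by (simp add: SUPI UN)
  also have "\<dots> = (\<integral>\<^sup>+x. f (g x) * ennreal (g' x) * indicator {0<..} x \<partial>lborel)"
    by (intro nn_integral_cong) (auto split: split_indicator)
  finally show ?thesis .
qed

text \<open>Reflection of the axis turns \<open>g\<close> into the increasing function
  \<open>- g\<close>. The sign convention keeps \<open>g'\<close> positive.\<close>

lemma nn_integral_substitution_greaterThan_antimono: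
  fixes f :: "real \<Rightarrow> ennreal" and g g' :: "real \<Rightarrow> real"
  assumes [measurable]: "f \<in> borel_measurable borel"
    and deriv: "\<And>x. 0 < x \<Longrightarrow> (g has_real_derivative - g' x) (at x)"
    and cont: "continuous_on {0<..} g'"
    and pos: "\<And>x. 0 < x \<Longrightarrow> 0 < g' x"
    and [measurable]: "g ` {0<..} \<in> sets borel"
  shows "(\<integral>\<^sup>+x. f x * indicator (g ` {0<..}) x \<partial>lborel) =
         (\<integral>\<^sup>+x. f (g x) * ennreal (g' x) * indicator {0<..} x \<partial>lborel)"
proof -
  have "(\<integral>\<^sup>+x. f x * indicator (g ` {0<..}) x \<partial>lborel) =
      (\<integral>\<^sup>+x. f (- x) * indicator (g ` {0<..}) (- x) \<partial>lborel)"
    by (subst nn_integral_real_affine[of _ "-1" 0]) simp_all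
  also have "\<dots> = (\<integral>\<^sup>+x. f (- x) * indicator ((\<lambda>x. - g x) ` {0<..}) x \<partial>lborel)"
    by (intro nn_integral_cong) (force split: split_indicator)
  also have "\<dots> = (\<integral>\<^sup>+x. f (- (- g x)) * ennreal (g' x) * indicator {0<..} x \<partial>lborel)"
    by (rule nn_integral_substitution_greaterThan)
       (use cont pos in \<open>auto intro!: derivative_eq_intros deriv\<close>)
  finally show ?thesis by simp
qed

section \<open>Heat kernel and hitting time densities\<close>

text \<open>The centred Gaussian density of variance \<open>t\<close>. At \<open>t = 0\<close>
  division by zero makes it 0 rather than a point mass, so time 0 is treated separately wherever it
  matters.\<close>

definition heat :: "real \<Rightarrow> real \<Rightarrow> real" where
  "heat t x = exp (- (x\<^sup>2) / (2 * t)) / sqrt (2 * pi * t)"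

text \<open>The density at time \<open>t\<close> of the first hitting time of the level \<open>a > 0\<close>.\<close>

definition hit :: "real \<Rightarrow> real \<Rightarrow> real" where
  "hit t a = a / t * heat t a"

lemma heat_measurable [measurable (raw)]:
  assumes [measurable]: "f \<in> borel_measurable M" "g \<in> borel_measurable M"
  shows "(\<lambda>x. heat (f x) (g x)) \<in> borel_measurable M"
  unfolding heat_def by measurable

lemma hit_measurable [measurable (raw)]:
  assumes [measurable]: "f \<in> borel_measurable M" "g \<in> borel_measurable M"
  shows "(\<lambda>x. hit (f x) (g x)) \<in> borel_measurable M"
  unfolding hit_def by measurable

lemma heat_nonneg [simp]: "0 \<le> t \<Longrightarrow> 0 \<le> heat t x"
  by (simp add: heat_def)

lemma hit_nonneg [simp]: "0 \<le> t \<Longrightarrow> 0 \<le> a \<Longrightarrow> 0 \<le> hit t a"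
  by (simp add: hit_def)

lemma heat_minus [simp]: "heat t (- x) = heat t x"
  by (simp add: heat_def)

lemma heat_abs [simp]: "heat t \<bar>x\<bar> = heat t x"
  by (simp add: heat_def)

lemma heat_minus_commute: "heat t (x - y) = heat t (y - x)"
  by (simp add: heat_def power2_commute)

lemma normal_density_eq_heat: "0 < t \<Longrightarrow> normal_density 0 (sqrt t) = heat t"
  by (auto simp: fun_eq_iff normal_density_def heat_def)

lemma heat_le: "0 < t \<Longrightarrow> heat t x \<le> heat t 0"
  unfolding heat_def by (intro divide_right_mono) auto

lemma nn_integral_heat: "0 < t \<Longrightarrow> (\<integral>\<^sup>+x. heat t x \<partial>lborel) = 1"
  using prob_space.emeasure_space_1[OF prob_space_normal_density[of "sqrt t" 0]]
  by (simp add: emeasure_density normal_density_eq_heat)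

lemma nn_integral_heat_shift:
  assumes "0 < t" shows "(\<integral>\<^sup>+x. heat t (x - a) \<partial>lborel) = 1"
  using nn_integral_heat[OF assms] by (subst nn_integral_real_affine[of _ 1 a]) auto

lemma nn_integral_even:
  fixes f :: "real \<Rightarrow> ennreal"
  assumes [measurable]: "f \<in> borel_measurable borel" and even: "\<And>x. f (- x) = f x"
  shows "(\<integral>\<^sup>+x. f x \<partial>lborel) = 2 * (\<integral>\<^sup>+x\<in>{0<..}. f x \<partial>lborel)"
proof -
  have "(\<integral>\<^sup>+x\<in>{..<0}. f x \<partial>lborel) = (\<integral>\<^sup>+x\<in>{0<..}. f x \<partial>lborel)"
    by (subst nn_integral_real_affine[of _ "-1" 0])
       (auto intro!: nn_integral_cong simp: even split: split_indicator)
  moreover have "(\<integral>\<^sup>+x. f x \<partial>lborel) = (\<integral>\<^sup>+x. f x * indicator {0<..} x + f x * indicator {..<0} x \<partial>lborel)"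
    by (intro nn_integral_cong_AE eventually_mono[OF AE_lborel_singleton[of 0]])
       (simp split: split_indicator)
  ultimately show ?thesis
    by (simp add: nn_integral_add mult_2)
qed

lemma ennreal_eq_half_if_double:
  fixes x :: ennreal
  assumes "2 * x = 1" shows "x = ennreal (1 / 2)"
proof (cases x)
  case (real r)
  then have "ennreal (2 * r) = ennreal 1" using assms by (simp add: ennreal_mult')
  then have "2 * r = 1" using real by (simp only: ennreal_inj)
  then have "r = 1 / 2" by simp
  then show ?thesis using real by (simp only:)
qed (use assms in simp)

lemma nn_integral_heat_half:
  assumes "0 < t" shows "(\<integral>\<^sup>+x\<in>{0<..}. heat t x \<partial>lborel) = ennreal (1 / 2)"
proof (rule ennreal_eq_half_if_double)
  have "2 * (\<integral>\<^sup>+x\<in>{0<..}. heat t x \<partial>lborel) = (\<integral>\<^sup>+x. heat t x \<partial>lborel)"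
    by (rule nn_integral_even[symmetric]) auto
  then show "2 * (\<integral>\<^sup>+x\<in>{0<..}. heat t x \<partial>lborel) = 1"
    by (simp only: nn_integral_heat[OF assms])
qed

lemma DERIV_heat: "0 < t \<Longrightarrow> (heat t has_real_derivative - hit t x) (at x)"
  unfolding heat_def [abs_def] hit_def
  by (auto intro!: derivative_eq_intros simp: field_simps)

text \<open>The Cauchy--Schloemilch substitution: the two integrals are exchanged by
  \<open>\<rho> \<mapsto> b / (a \<rho>)\<close>, and their sum is the integral of \<open>heat t\<close> over the line.\<close>

lemma nn_integral_Cauchy_Schloemilch:
  assumes t: "0 < t" and a: "0 < a" and b: "0 < b"
  shows "(\<integral>\<^sup>+\<rho>\<in>{0<..}. ennreal (a * heat t (a * \<rho> - b / \<rho>)) \<partial>lborel) = ennreal (1 / 2)"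
    and "(\<integral>\<^sup>+\<rho>\<in>{0<..}. ennreal (b / \<rho>\<^sup>2 * heat t (a * \<rho> - b / \<rho>)) \<partial>lborel) = ennreal (1 / 2)"
proof -
  let ?A = "\<integral>\<^sup>+\<rho>\<in>{0<..}. ennreal (a * heat t (a * \<rho> - b / \<rho>)) \<partial>lborel"
  let ?B = "\<integral>\<^sup>+\<rho>\<in>{0<..}. ennreal (b / \<rho>\<^sup>2 * heat t (a * \<rho> - b / \<rho>)) \<partial>lborel"
  have surj: "\<exists>x>0. v = a * x - b / x" for v
  proof -
    \<comment> \<open>The positive root of \<open>a * x\<^sup>2 - v * x - b = 0\<close>.\<close>
    let ?x = "(v + sqrt (v\<^sup>2 + 4 * a * b)) / (2 * a)"
    have "\<bar>v\<bar> < sqrt (v\<^sup>2 + 4 * a * b)"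
      using a b by (intro real_less_rsqrt) (simp add: power2_eq_square)
    then have pos: "0 < ?x" using a by simp
    have sq: "sqrt (v\<^sup>2 + 4 * a * b) * sqrt (v\<^sup>2 + 4 * a * b) = v\<^sup>2 + 4 * a * b"
      using a b by simp
    have eq: "a * ?x * ?x - b = v * ?x"
      using a sq by (simp add: field_simps power2_eq_square)
    have "v = a * x - b / x" if "0 < x" "a * x * x - b = v * x" for x
      using that by (simp add: field_simps)
    with pos eq show ?thesis by blast
  qed
  have img: "(\<lambda>x. a * x - b / x) ` {0<..} = UNIV"
    using surj by (auto simp: image_def)
  have img2: "(\<lambda>x. b / (a * x)) ` {0<..} = {0<..}"
  proof safe
    fix y :: real assume "0 < y"
    then show "y \<in> (\<lambda>x. b / (a * x)) ` {0<..}"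
      using a b by (intro image_eqI[of _ _ "b / (a * y)"]) auto
  qed (use a b in auto)
  \<comment> \<open>The Jacobian of \<open>\<rho> \<mapsto> a * \<rho> - b / \<rho>\<close> is the
    sum of the weights \<open>a\<close> and \<open>b / \<rho>\<^sup>2\<close>, so the mass 1 of
    \<open>heat t\<close> is the sum of the two integrals.\<close>
  have "(\<integral>\<^sup>+v. ennreal (heat t v) * indicator ((\<lambda>x. a * x - b / x) ` {0<..}) v \<partial>lborel)
      = (\<integral>\<^sup>+\<rho>. ennreal (heat t (a * \<rho> - b / \<rho>)) * ennreal (a + b / \<rho>\<^sup>2) * indicator {0<..} \<rho> \<partial>lborel)"
    using a b
    by (intro nn_integral_substitution_greaterThan)
       (auto intro!: derivative_eq_intros continuous_intros add_pos_pos simp: power2_eq_square)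
  also have "\<dots> = (\<integral>\<^sup>+\<rho>. ennreal (a * heat t (a * \<rho> - b / \<rho>)) * indicator {0<..} \<rho> +
      ennreal (b / \<rho>\<^sup>2 * heat t (a * \<rho> - b / \<rho>)) * indicator {0<..} \<rho> \<partial>lborel)"
    using a b t
    by (intro nn_integral_cong)
       (auto simp: ennreal_mult'[symmetric] ennreal_plus[symmetric] distrib_right mult.commute[of "heat _ _"]
             simp del: ennreal_plus split: split_indicator)
  also have "\<dots> = ?A + ?B"
    by (subst nn_integral_add) auto
  finally have sum: "?A + ?B = 1"
    using nn_integral_heat[OF t] by (simp add: img)
  have "(\<integral>\<^sup>+x. ennreal (a * heat t (a * x - b / x)) * indicator ((\<lambda>x. b / (a * x)) ` {0<..}) x \<partial>lborel)
     = (\<integral>\<^sup>+\<rho>. ennreal (a * heat t (a * (b / (a * \<rho>)) - b / (b / (a * \<rho>)))) * ennreal (b / (a * \<rho>\<^sup>2)) * indicator {0<..} \<rho> \<partial>lborel)"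
    using a b
    by (intro nn_integral_substitution_greaterThan_antimono)
       (auto intro!: derivative_eq_intros continuous_intros simp: power2_eq_square img2)
  also have "\<dots> = ?B"
  proof (intro nn_integral_cong)
    fix \<rho> :: real
    have "heat t (a * (b / (a * \<rho>)) - b / (b / (a * \<rho>))) = heat t (a * \<rho> - b / \<rho>)"
      using a b by (subst heat_minus_commute) (cases "\<rho> = 0", auto simp: field_simps)
    then show "ennreal (a * heat t (a * (b / (a * \<rho>)) - b / (b / (a * \<rho>)))) * ennreal (b / (a * \<rho>\<^sup>2)) * indicator {0<..} \<rho>
       = ennreal (b / \<rho>\<^sup>2 * heat t (a * \<rho> - b / \<rho>)) * indicator {0<..} \<rho>"
      using a b t by (auto simp: ennreal_mult'[symmetric] field_simps split: split_indicator)
  qed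
  finally have AB: "?A = ?B" by (simp add: img2)
  show A: "?A = ennreal (1 / 2)"
    using sum AB by (intro ennreal_eq_half_if_double) (simp add: mult_2)
  with AB show "?B = ennreal (1 / 2)" by simp
qed

text \<open>Includes \<open>b = 0\<close>, where the exchange of the two integrals breaks down; the
  Volterra equation convolves with \<open>heat s 0\<close>.\<close>

lemma nn_integral_heat_linear_half:
  assumes t: "0 < t" and a: "0 < a" and b: "0 \<le> b"
  shows "(\<integral>\<^sup>+\<rho>\<in>{0<..}. ennreal (a * heat t (a * \<rho> - b / \<rho>)) \<partial>lborel) = ennreal (1 / 2)"
proof (cases "b = 0")
  case True
  have img: "(*) a ` {0<..} = {0<..}"
  proof safe
    fix y :: real assume "0 < y"
    then show "y \<in> (*) a ` {0<..}"
      using a by (intro image_eqI[of _ _ "y / a"]) auto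
  qed (use a in auto)
  have "(\<integral>\<^sup>+v. ennreal (heat t v) * indicator ((*) a ` {0<..}) v \<partial>lborel)
      = (\<integral>\<^sup>+\<rho>. ennreal (heat t (a * \<rho>)) * ennreal a * indicator {0<..} \<rho> \<partial>lborel)"
    using a
    by (intro nn_integral_substitution_greaterThan)
       (auto intro!: derivative_eq_intros)
  also have "\<dots> = (\<integral>\<^sup>+\<rho>\<in>{0<..}. ennreal (a * heat t (a * \<rho> - b / \<rho>)) \<partial>lborel)"
    using True a t by (intro nn_integral_cong) (simp add: ennreal_mult' mult.commute)
  finally show ?thesis
    using nn_integral_heat_half[OF t] by (simp add: img)
qed (use nn_integral_Cauchy_Schloemilch(1)[OF t a, of b] b in auto)

text \<open>Convolutions over \<open>0 < s < t\<close> are computed with \<open>s = t \<rho>\<^sup>2 / (1 + \<rho>\<^sup>2)\<close>.\<close>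

lemma nn_integral_Ioo_substitution:
  fixes f :: "real \<Rightarrow> ennreal"
  assumes [measurable]: "f \<in> borel_measurable borel" and t: "0 < t"
  shows "(\<integral>\<^sup>+s\<in>{0<..<t}. f s \<partial>lborel) =
    (\<integral>\<^sup>+\<rho>\<in>{0<..}. f (t * \<rho>\<^sup>2 / (1 + \<rho>\<^sup>2)) * ennreal (2 * t * \<rho> / (1 + \<rho>\<^sup>2)\<^sup>2) \<partial>lborel)"
proof -
  have pos: "0 < 1 + x\<^sup>2" for x :: real
    by (rule add_pos_nonneg) auto
  have ne: "1 + x\<^sup>2 \<noteq> 0" for x :: real using pos[of x] by linarith
  have img: "(\<lambda>\<rho>. t * \<rho>\<^sup>2 / (1 + \<rho>\<^sup>2)) ` {0<..} = {0<..<t}"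
  proof (intro antisym subsetI)
    fix s assume s: "s \<in> {0<..<t}"
    show "s \<in> (\<lambda>\<rho>. t * \<rho>\<^sup>2 / (1 + \<rho>\<^sup>2)) ` {0<..}"
    proof (rule image_eqI)
      have "1 + s / (t - s) = t / (t - s)" using s by (simp add: divide_simps)
      then show "s = t * (sqrt (s / (t - s)))\<^sup>2 / (1 + (sqrt (s / (t - s)))\<^sup>2)"
        using s t by simp
    qed (use s in auto)
  next
    fix s assume "s \<in> (\<lambda>\<rho>. t * \<rho>\<^sup>2 / (1 + \<rho>\<^sup>2)) ` {0<..}"
    then obtain \<rho> where \<rho>: "0 < \<rho>" "s = t * \<rho>\<^sup>2 / (1 + \<rho>\<^sup>2)" by auto
    have "t * \<rho>\<^sup>2 < t * (1 + \<rho>\<^sup>2)" using t by simp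
    then have "s < t" using pos[of \<rho>] \<rho>(2) by (simp only: pos_divide_less_eq)
    moreover have "0 < s" using \<rho> t pos[of \<rho>] by simp
    ultimately show "s \<in> {0<..<t}" by simp
  qed
  have "(\<integral>\<^sup>+s. f s * indicator ((\<lambda>\<rho>. t * \<rho>\<^sup>2 / (1 + \<rho>\<^sup>2)) ` {0<..}) s \<partial>lborel) =
    (\<integral>\<^sup>+\<rho>\<in>{0<..}. f (t * \<rho>\<^sup>2 / (1 + \<rho>\<^sup>2)) * ennreal (2 * t * \<rho> / (1 + \<rho>\<^sup>2)\<^sup>2) \<partial>lborel)"
  proof (rule nn_integral_substitution_greaterThan)
    fix x :: real
    show "((\<lambda>\<rho>. t * \<rho>\<^sup>2 / (1 + \<rho>\<^sup>2)) has_real_derivative 2 * t * x / (1 + x\<^sup>2)\<^sup>2) (at x)"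
    proof -
      have "((\<lambda>\<rho>. t * \<rho>\<^sup>2 / (1 + \<rho>\<^sup>2)) has_real_derivative
          ((t * (2 * x)) * (1 + x\<^sup>2) - t * x\<^sup>2 * (2 * x)) / ((1 + x\<^sup>2) * (1 + x\<^sup>2))) (at x)"
        by (rule DERIV_divide) (auto intro!: derivative_eq_intros simp: ne)
      also have "(t * (2 * x)) * (1 + x\<^sup>2) - t * x\<^sup>2 * (2 * x) = 2 * t * x"
        by (simp add: algebra_simps)
      finally show ?thesis by (simp only: power2_eq_square[of "1 + x\<^sup>2"])
    qed
    show "0 < 2 * t * x / (1 + x\<^sup>2)\<^sup>2" if "0 < x"
      using that t pos[of x] by simp
    show "continuous_on {0<..} (\<lambda>\<rho>. 2 * t * \<rho> / (1 + \<rho>\<^sup>2)\<^sup>2)"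
      using ne by (intro continuous_intros) auto
  qed simp
  then show ?thesis by (simp add: img)
qed

section \<open>Convolutions of Gaussian and first-passage densities\<close>

text \<open>With \<open>s = t * \<rho>\<^sup>2 / (1 + \<rho>\<^sup>2)\<close> one has
  \<open>b\<^sup>2 / s + a\<^sup>2 / (t - s) = ((a + b)\<^sup>2 + (a * \<rho> - b / \<rho>)\<^sup>2)
  / t\<close>: the mixed terms cancel, and only the second square depends on
  \<open>\<rho>\<close>.\<close>

lemma heat_mult_heat:
  assumes t: "0 < t" and \<rho>: "0 < \<rho>"
  shows "heat (t * \<rho>\<^sup>2 / (1 + \<rho>\<^sup>2)) b * heat (t - t * \<rho>\<^sup>2 / (1 + \<rho>\<^sup>2)) a =
    (1 + \<rho>\<^sup>2) / \<rho> * (heat t (a + b) * heat t (a * \<rho> - b / \<rho>))"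
proof -
  have pos: "0 < 1 + \<rho>\<^sup>2" by (rule add_pos_nonneg) auto
  have s': "t - t * \<rho>\<^sup>2 / (1 + \<rho>\<^sup>2) = t / (1 + \<rho>\<^sup>2)"
    using pos by (simp add: field_simps)
  have e: "- (b\<^sup>2) / (2 * (t * \<rho>\<^sup>2 / (1 + \<rho>\<^sup>2))) + - (a\<^sup>2) / (2 * (t / (1 + \<rho>\<^sup>2)))
     = - ((a + b)\<^sup>2) / (2 * t) + - ((a * \<rho> - b / \<rho>)\<^sup>2) / (2 * t)"
    using t \<rho> pos by (simp add: field_simps power2_eq_square)
  have q: "sqrt (2 * pi * (t * \<rho>\<^sup>2 / (1 + \<rho>\<^sup>2))) * sqrt (2 * pi * (t / (1 + \<rho>\<^sup>2))) = 2 * pi * t * \<rho> / (1 + \<rho>\<^sup>2)"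
  proof -
    have "sqrt (2 * pi * (t * \<rho>\<^sup>2 / (1 + \<rho>\<^sup>2))) * sqrt (2 * pi * (t / (1 + \<rho>\<^sup>2))) = sqrt ((2 * pi * t * \<rho> / (1 + \<rho>\<^sup>2))\<^sup>2)"
      by (simp add: real_sqrt_mult[symmetric] power2_eq_square field_simps)
    also have "\<dots> = 2 * pi * t * \<rho> / (1 + \<rho>\<^sup>2)"
      using t \<rho> pos by (intro real_sqrt_unique) auto
    finally show ?thesis .
  qed
  have q2: "sqrt (2 * pi * t) * sqrt (2 * pi * t) = 2 * pi * t" using t by simp
  have "heat (t * \<rho>\<^sup>2 / (1 + \<rho>\<^sup>2)) b * heat (t - t * \<rho>\<^sup>2 / (1 + \<rho>\<^sup>2)) a =
    exp (- (b\<^sup>2) / (2 * (t * \<rho>\<^sup>2 / (1 + \<rho>\<^sup>2))) + - (a\<^sup>2) / (2 * (t / (1 + \<rho>\<^sup>2)))) / (2 * pi * t * \<rho> / (1 + \<rho>\<^sup>2))"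
    unfolding heat_def s' exp_add times_divide_times_eq q ..
  also have "\<dots> = (1 + \<rho>\<^sup>2) / \<rho> * (heat t (a + b) * heat t (a * \<rho> - b / \<rho>))"
    unfolding heat_def e exp_add times_divide_times_eq q2 using \<rho> t pos by (simp add: field_simps)
  finally show ?thesis .
qed

text \<open>First-passage decomposition of a displacement by \<open>a + b\<close>: the level
  \<open>a\<close> is reached after time \<open>t - s\<close>, and \<open>b\<close> is covered in
  the remaining time \<open>s\<close>. In the variable \<open>\<rho>\<close> only the first
  Cauchy--Schloemilch integral is left.\<close>

lemma heat_convolution_hit:
  assumes t: "0 < t" and a: "0 < a" and b: "0 \<le> b"
  shows "(\<integral>\<^sup>+s\<in>{0<..<t}. ennreal (heat s b * hit (t - s) a) \<partial>lborel) = ennreal (heat t (a + b))"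
proof -
  have "(\<integral>\<^sup>+s\<in>{0<..<t}. ennreal (heat s b * hit (t - s) a) \<partial>lborel) =
      (\<integral>\<^sup>+\<rho>. ennreal (2 * heat t (a + b)) * (ennreal (a * heat t (a * \<rho> - b / \<rho>)) * indicator {0<..} \<rho>) \<partial>lborel)"
  proof (subst nn_integral_Ioo_substitution[OF _ t], measurable, intro nn_integral_cong)
    fix \<rho> :: real
    have *: "heat (t * \<rho>\<^sup>2 / (1 + \<rho>\<^sup>2)) b * hit (t - t * \<rho>\<^sup>2 / (1 + \<rho>\<^sup>2)) a * (2 * t * \<rho> / (1 + \<rho>\<^sup>2)\<^sup>2) =
        2 * heat t (a + b) * (a * heat t (a * \<rho> - b / \<rho>))" if "0 < \<rho>"
    proof -
      have pos: "0 < 1 + \<rho>\<^sup>2" by (rule add_pos_nonneg) auto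
      have s': "t - t * \<rho>\<^sup>2 / (1 + \<rho>\<^sup>2) = t / (1 + \<rho>\<^sup>2)"
        using pos by (simp add: field_simps)
      have "heat (t * \<rho>\<^sup>2 / (1 + \<rho>\<^sup>2)) b * hit (t - t * \<rho>\<^sup>2 / (1 + \<rho>\<^sup>2)) a =
         a * (1 + \<rho>\<^sup>2) / t * (heat (t * \<rho>\<^sup>2 / (1 + \<rho>\<^sup>2)) b * heat (t - t * \<rho>\<^sup>2 / (1 + \<rho>\<^sup>2)) a)"
        unfolding hit_def s' by simp
      also have "\<dots> * (2 * t * \<rho> / (1 + \<rho>\<^sup>2)\<^sup>2) = 2 * heat t (a + b) * (a * heat t (a * \<rho> - b / \<rho>))"
        unfolding heat_mult_heat[OF t that] using that t pos by (simp add: power2_eq_square[of "1 + \<rho>\<^sup>2"])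
      finally show ?thesis .
    qed
    show "ennreal (heat (t * \<rho>\<^sup>2 / (1 + \<rho>\<^sup>2)) b * hit (t - t * \<rho>\<^sup>2 / (1 + \<rho>\<^sup>2)) a) * ennreal (2 * t * \<rho> / (1 + \<rho>\<^sup>2)\<^sup>2) * indicator {0<..} \<rho>
      = ennreal (2 * heat t (a + b)) * (ennreal (a * heat t (a * \<rho> - b / \<rho>)) * indicator {0<..} \<rho>)"
      using * t a by (auto simp: ennreal_mult'[symmetric] ennreal_mult''[symmetric] split: split_indicator)
  qed
  also have "\<dots> = ennreal (2 * heat t (a + b)) * ennreal (1 / 2)"
    by (subst nn_integral_cmult) (simp_all add: nn_integral_heat_linear_half[OF t a b] del: ennreal_half)
  also have "\<dots> = ennreal (heat t (a + b))"
    using t by (simp add: ennreal_mult'[symmetric] del: ennreal_half)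
  finally show ?thesis .
qed

text \<open>The passage to \<open>a + b\<close> is the passage to \<open>a\<close> followed by an
  independent passage through \<open>b\<close>. Both Cauchy--Schloemilch integrals occur, with the
  factors \<open>a\<close> and \<open>b\<close>, and each contributes one half.\<close>

lemma hit_convolution_hit:
  assumes t: "0 < t" and a: "0 < a" and b: "0 < b"
  shows "(\<integral>\<^sup>+s\<in>{0<..<t}. ennreal (hit s a * hit (t - s) b) \<partial>lborel) = ennreal (hit t (a + b))"
proof -
  have "(\<integral>\<^sup>+s\<in>{0<..<t}. ennreal (hit s a * hit (t - s) b) \<partial>lborel) =
      (\<integral>\<^sup>+\<rho>. ennreal (2 / t * heat t (a + b)) * (ennreal a * (ennreal (b * heat t (b * \<rho> - a / \<rho>)) * indicator {0<..} \<rho>)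
         + ennreal b * (ennreal (a / \<rho>\<^sup>2 * heat t (b * \<rho> - a / \<rho>)) * indicator {0<..} \<rho>)) \<partial>lborel)"
  proof (subst nn_integral_Ioo_substitution[OF _ t], measurable, intro nn_integral_cong)
    fix \<rho> :: real
    have *: "hit (t * \<rho>\<^sup>2 / (1 + \<rho>\<^sup>2)) a * hit (t - t * \<rho>\<^sup>2 / (1 + \<rho>\<^sup>2)) b * (2 * t * \<rho> / (1 + \<rho>\<^sup>2)\<^sup>2) =
        2 / t * heat t (a + b) * (a * (b * heat t (b * \<rho> - a / \<rho>)) + b * (a / \<rho>\<^sup>2 * heat t (b * \<rho> - a / \<rho>)))" if "0 < \<rho>"
    proof -
      have pos: "0 < 1 + \<rho>\<^sup>2" by (rule add_pos_nonneg) auto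
      have s': "t - t * \<rho>\<^sup>2 / (1 + \<rho>\<^sup>2) = t / (1 + \<rho>\<^sup>2)"
        using pos by (simp add: field_simps)
      have "hit (t * \<rho>\<^sup>2 / (1 + \<rho>\<^sup>2)) a * hit (t - t * \<rho>\<^sup>2 / (1 + \<rho>\<^sup>2)) b =
         a * (1 + \<rho>\<^sup>2) / (t * \<rho>\<^sup>2) * (b * (1 + \<rho>\<^sup>2) / t) * (heat (t * \<rho>\<^sup>2 / (1 + \<rho>\<^sup>2)) a * heat (t - t * \<rho>\<^sup>2 / (1 + \<rho>\<^sup>2)) b)"
        unfolding hit_def s' by simp
      also have "\<dots> * (2 * t * \<rho> / (1 + \<rho>\<^sup>2)\<^sup>2) = 2 / t * heat t (a + b) * (a * (b * heat t (b * \<rho> - a / \<rho>)) + b * (a / \<rho>\<^sup>2 * heat t (b * \<rho> - a / \<rho>)))"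
        unfolding heat_mult_heat[OF t that] using that t pos
        by (simp add: power2_eq_square[of "1 + \<rho>\<^sup>2"] add.commute[of b a]) (simp add: field_simps power2_eq_square)
      finally show ?thesis .
    qed
    show "ennreal (hit (t * \<rho>\<^sup>2 / (1 + \<rho>\<^sup>2)) a * hit (t - t * \<rho>\<^sup>2 / (1 + \<rho>\<^sup>2)) b) * ennreal (2 * t * \<rho> / (1 + \<rho>\<^sup>2)\<^sup>2) * indicator {0<..} \<rho>
      = ennreal (2 / t * heat t (a + b)) * (ennreal a * (ennreal (b * heat t (b * \<rho> - a / \<rho>)) * indicator {0<..} \<rho>)
         + ennreal b * (ennreal (a / \<rho>\<^sup>2 * heat t (b * \<rho> - a / \<rho>)) * indicator {0<..} \<rho>))"
      using * t a b
      by (auto simp: ennreal_mult'[symmetric] ennreal_mult''[symmetric] ennreal_plus[symmetric]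
               simp del: ennreal_plus split: split_indicator)
  qed
  also have "\<dots> = ennreal (2 / t * heat t (a + b)) * (ennreal a * ennreal (1 / 2) + ennreal b * ennreal (1 / 2))"
    by (simp add: nn_integral_cmult nn_integral_add nn_integral_Cauchy_Schloemilch[OF t b a]
             del: ennreal_half times_divide_eq_left times_divide_eq_right)
  also have "\<dots> = ennreal (hit t (a + b))"
    using t a b by (simp add: ennreal_mult'[symmetric] ennreal_plus[symmetric] hit_def field_simps del: ennreal_half ennreal_plus)
  finally show ?thesis .
qed

section \<open>Integrals over the level, Laplace transform in time, continuity in space\<close>

lemma tendsto_heat_at_top: "0 < t \<Longrightarrow> (heat t \<longlongrightarrow> 0) at_top"
  unfolding heat_def by real_asymp

lemma nn_integral_hit_atLeast:
  assumes t: "0 < t" and b: "0 \<le> b"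
  shows "(\<integral>\<^sup>+a\<in>{b..}. ennreal (hit t a) \<partial>lborel) = ennreal (heat t b)"
proof -
  have "(\<integral>\<^sup>+a\<in>{b..}. ennreal (hit t a) \<partial>lborel) = 0 - (- heat t b)"
    by (rule nn_integral_FTC_atLeast)
       (use t b tendsto_minus[OF tendsto_heat_at_top[OF t]] in \<open>auto intro!: derivative_eq_intros DERIV_heat\<close>)
  then show ?thesis by simp
qed

text \<open>Integration by parts in \<open>l\<close>, as \<open>hit\<close> is minus the space
  derivative of \<open>heat\<close>. With \<open>b = \<bar>y\<bar>\<close> and integrated against
  \<open>\<phi> y\<close> this becomes the Volterra equation.\<close>

lemma nn_integral_exp_heat_hit:
  assumes t: "0 < t" and b: "0 \<le> b" and lam: "0 \<le> lam"
  shows "(\<integral>\<^sup>+l\<in>{0..}. ennreal (exp (- lam * l) * hit t (b + l)) \<partial>lborel) +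
    ennreal lam * (\<integral>\<^sup>+l\<in>{0..}. ennreal (exp (- lam * l) * heat t (b + l)) \<partial>lborel) = ennreal (heat t b)"
proof -
  have "((\<lambda>l. exp (- lam * l) * heat t (b + l)) \<longlongrightarrow> 0) at_top"
  proof (rule tendsto_0_le[of "\<lambda>l. heat t (b + l)" _ _ 1])
    show "((\<lambda>l. heat t (b + l)) \<longlongrightarrow> 0) at_top"
      using t unfolding heat_def by real_asymp
    show "\<forall>\<^sub>F x in at_top. norm (exp (- lam * x) * heat t (b + x)) \<le> norm (heat t (b + x)) * 1"
      using eventually_ge_at_top[of 0] by eventually_elim (use lam t in \<open>auto simp: abs_mult intro!: mult_left_le_one_le\<close>)
  qed
  from tendsto_minus[OF this]
  have lim: "((\<lambda>l. - (exp (- lam * l) * heat t (b + l))) \<longlongrightarrow> 0) at_top" by simp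
  have "(\<integral>\<^sup>+l\<in>{0..}. ennreal (exp (- lam * l) * hit t (b + l) + lam * (exp (- lam * l) * heat t (b + l))) \<partial>lborel)
     = 0 - (- (exp (- lam * 0) * heat t (b + 0)))"
  proof (rule nn_integral_FTC_atLeast[OF _ _ _ lim])
    fix l :: real assume "0 \<le> l"
    have "((\<lambda>l. heat t (b + l)) has_real_derivative - hit t (b + l) * 1) (at l)"
      by (rule DERIV_chain2[OF DERIV_heat[OF t]]) (auto intro!: derivative_eq_intros)
    then show "((\<lambda>l. - (exp (- lam * l) * heat t (b + l))) has_real_derivative
        exp (- lam * l) * hit t (b + l) + lam * (exp (- lam * l) * heat t (b + l))) (at l)"
      by (auto intro!: derivative_eq_intros)
  qed (use t b lam in auto)
  also have "(\<integral>\<^sup>+l\<in>{0..}. ennreal (exp (- lam * l) * hit t (b + l) + lam * (exp (- lam * l) * heat t (b + l))) \<partial>lborel)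
     = (\<integral>\<^sup>+l. ennreal (exp (- lam * l) * hit t (b + l)) * indicator {0..} l +
        ennreal lam * (ennreal (exp (- lam * l) * heat t (b + l)) * indicator {0..} l) \<partial>lborel)"
    using t b lam
    by (intro nn_integral_cong) (auto simp: ennreal_mult'[symmetric] ennreal_plus[symmetric] simp del: ennreal_plus split: split_indicator)
  finally show ?thesis
    by (simp add: nn_integral_add nn_integral_cmult)
qed

text \<open>After \<open>q = \<rho>\<^sup>2 / (2 * \<kappa>)\<close> the integrand is Gaussian. The
  value is the factor by which the Volterra kernel shrinks in the norm with weight \<kappa>, and it
  is small for large \<kappa>.\<close>

lemma nn_integral_heat_exp:
  assumes \<kappa>: "0 < \<kappa>"
  shows "(\<integral>\<^sup>+q\<in>{0<..}. ennreal (heat q 0 * exp (- \<kappa> * q)) \<partial>lborel) = ennreal (1 / sqrt (2 * \<kappa>))"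
proof -
  have img: "(\<lambda>\<rho>. \<rho>\<^sup>2 / (2 * \<kappa>)) ` {0<..} = {0<..}"
  proof safe
    fix y :: real assume "0 < y"
    then show "y \<in> (\<lambda>\<rho>. \<rho>\<^sup>2 / (2 * \<kappa>)) ` {0<..}"
      using \<kappa> by (intro image_eqI[of _ _ "sqrt (2 * \<kappa> * y)"]) auto
  qed (use \<kappa> in auto)
  have "(\<integral>\<^sup>+q. ennreal (heat q 0 * exp (- \<kappa> * q)) * indicator ((\<lambda>\<rho>. \<rho>\<^sup>2 / (2 * \<kappa>)) ` {0<..}) q \<partial>lborel)
     = (\<integral>\<^sup>+\<rho>. ennreal (heat (\<rho>\<^sup>2 / (2 * \<kappa>)) 0 * exp (- \<kappa> * (\<rho>\<^sup>2 / (2 * \<kappa>)))) * ennreal (\<rho> / \<kappa>) * indicator {0<..} \<rho> \<partial>lborel)"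
  proof (rule nn_integral_substitution_greaterThan)
    show "((\<lambda>\<rho>. \<rho>\<^sup>2 / (2 * \<kappa>)) has_real_derivative x / \<kappa>) (at x)" for x
      using \<kappa> by (auto intro!: derivative_eq_intros)
    show "continuous_on {0<..} (\<lambda>\<rho>. \<rho> / \<kappa>)"
      using \<kappa> by (intro continuous_intros) auto
  qed (use \<kappa> in auto)
  also have "\<dots> = (\<integral>\<^sup>+\<rho>. ennreal (2 / sqrt (2 * \<kappa>)) * (ennreal (heat 1 \<rho>) * indicator {0<..} \<rho>) \<partial>lborel)"
  proof (intro nn_integral_cong)
    fix \<rho> :: real
    have "heat (\<rho>\<^sup>2 / (2 * \<kappa>)) 0 * exp (- \<kappa> * (\<rho>\<^sup>2 / (2 * \<kappa>))) * (\<rho> / \<kappa>) = 2 / sqrt (2 * \<kappa>) * heat 1 \<rho>" if "0 < \<rho>"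
    proof -
      have 1: "sqrt (2 * pi * (\<rho>\<^sup>2 / (2 * \<kappa>))) = \<rho> * (sqrt pi / sqrt \<kappa>)"
        using that by (simp add: real_sqrt_mult real_sqrt_divide)
      have 2: "- \<kappa> * (\<rho>\<^sup>2 / (2 * \<kappa>)) = - (\<rho>\<^sup>2) / (2 * 1)"
        using \<kappa> by simp
      have 3: "sqrt (2 * \<kappa>) * sqrt (2 * pi) = 2 * (sqrt \<kappa> * sqrt pi)"
        by (simp add: real_sqrt_mult)
      have "heat (\<rho>\<^sup>2 / (2 * \<kappa>)) 0 * exp (- \<kappa> * (\<rho>\<^sup>2 / (2 * \<kappa>))) * (\<rho> / \<kappa>)
          = exp (- (\<rho>\<^sup>2) / (2 * 1)) * ((\<rho> / \<kappa>) / (\<rho> * (sqrt pi / sqrt \<kappa>)))"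
        unfolding heat_def 1 2 by (simp add: mult.commute)
      also have "(\<rho> / \<kappa>) / (\<rho> * (sqrt pi / sqrt \<kappa>)) = sqrt \<kappa> / (\<kappa> * sqrt pi)"
        using that by simp
      also have "\<dots> = 1 / (sqrt \<kappa> * sqrt pi)"
        using \<kappa> by (simp add: divide_eq_eq eq_divide_eq)
      also have "\<dots> = 2 / (sqrt (2 * \<kappa>) * sqrt (2 * pi))"
        unfolding 3 by simp
      finally show ?thesis by (simp add: heat_def mult.commute)
    qed
    then show "ennreal (heat (\<rho>\<^sup>2 / (2 * \<kappa>)) 0 * exp (- \<kappa> * (\<rho>\<^sup>2 / (2 * \<kappa>)))) * ennreal (\<rho> / \<kappa>) * indicator {0<..} \<rho>
       = ennreal (2 / sqrt (2 * \<kappa>)) * (ennreal (heat 1 \<rho>) * indicator {0<..} \<rho>)"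
      using \<kappa> by (auto simp: ennreal_mult'[symmetric] ennreal_mult''[symmetric] split: split_indicator)
  qed
  also have "\<dots> = ennreal (2 / sqrt (2 * \<kappa>)) * ennreal (1 / 2)"
    by (subst nn_integral_cmult) (simp_all add: nn_integral_heat_half del: ennreal_half)
  also have "\<dots> = ennreal (1 / sqrt (2 * \<kappa>))"
    using \<kappa> by (simp add: ennreal_mult'[symmetric] del: ennreal_half)
  finally show ?thesis by (simp add: img)
qed

text \<open>The difference is at most \<open>1 / sqrt q\<close> and at most \<open>\<bar>y - z\<bar> / q\<close>; the geometric mean of the two
  bounds is integrable in \<open>q\<close>.\<close>

lemma abs_heat_diff_le:
  assumes q: "0 < q"
  shows "\<bar>heat q y - heat q z\<bar> \<le> sqrt \<bar>y - z\<bar> * q powr (- 3 / 4)"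
proof -
  have h0: "heat q 0 \<le> 1 / sqrt q"
    using q pi_gt3 by (auto simp: heat_def intro!: divide_left_mono)
  have le1: "\<bar>heat q y - heat q z\<bar> \<le> 1 / sqrt q"
    using heat_le[OF q, of y] heat_le[OF q, of z] h0 heat_nonneg[of q y] heat_nonneg[of q z] q by linarith
  have hit_le: "\<bar>hit q x\<bar> \<le> 1 / q" for x
  proof -
    have "\<bar>x\<bar> * exp (- (x\<^sup>2) / (2 * q)) \<le> sqrt q"
    proof -
      \<comment> \<open>The claim amounts to \<open>\<bar>w\<bar> \<le> exp (w\<^sup>2 / 2)\<close>
        for \<open>w = x / sqrt q\<close>, seen by inserting \<open>1 + w\<^sup>2 / 2\<close> in
        between.\<close>
      have "\<bar>x\<bar> / sqrt q \<le> 1 + (x / sqrt q)\<^sup>2 / 2"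
        using sum_squares_bound[of "\<bar>x\<bar> / sqrt q" 1] by (simp add: power_divide)
      also have "\<dots> \<le> exp (x\<^sup>2 / (2 * q))"
        using exp_ge_add_one_self[of "x\<^sup>2 / (2 * q)"] q by (simp add: power_divide field_simps)
      finally have "\<bar>x\<bar> \<le> exp (x\<^sup>2 / (2 * q)) * sqrt q" using q by (simp add: field_simps)
      then show ?thesis by (simp add: exp_minus field_simps)
    qed
    then have "\<bar>x\<bar> * exp (- (x\<^sup>2) / (2 * q)) / sqrt (2 * pi * q) \<le> sqrt q / sqrt (2 * pi * q)"
      using q by (intro divide_right_mono) auto
    also have "\<dots> \<le> sqrt q / sqrt q"
      using q pi_gt3 by (intro divide_left_mono) auto
    finally have "\<bar>x\<bar> * heat q x \<le> 1" using q by (simp add: heat_def)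
    then show ?thesis using q by (simp add: hit_def abs_mult divide_right_mono)
  qed
  have le2: "\<bar>heat q y - heat q z\<bar> \<le> 1 / q * \<bar>y - z\<bar>"
  proof (rule field_differentiable_bound[of UNIV "heat q" "\<lambda>x. - hit q x", simplified real_norm_def])
    fix x show "(heat q has_field_derivative - hit q x) (at x within UNIV)"
      using DERIV_heat[OF q] by simp
  qed (use hit_le in auto)
  have "\<bar>heat q y - heat q z\<bar>\<^sup>2 \<le> 1 / sqrt q * (1 / q * \<bar>y - z\<bar>)"
    unfolding power2_eq_square using le1 le2 q by (intro mult_mono) auto
  also have "\<dots> = (sqrt \<bar>y - z\<bar> * q powr (- 3 / 4))\<^sup>2"
  proof -
    have "(q powr (- 3 / 4))\<^sup>2 = q powr (- (1 / 2) + - 1)"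
      by (simp add: power2_eq_square powr_add[symmetric])
    also have "\<dots> = q powr - (1 / 2) * q powr - 1"
      by (rule powr_add)
    also have "q powr - (1 / 2) = 1 / sqrt q"
      using q by (simp add: powr_minus_divide powr_half_sqrt)
    also have "q powr - 1 = 1 / q"
      using q by (simp add: powr_minus_divide)
    finally show ?thesis by (simp add: power_mult_distrib)
  qed
  finally show ?thesis
    by (rule power2_le_imp_le) auto
qed

lemma nn_integral_powr_Ioo:
  assumes t: "0 \<le> t"
  shows "(\<integral>\<^sup>+q\<in>{0<..<t}. ennreal (q powr (- 3 / 4)) \<partial>lborel) \<le> ennreal (4 * t powr (1 / 4))"
proof -
  have "((\<lambda>q. q powr (- 3 / 4)) has_integral (t powr (- 3 / 4 + 1) / (- 3 / 4 + 1))) {0..t}"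
    using t by (intro has_integral_powr_from_0) auto
  then have "(\<integral>\<^sup>+q\<in>{0..t}. ennreal (q powr (- 3 / 4)) \<partial>lborel) = ennreal (t powr (- 3 / 4 + 1) / (- 3 / 4 + 1))"
    by (intro nn_integral_has_integral_lebesgue') auto
  then have "(\<integral>\<^sup>+q\<in>{0..t}. ennreal (q powr (- 3 / 4)) \<partial>lborel) = ennreal (4 * t powr (1 / 4))"
    by (simp add: mult.commute)
  moreover have "(\<integral>\<^sup>+q\<in>{0<..<t}. ennreal (q powr (- 3 / 4)) \<partial>lborel) \<le> (\<integral>\<^sup>+q\<in>{0..t}. ennreal (q powr (- 3 / 4)) \<partial>lborel)"
    by (intro nn_integral_mono) (auto split: split_indicator)
  ultimately show ?thesis by simp
qed

text \<open>The first hitting time of \<open>a\<close> is distributed as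
  \<open>a\<^sup>2 / Z\<^sup>2\<close> with \<open>Z\<close> standard normal, so survival up to time
  \<open>q\<close> is the event that a normal variable of variance \<open>q\<close> lies in
  \<open>[- a, a]\<close>. Since \<open>heat 0\<close> vanishes, \<open>q = 0\<close> is a case of
  its own.\<close>

lemma nn_integral_hit_time:
  assumes a: "0 < a" and q: "0 \<le> q"
  shows "(\<integral>\<^sup>+r\<in>{0<..}. ennreal (hit r a) * indicator {q..} r \<partial>lborel) =
    (if q = 0 then 1 else (\<integral>\<^sup>+z. ennreal (heat q z) * indicator {-a..a} z \<partial>lborel))"
proof -
  \<comment> \<open>The variance \<open>c = q\<close> turns
    \<open>q \<le> c * a\<^sup>2 / z\<^sup>2\<close> into \<open>\<bar>z\<bar> \<le> a\<close>. At
    \<open>q = 0\<close> a positive variance is chosen, for which the condition always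
    holds.\<close>
  define c where "c = (if q = 0 then 1 else q)"
  have c: "0 < c" using q by (simp add: c_def)
  have img: "(\<lambda>z. c * a\<^sup>2 / z\<^sup>2) ` {0<..} = {0<..}"
  proof safe
    fix y :: real assume "0 < y"
    then show "y \<in> (\<lambda>z. c * a\<^sup>2 / z\<^sup>2) ` {0<..}"
      using a c by (intro image_eqI[of _ _ "a * sqrt (c / y)"]) (auto simp: power_mult_distrib)
  qed (use a c in auto)
  have "(\<integral>\<^sup>+r. (ennreal (hit r a) * indicator {q..} r) * indicator ((\<lambda>z. c * a\<^sup>2 / z\<^sup>2) ` {0<..}) r \<partial>lborel) =
     (\<integral>\<^sup>+z. (ennreal (hit (c * a\<^sup>2 / z\<^sup>2) a) * indicator {q..} (c * a\<^sup>2 / z\<^sup>2)) * ennreal (2 * c * a\<^sup>2 / z ^ 3) * indicator {0<..} z \<partial>lborel)"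
  proof (rule nn_integral_substitution_greaterThan_antimono)
    show "((\<lambda>z. c * a\<^sup>2 / z\<^sup>2) has_real_derivative - (2 * c * a\<^sup>2 / x ^ 3)) (at x)" if "0 < x" for x
      using that by (auto intro!: derivative_eq_intros simp: power2_eq_square power3_eq_cube ac_simps)
    show "continuous_on {0<..} (\<lambda>z. 2 * c * a\<^sup>2 / z ^ 3)"
      by (intro continuous_intros) auto
  qed (use a c in \<open>auto simp: img\<close>)
  also have "\<dots> = (\<integral>\<^sup>+z. 2 * (ennreal (heat c z) * indicator {z. q \<le> c * a\<^sup>2 / z\<^sup>2} z * indicator {0<..} z) \<partial>lborel)"
  proof (intro nn_integral_cong)
    fix z :: real
    have "hit (c * a\<^sup>2 / z\<^sup>2) a * (2 * c * a\<^sup>2 / z ^ 3) = 2 * heat c z" if "0 < z"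
    proof -
      have "sqrt (2 * pi * (c * a\<^sup>2 / z\<^sup>2)) = sqrt (2 * pi * c) * (a / z)"
        using that a c by (simp add: real_sqrt_mult real_sqrt_divide)
      then show ?thesis
        using that a c by (simp add: hit_def heat_def field_simps power2_eq_square power3_eq_cube)
    qed
    then show "(ennreal (hit (c * a\<^sup>2 / z\<^sup>2) a) * indicator {q..} (c * a\<^sup>2 / z\<^sup>2)) * ennreal (2 * c * a\<^sup>2 / z ^ 3) * indicator {0<..} z =
      2 * (ennreal (heat c z) * indicator {z. q \<le> c * a\<^sup>2 / z\<^sup>2} z * indicator {0<..} z)"
      using a c by (auto simp: ennreal_mult'[symmetric] ennreal_mult''[symmetric] ennreal_mult split: split_indicator)
  qed
  also have "\<dots> = 2 * (\<integral>\<^sup>+z\<in>{0<..}. ennreal (heat c z) * indicator {z. q \<le> c * a\<^sup>2 / z\<^sup>2} z \<partial>lborel)"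
    by (subst nn_integral_cmult) auto
  also have "\<dots> = (\<integral>\<^sup>+z. ennreal (heat c z) * indicator {z. q \<le> c * a\<^sup>2 / z\<^sup>2} z \<partial>lborel)"
    by (subst nn_integral_even) (auto split: split_indicator)
  also have "\<dots> = (if q = 0 then 1 else (\<integral>\<^sup>+z. ennreal (heat q z) * indicator {-a..a} z \<partial>lborel))"
  proof (cases "q = 0")
    case True
    then show ?thesis using c nn_integral_heat[OF c] by simp
  next
    case False
    have "q \<le> c * a\<^sup>2 / z\<^sup>2 \<longleftrightarrow> z \<in> {-a..a}" if "z \<noteq> 0" for z
    proof -
      have "q \<le> c * a\<^sup>2 / z\<^sup>2 \<longleftrightarrow> z\<^sup>2 \<le> a\<^sup>2" using False q that by (simp add: c_def field_simps)
      also have "\<dots> \<longleftrightarrow> z \<in> {-a..a}" using a by (auto simp: abs_le_square_iff[symmetric])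
      finally show ?thesis .
    qed
    then show ?thesis using False
      by (simp add: c_def)
         (intro nn_integral_cong_AE eventually_mono[OF AE_lborel_singleton[of 0]], simp add: c_def split: split_indicator)
  qed
  finally show ?thesis by (simp add: img)
qed

section \<open>Volterra equations\<close>

text \<open>The value of \<open>E (\<phi> (B t) * exp (- lam * L t))\<close>.\<close>

definition joint_transform :: "(real \<Rightarrow> real) \<Rightarrow> real \<Rightarrow> real \<Rightarrow> ennreal" where
  "joint_transform \<phi> lam t =
    (\<integral>\<^sup>+y. (\<integral>\<^sup>+l\<in>{0..}. ennreal (\<phi> y * exp (- lam * l) * hit t (\<bar>y\<bar> + l)) \<partial>lborel) \<partial>lborel)"

lemma joint_transform_measurable [measurable (raw)]:
  assumes [measurable]: "\<phi> \<in> borel_measurable borel" "f \<in> borel_measurable M"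
  shows "(\<lambda>x. joint_transform \<phi> lam (f x)) \<in> borel_measurable M"
  unfolding joint_transform_def by measurable

text \<open>Fubini makes the time integral innermost, where it is the first-passage identity
  \<open>heat_convolution_hit\<close>. Here \<open>heat q x\<close> is the density of reaching 0
  from \<open>x\<close> at time \<open>q\<close>, after which the path continues as if started at
  0.\<close>

lemma heat_convolution_joint_transform:
  assumes [measurable]: "\<phi> \<in> borel_measurable borel" and \<phi>: "\<And>y. 0 \<le> \<phi> y" and t: "0 < t"
  shows "(\<integral>\<^sup>+q\<in>{0<..<t}. ennreal (heat q x) * joint_transform \<phi> lam (t - q) \<partial>lborel) =
    (\<integral>\<^sup>+y. (\<integral>\<^sup>+l\<in>{0..}. ennreal (\<phi> y * exp (- lam * l) * heat t (\<bar>x\<bar> + \<bar>y\<bar> + l)) \<partial>lborel) \<partial>lborel)"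
proof -
  let ?f = "\<lambda>q y l. ennreal (\<phi> y * exp (- lam * l)) * (ennreal (heat q \<bar>x\<bar> * hit (t - q) (\<bar>y\<bar> + l)) * indicator {0<..<t} q) * indicator {0..} l"
  have "(\<integral>\<^sup>+q\<in>{0<..<t}. ennreal (heat q x) * joint_transform \<phi> lam (t - q) \<partial>lborel)
      = (\<integral>\<^sup>+q. (\<integral>\<^sup>+y. (\<integral>\<^sup>+l. ?f q y l \<partial>lborel) \<partial>lborel) \<partial>lborel)"
  proof (intro nn_integral_cong)
    fix q :: real
    have "ennreal (heat q x) * joint_transform \<phi> lam (t - q) * indicator {0<..<t} q =
       (\<integral>\<^sup>+y. (\<integral>\<^sup>+l. ennreal (heat q x) * (ennreal (\<phi> y * exp (- lam * l) * hit (t - q) (\<bar>y\<bar> + l)) * indicator {0..} l) * indicator {0<..<t} q \<partial>lborel) \<partial>lborel)"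
      unfolding joint_transform_def by (simp add: nn_integral_cmult nn_integral_multc)
    also have "\<dots> = (\<integral>\<^sup>+y. (\<integral>\<^sup>+l. ?f q y l \<partial>lborel) \<partial>lborel)"
      using \<phi> by (intro nn_integral_cong)
        (auto simp: ennreal_mult'[symmetric] ac_simps split: split_indicator)
    finally show "ennreal (heat q x) * joint_transform \<phi> lam (t - q) * indicator {0<..<t} q = \<dots>" .
  qed
  also have "\<dots> = (\<integral>\<^sup>+y. (\<integral>\<^sup>+q. (\<integral>\<^sup>+l. ?f q y l \<partial>lborel) \<partial>lborel) \<partial>lborel)"
    by (rule lborel_pair.Fubini') measurable
  also have "\<dots> = (\<integral>\<^sup>+y. (\<integral>\<^sup>+l. (\<integral>\<^sup>+q. ?f q y l \<partial>lborel) \<partial>lborel) \<partial>lborel)"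
    by (intro nn_integral_cong lborel_pair.Fubini') measurable
  also have "\<dots> = (\<integral>\<^sup>+y. (\<integral>\<^sup>+l\<in>{0..}. ennreal (\<phi> y * exp (- lam * l) * heat t (\<bar>x\<bar> + \<bar>y\<bar> + l)) \<partial>lborel) \<partial>lborel)"
  \<comment> \<open>\<open>heat_convolution_hit\<close> requires the level
    \<open>\<bar>y\<bar> + l\<close> to be positive, also at \<open>l = 0\<close>.\<close>
  proof (intro nn_integral_cong_AE eventually_mono[OF AE_lborel_singleton[of 0]] nn_integral_cong)
    fix y l :: real assume y: "y \<noteq> 0"
    have "(\<integral>\<^sup>+q. ?f q y l \<partial>lborel) =
       ennreal (\<phi> y * exp (- lam * l)) * (\<integral>\<^sup>+q\<in>{0<..<t}. ennreal (heat q \<bar>x\<bar> * hit (t - q) (\<bar>y\<bar> + l)) \<partial>lborel) * indicator {0..} l"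
      by (simp add: nn_integral_cmult nn_integral_multc)
    also have "\<dots> = ennreal (\<phi> y * exp (- lam * l) * heat t (\<bar>x\<bar> + \<bar>y\<bar> + l)) * indicator {0..} l"
    proof (cases "0 \<le> l")
      case True
      then have "(\<integral>\<^sup>+q\<in>{0<..<t}. ennreal (heat q \<bar>x\<bar> * hit (t - q) (\<bar>y\<bar> + l)) \<partial>lborel) = ennreal (heat t (\<bar>y\<bar> + l + \<bar>x\<bar>))"
        using y by (intro heat_convolution_hit t) auto
      then show ?thesis using \<phi> by (simp add: ennreal_mult' ac_simps)
    qed simp
    finally show "(\<integral>\<^sup>+q. ?f q y l \<partial>lborel) = \<dots>" .
  qed
  finally show ?thesis .
qed

text \<open>The limit of the Duhamel equation: started at 0, the local time grows at expected rate
  \<open>heat q 0\<close>, and the path is at 0 whenever it grows. For the explicit transform the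
  equation is integration by parts in \<open>l\<close>.\<close>

lemma joint_transform_Volterra:
  assumes [measurable]: "\<phi> \<in> borel_measurable borel" and \<phi>: "\<And>y. 0 \<le> \<phi> y" and t: "0 < t" and lam: "0 \<le> lam"
  shows "joint_transform \<phi> lam t + ennreal lam *
      (\<integral>\<^sup>+q\<in>{0<..<t}. ennreal (heat q 0) * joint_transform \<phi> lam (t - q) \<partial>lborel) =
    (\<integral>\<^sup>+y. ennreal (\<phi> y * heat t y) \<partial>lborel)"
proof -
  have "joint_transform \<phi> lam t + ennreal lam *
      (\<integral>\<^sup>+q\<in>{0<..<t}. ennreal (heat q 0) * joint_transform \<phi> lam (t - q) \<partial>lborel)
    = (\<integral>\<^sup>+y. (\<integral>\<^sup>+l\<in>{0..}. ennreal (\<phi> y * exp (- lam * l) * hit t (\<bar>y\<bar> + l)) \<partial>lborel) +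
       ennreal lam * (\<integral>\<^sup>+l\<in>{0..}. ennreal (\<phi> y * exp (- lam * l) * heat t (\<bar>0\<bar> + \<bar>y\<bar> + l)) \<partial>lborel) \<partial>lborel)"
    unfolding heat_convolution_joint_transform[OF assms(1) \<phi> t]
    unfolding joint_transform_def
    by (simp add: nn_integral_add nn_integral_cmult)
  also have "\<dots> = (\<integral>\<^sup>+y. ennreal (\<phi> y * heat t y) \<partial>lborel)"
  proof (intro nn_integral_cong)
    fix y :: real
    have "(\<integral>\<^sup>+l\<in>{0..}. ennreal (\<phi> y * exp (- lam * l) * hit t (\<bar>y\<bar> + l)) \<partial>lborel)
       = (\<integral>\<^sup>+l. ennreal (\<phi> y) * (ennreal (exp (- lam * l) * hit t (\<bar>y\<bar> + l)) * indicator {0..} l) \<partial>lborel)"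
      using \<phi> by (intro nn_integral_cong) (auto simp: ennreal_mult'[symmetric] ac_simps split: split_indicator)
    moreover have "(\<integral>\<^sup>+l\<in>{0..}. ennreal (\<phi> y * exp (- lam * l) * heat t (\<bar>0\<bar> + \<bar>y\<bar> + l)) \<partial>lborel)
       = (\<integral>\<^sup>+l. ennreal (\<phi> y) * (ennreal (exp (- lam * l) * heat t (\<bar>y\<bar> + l)) * indicator {0..} l) \<partial>lborel)"
      using \<phi> by (intro nn_integral_cong) (auto simp: ennreal_mult'[symmetric] ac_simps split: split_indicator)
    ultimately have "(\<integral>\<^sup>+l\<in>{0..}. ennreal (\<phi> y * exp (- lam * l) * hit t (\<bar>y\<bar> + l)) \<partial>lborel) +
       ennreal lam * (\<integral>\<^sup>+l\<in>{0..}. ennreal (\<phi> y * exp (- lam * l) * heat t (\<bar>0\<bar> + \<bar>y\<bar> + l)) \<partial>lborel)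
       = ennreal (\<phi> y) * ((\<integral>\<^sup>+l\<in>{0..}. ennreal (exp (- lam * l) * hit t (\<bar>y\<bar> + l)) \<partial>lborel) +
          ennreal lam * (\<integral>\<^sup>+l\<in>{0..}. ennreal (exp (- lam * l) * heat t (\<bar>y\<bar> + l)) \<partial>lborel))"
      by (simp add: nn_integral_cmult distrib_left ac_simps)
    also have "\<dots> = ennreal (\<phi> y * heat t y)"
      using \<phi> by (subst nn_integral_exp_heat_hit[OF t _ lam]) (auto simp: ennreal_mult')
    finally show "(\<integral>\<^sup>+l\<in>{0..}. ennreal (\<phi> y * exp (- lam * l) * hit t (\<bar>y\<bar> + l)) \<partial>lborel) +
       ennreal lam * (\<integral>\<^sup>+l\<in>{0..}. ennreal (\<phi> y * exp (- lam * l) * heat t (\<bar>0\<bar> + \<bar>y\<bar> + l)) \<partial>lborel) = \<dots>" .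
  qed
  finally show ?thesis .
qed

lemma nn_integral_mult_heat_le_1:
  assumes [measurable]: "\<phi> \<in> borel_measurable borel" and \<phi>: "\<And>y. 0 \<le> \<phi> y" "\<And>y. \<phi> y \<le> 1" and t: "0 < t"
  shows "(\<integral>\<^sup>+y. ennreal (\<phi> y * heat t (y - x)) \<partial>lborel) \<le> 1"
proof -
  have "(\<integral>\<^sup>+y. ennreal (\<phi> y * heat t (y - x)) \<partial>lborel) \<le> (\<integral>\<^sup>+y. ennreal (heat t (y - x)) \<partial>lborel)"
    using \<phi> t by (intro nn_integral_mono ennreal_leI mult_left_le_one_le) auto
  then show ?thesis using nn_integral_heat_shift[OF t] by simp
qed

text \<open>In the Volterra equation both summands on the left are nonnegative, and the right-hand
  side is a mean of \<open>\<phi>\<close>.\<close>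

lemma joint_transform_le_1:
  assumes [measurable]: "\<phi> \<in> borel_measurable borel" and \<phi>: "\<And>y. 0 \<le> \<phi> y" "\<And>y. \<phi> y \<le> 1" and t: "0 < t" and lam: "0 \<le> lam"
  shows "joint_transform \<phi> lam t \<le> 1"
proof -
  have "joint_transform \<phi> lam t \<le> joint_transform \<phi> lam t + ennreal lam *
      (\<integral>\<^sup>+q\<in>{0<..<t}. ennreal (heat q 0) * joint_transform \<phi> lam (t - q) \<partial>lborel)"
    by simp
  also have "\<dots> \<le> 1"
    using joint_transform_Volterra[OF assms(1) \<phi>(1) t lam] nn_integral_mult_heat_le_1[OF assms(1) \<phi> t, of 0] by simp
  finally show ?thesis .
qed

lemma exp_plus_nn_integral_exp:
  assumes m: "0 \<le> m" and lam: "0 \<le> lam"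
  shows "ennreal (exp (- lam * m)) + ennreal lam * (\<integral>\<^sup>+l\<in>{0..m}. ennreal (exp (- lam * l)) \<partial>lborel) = 1"
proof -
  have "(\<integral>\<^sup>+l\<in>{0..m}. ennreal (lam * exp (- lam * l)) \<partial>lborel) = ennreal (- exp (- lam * m) - (- exp (- lam * 0)))"
    by (rule nn_integral_FTC_Icc) (use lam m in \<open>auto intro!: derivative_eq_intros\<close>)
  moreover have "(\<integral>\<^sup>+l\<in>{0..m}. ennreal (lam * exp (- lam * l)) \<partial>lborel) = ennreal lam * (\<integral>\<^sup>+l\<in>{0..m}. ennreal (exp (- lam * l)) \<partial>lborel)"
    using lam by (subst nn_integral_cmult[symmetric]) (auto simp: ennreal_mult' mult.assoc)
  ultimately have I: "ennreal lam * (\<integral>\<^sup>+l\<in>{0..m}. ennreal (exp (- lam * l)) \<partial>lborel) = ennreal (1 - exp (- lam * m))"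
    by simp
  have "exp (- lam * m) \<le> 1" using lam m by simp
  then show ?thesis unfolding I by (simp add: ennreal_plus[symmetric] del: ennreal_plus)
qed

text \<open>Started at \<open>x\<close>, the local time at \<open>0\<close> up to time \<open>t\<close> is distributed as \<open>max 0 (\<bar>Z\<bar> - \<bar>x\<bar>)\<close> with
  \<open>Z\<close> normal of variance \<open>t\<close>.\<close>

lemma joint_transform_1_Volterra:
  assumes t: "0 < t" and lam: "0 \<le> lam"
  shows "(\<integral>\<^sup>+z. ennreal (heat t z * exp (- lam * max 0 (\<bar>z\<bar> - \<bar>x\<bar>))) \<partial>lborel) + ennreal lam *
      (\<integral>\<^sup>+q\<in>{0<..<t}. ennreal (heat q x) * joint_transform (\<lambda>_. 1) lam (t - q) \<partial>lborel) = 1"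
proof -
  let ?h = "\<lambda>z l. ennreal (heat t z) * (ennreal (exp (- lam * l)) * indicator {0<..} (\<bar>z\<bar> - \<bar>x\<bar> - l) * indicator {0..} l)"
  have "(\<integral>\<^sup>+q\<in>{0<..<t}. ennreal (heat q x) * joint_transform (\<lambda>_. 1) lam (t - q) \<partial>lborel)
    = (\<integral>\<^sup>+y. (\<integral>\<^sup>+l\<in>{0..}. ennreal (1 * exp (- lam * l) * heat t (\<bar>x\<bar> + \<bar>y\<bar> + l)) \<partial>lborel) \<partial>lborel)"
    by (rule heat_convolution_joint_transform) (auto intro: t)
  also have "\<dots> = (\<integral>\<^sup>+l. (\<integral>\<^sup>+y. ennreal (1 * exp (- lam * l) * heat t (\<bar>x\<bar> + \<bar>y\<bar> + l)) * indicator {0..} l \<partial>lborel) \<partial>lborel)"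
    by (rule lborel_pair.Fubini') measurable
  also have "\<dots> = (\<integral>\<^sup>+l. (\<integral>\<^sup>+z. ?h z l \<partial>lborel) \<partial>lborel)"
  proof (rule nn_integral_cong)
    fix l :: real
    show "(\<integral>\<^sup>+y. ennreal (1 * exp (- lam * l) * heat t (\<bar>x\<bar> + \<bar>y\<bar> + l)) * indicator {0..} l \<partial>lborel) = (\<integral>\<^sup>+z. ?h z l \<partial>lborel)"
    proof (cases "0 \<le> l")
      case True
      \<comment> \<open>For fixed \<open>l\<close> the values \<open>c + \<bar>y\<bar>\<close> run
        twice through the levels above \<open>c\<close>, just as \<open>\<bar>z\<bar>\<close> does.
        The constraint \<open>\<bar>z\<bar> > c\<close> then reads
        \<open>l < \<bar>z\<bar> - \<bar>x\<bar>\<close>, which becomes the range of the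
        \<open>l\<close>-integral after exchanging the order.\<close>
      define c where "c = \<bar>x\<bar> + l"
      have c: "0 \<le> c" using True by (simp add: c_def)
      have "(\<integral>\<^sup>+y. ennreal (1 * exp (- lam * l) * heat t (\<bar>x\<bar> + \<bar>y\<bar> + l)) * indicator {0..} l \<partial>lborel)
         = ennreal (exp (- lam * l)) * (\<integral>\<^sup>+y. ennreal (heat t (c + \<bar>y\<bar>)) \<partial>lborel)"
        using True t by (subst nn_integral_cmult[symmetric]) (auto simp: ennreal_mult' c_def ac_simps)
      also have "(\<integral>\<^sup>+y. ennreal (heat t (c + \<bar>y\<bar>)) \<partial>lborel) = 2 * (\<integral>\<^sup>+y\<in>{0<..}. ennreal (heat t (c + \<bar>y\<bar>)) \<partial>lborel)"
        by (rule nn_integral_even) auto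
      also have "(\<integral>\<^sup>+y\<in>{0<..}. ennreal (heat t (c + \<bar>y\<bar>)) \<partial>lborel) = (\<integral>\<^sup>+y. ennreal (heat t (c + y)) * indicator {c<..} (c + y) \<partial>lborel)"
        by (intro nn_integral_cong) (auto split: split_indicator)
      also have "\<dots> = (\<integral>\<^sup>+z. ennreal (heat t z) * indicator {c<..} z \<partial>lborel)"
        by (subst (2) nn_integral_real_affine[of _ 1 c]) auto
      also have "\<dots> = (\<integral>\<^sup>+z\<in>{0<..}. ennreal (heat t z) * indicator {c<..} \<bar>z\<bar> \<partial>lborel)"
        using c by (intro nn_integral_cong) (auto split: split_indicator)
      also have "2 * \<dots> = (\<integral>\<^sup>+z. ennreal (heat t z) * indicator {c<..} \<bar>z\<bar> \<partial>lborel)"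
        by (rule nn_integral_even[symmetric]) auto
      also have "ennreal (exp (- lam * l)) * \<dots> = (\<integral>\<^sup>+z. ?h z l \<partial>lborel)"
        using True by (subst nn_integral_cmult[symmetric])
          (auto simp: c_def ac_simps intro!: nn_integral_cong split: split_indicator)
      finally show ?thesis .
    qed simp
  qed
  also have "\<dots> = (\<integral>\<^sup>+z. (\<integral>\<^sup>+l. ?h z l \<partial>lborel) \<partial>lborel)"
    by (rule lborel_pair.Fubini') measurable
  finally have "(\<integral>\<^sup>+z. ennreal (heat t z * exp (- lam * max 0 (\<bar>z\<bar> - \<bar>x\<bar>))) \<partial>lborel) + ennreal lam *
      (\<integral>\<^sup>+q\<in>{0<..<t}. ennreal (heat q x) * joint_transform (\<lambda>_. 1) lam (t - q) \<partial>lborel)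
    = (\<integral>\<^sup>+z. ennreal (heat t z * exp (- lam * max 0 (\<bar>z\<bar> - \<bar>x\<bar>))) + ennreal lam * (\<integral>\<^sup>+l. ?h z l \<partial>lborel) \<partial>lborel)"
    by (simp add: nn_integral_add nn_integral_cmult)
  also have "\<dots> = (\<integral>\<^sup>+z. ennreal (heat t z) \<partial>lborel)"
  proof (intro nn_integral_cong)
    fix z :: real
    let ?m = "max 0 (\<bar>z\<bar> - \<bar>x\<bar>)"
    have "(\<integral>\<^sup>+l. ?h z l \<partial>lborel) = ennreal (heat t z) * (\<integral>\<^sup>+l. ennreal (exp (- lam * l)) * indicator {0<..} (\<bar>z\<bar> - \<bar>x\<bar> - l) * indicator {0..} l \<partial>lborel)"
      by (subst nn_integral_cmult) auto
    also have "(\<integral>\<^sup>+l. ennreal (exp (- lam * l)) * indicator {0<..} (\<bar>z\<bar> - \<bar>x\<bar> - l) * indicator {0..} l \<partial>lborel)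
       = (\<integral>\<^sup>+l\<in>{0..?m}. ennreal (exp (- lam * l)) \<partial>lborel)"
      by (intro nn_integral_cong_AE eventually_mono[OF AE_lborel_singleton[of ?m]])
         (auto split: split_indicator)
    finally have "ennreal (heat t z * exp (- lam * ?m)) + ennreal lam * (\<integral>\<^sup>+l. ?h z l \<partial>lborel) =
       ennreal (heat t z) * (ennreal (exp (- lam * ?m)) + ennreal lam * (\<integral>\<^sup>+l\<in>{0..?m}. ennreal (exp (- lam * l)) \<partial>lborel))"
      using t by (simp add: ennreal_mult' distrib_left ac_simps)
    also have "\<dots> = ennreal (heat t z)"
      by (subst exp_plus_nn_integral_exp[OF _ lam]) auto
    finally show "ennreal (heat t z * exp (- lam * ?m)) + ennreal lam * (\<integral>\<^sup>+l. ?h z l \<partial>lborel) = ennreal (heat t z)" .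
  qed
  finally show ?thesis using nn_integral_heat[OF t] by simp
qed

section \<open>Laws determined by transforms\<close>

text \<open>The characteristic functions agree: on the unit interval all moments are at most 1, so
  the Taylor expansion of order \<open>n\<close> has an error of at most
  \<open>2 * \<bar>t\<bar> ^ n / fact n\<close>.\<close>

lemma real_distribution_eqI_moments:
  assumes "real_distribution M1" "real_distribution M2"
    and bdd: "AE x in M1. x \<in> {0..1}" "AE x in M2. x \<in> {0..1}"
    and mom: "\<And>k. (LINT x|M1. x ^ k) = (LINT x|M2. x ^ k)"
  shows "M1 = M2"
proof (rule Levy_uniqueness[OF assms(1,2)], rule ext)
  interpret M1: real_distribution M1 by fact
  interpret M2: real_distribution M2 by fact
  fix t :: real
  have int: "integrable M (\<lambda>x. \<bar>x\<bar> ^ k)" "integrable M (\<lambda>x. x ^ k)" "(LINT x|M. \<bar>x\<bar> ^ k) \<le> 1"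
    if "real_distribution M" "AE x in M. x \<in> {0..1}" for M k
  proof -
    interpret real_distribution M by fact
    have bd: "AE x in M. \<bar>x\<bar> ^ k \<le> 1"
      using that(2) by eventually_elim (auto intro: power_le_one)
    show int: "integrable M (\<lambda>x. \<bar>x\<bar> ^ k)"
      by (rule integrable_const_bound[of _ 1]) (use bd in auto)
    show "integrable M (\<lambda>x. x ^ k)"
      by (rule integrable_const_bound[of _ 1]) (use bd in \<open>auto simp: power_abs\<close>)
    show "(LINT x|M. \<bar>x\<bar> ^ k) \<le> 1"
      using integral_mono_AE[OF int _ bd] prob_space by simp
  qed
  have bound: "cmod (char M1 t - char M2 t) \<le> 4 * (inverse (fact n) * \<bar>t\<bar> ^ n)" for n
  proof -
    let ?S = "\<lambda>M :: real measure. (\<Sum>k\<le>n. ((\<i> * t) ^ k / fact k) * complex_of_real (LINT x|M. x ^ k))"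
    have *: "cmod (char M t - ?S M) \<le> 2 * (inverse (fact n) * \<bar>t\<bar> ^ n)"
      if M: "real_distribution M" "AE x in M. x \<in> {0..1}" for M
    proof -
      have "cmod (char M t - ?S M) \<le> 2 * \<bar>t\<bar> ^ n / fact n * (LINT x|M. \<bar>x\<bar> ^ n)"
        by (rule real_distribution.char_approx1[OF M(1)]) (rule int(2)[OF M])
      also have "\<dots> \<le> 2 * \<bar>t\<bar> ^ n / fact n * 1"
        by (intro mult_left_mono int(3)[OF M]) auto
      finally show ?thesis by (simp add: field_simps)
    qed
    have "cmod (char M1 t - char M2 t) \<le> cmod (char M1 t - ?S M1) + cmod (char M2 t - ?S M2)"
      using norm_triangle_ineq4[of "char M1 t - ?S M1" "char M2 t - ?S M2"] by (simp add: mom)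
    then show ?thesis
      using *[OF assms(1) bdd(1)] *[OF assms(2) bdd(2)] by simp
  qed
  have "(\<lambda>n. 4 * (inverse (fact n) * \<bar>t\<bar> ^ n)) \<longlonglongrightarrow> 4 * 0"
    by (intro tendsto_mult tendsto_const summable_LIMSEQ_zero summable_exp)
  then have "cmod (char M1 t - char M2 t) \<le> 4 * 0"
    by (rule LIMSEQ_le_const) (use bound in auto)
  then show "char M1 t = char M2 t" by simp
qed

text \<open>The Laplace transform at the natural numbers consists of the moments of \<open>exp (- X)\<close>.\<close>

lemma distr_eqI_Laplace:
  assumes "finite_measure N1" "finite_measure N2"
    and [measurable]: "X1 \<in> borel_measurable N1" "X2 \<in> borel_measurable N2"
    and nonneg: "AE x in N1. 0 \<le> X1 x" "AE x in N2. 0 \<le> X2 x"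
    and eq: "\<And>n::nat. (\<integral>\<^sup>+x. ennreal (exp (- real n * X1 x)) \<partial>N1) = (\<integral>\<^sup>+x. ennreal (exp (- real n * X2 x)) \<partial>N2)"
  shows "distr N1 borel X1 = distr N2 borel X2"
proof -
  \<comment> \<open>The case \<open>n = 0\<close> of the hypothesis is equality of the total masses,
    which allows normalising to probability measures.\<close>
  define m where "m = emeasure N1 (space N1)"
  have m1: "emeasure N1 (space N1) = m" and m2: "emeasure N2 (space N2) = m"
    using eq[of 0] by (simp_all add: m_def)
  have fin: "m \<noteq> \<top>" using finite_measure.finite_emeasure_space[OF assms(1)] by (simp add: m_def)
  show ?thesis
  proof (cases "m = 0")
    case True
    have "emeasure N1 A = 0" "emeasure N2 A' = 0" for A A'
      using emeasure_space[of N1 A] emeasure_space[of N2 A'] by (simp_all add: m1 m2 True)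
    then show ?thesis by (intro measure_eqI) (simp_all add: emeasure_distr)
  next
    case False
    have inv: "1 / m * m = 1" using False fin by (simp add: ennreal_divide_times divide_eq_1_ennreal ennreal_divide_self)
    have P1: "real_distribution (distr (density N1 (\<lambda>_. 1 / m)) borel (\<lambda>x. exp (- X1 x)))"
      by (intro prob_space.real_distribution_distr prob_spaceI)
         (simp_all add: emeasure_density m1 inv)
    have P2: "real_distribution (distr (density N2 (\<lambda>_. 1 / m)) borel (\<lambda>x. exp (- X2 x)))"
      by (intro prob_space.real_distribution_distr prob_spaceI)
         (simp_all add: emeasure_density m2 inv)
    have "distr (density N1 (\<lambda>_. 1 / m)) borel (\<lambda>x. exp (- X1 x)) = distr (density N2 (\<lambda>_. 1 / m)) borel (\<lambda>x. exp (- X2 x))"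
    proof (rule real_distribution_eqI_moments[OF P1 P2])
      show "AE x in distr (density N1 (\<lambda>_. 1 / m)) borel (\<lambda>x. exp (- X1 x)). x \<in> {0..1}"
        by (subst AE_distr_iff) (use nonneg(1) in \<open>auto simp: AE_density\<close>)
      show "AE x in distr (density N2 (\<lambda>_. 1 / m)) borel (\<lambda>x. exp (- X2 x)). x \<in> {0..1}"
        by (subst AE_distr_iff) (use nonneg(2) in \<open>auto simp: AE_density\<close>)
      fix k :: nat
      have "(LINT x|distr (density N1 (\<lambda>_. 1 / m)) borel (\<lambda>x. exp (- X1 x)). x ^ k) =
          enn2real (1 / m * (\<integral>\<^sup>+x. ennreal (exp (- real k * X1 x)) \<partial>N1))"
        by (subst integral_distr, measurable, subst integral_eq_nn_integral)
           (auto simp: nn_integral_density nn_integral_cmult exp_of_nat_mult[symmetric])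
      moreover have "(LINT x|distr (density N2 (\<lambda>_. 1 / m)) borel (\<lambda>x. exp (- X2 x)). x ^ k) =
          enn2real (1 / m * (\<integral>\<^sup>+x. ennreal (exp (- real k * X2 x)) \<partial>N2))"
        by (subst integral_distr, measurable, subst integral_eq_nn_integral)
           (auto simp: nn_integral_density nn_integral_cmult exp_of_nat_mult[symmetric])
      ultimately show "(LINT x|distr (density N1 (\<lambda>_. 1 / m)) borel (\<lambda>x. exp (- X1 x)). x ^ k) =
         (LINT x|distr (density N2 (\<lambda>_. 1 / m)) borel (\<lambda>x. exp (- X2 x)). x ^ k)"
        by (simp only: eq)
    qed
    \<comment> \<open>\<open>X\<close> is recovered from \<open>exp (- X)\<close> by the measurable
      map \<open>- ln\<close>.\<close>
    then have E: "emeasure (distr (density N1 (\<lambda>_. 1 / m)) borel (\<lambda>x. exp (- X1 x))) {y. - ln y \<in> A} =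
        emeasure (distr (density N2 (\<lambda>_. 1 / m)) borel (\<lambda>x. exp (- X2 x))) {y. - ln y \<in> A}" for A
      by simp
    show ?thesis
    proof (rule measure_eqI)
      fix A assume "A \<in> sets (distr N1 borel X1)"
      then have [measurable]: "A \<in> sets borel" by simp
      have [measurable]: "{y::real. - ln y \<in> A} \<in> sets borel" by measurable
      have "1 / m * emeasure N1 (X1 -` A \<inter> space N1) = emeasure (distr (density N1 (\<lambda>_. 1 / m)) borel (\<lambda>x. exp (- X1 x))) {y. - ln y \<in> A}"
        by (subst emeasure_distr, measurable)
           (simp add: vimage_def, subst emeasure_density_const, auto intro!: arg_cong[of _ _ "emeasure N1"] simp: ennreal_mult_cancel_left)
      also have "\<dots> = emeasure (distr (density N2 (\<lambda>_. 1 / m)) borel (\<lambda>x. exp (- X2 x))) {y. - ln y \<in> A}"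
        by (rule E)
      also have "\<dots> = 1 / m * emeasure N2 (X2 -` A \<inter> space N2)"
        by (subst emeasure_distr, measurable)
           (simp add: vimage_def, subst emeasure_density_const, auto intro!: arg_cong[of _ _ "emeasure N2"] simp: ennreal_mult_cancel_left)
      finally have "m * (1 / m * emeasure N1 (X1 -` A \<inter> space N1)) = m * (1 / m * emeasure N2 (X2 -` A \<inter> space N2))"
        by simp
      then have "emeasure N1 (X1 -` A \<inter> space N1) = emeasure N2 (X2 -` A \<inter> space N2)"
        using inv by (simp only: mult.assoc[symmetric] mult.commute[of m]) simp
      then show "emeasure (distr N1 borel X1) A = emeasure (distr N2 borel X2) A"
        by (simp add: emeasure_distr)
    qed simp
  qed
qed

section \<open>Uniqueness of finite measures on the line and on products\<close>

lemma finite_borel_measure_eqI_greaterThan: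
  fixes N1 N2 :: "real measure"
  assumes "finite_measure N1" "finite_measure N2" and sets: "sets N1 = sets borel" "sets N2 = sets borel"
    and mass: "emeasure N1 UNIV = emeasure N2 UNIV"
    and eq: "\<And>x. emeasure N1 {x<..} = emeasure N2 {x<..}"
  shows "N1 = N2"
proof (rule cdf_unique')
  interpret N1: finite_measure N1 by fact
  interpret N2: finite_measure N2 by fact
  show "finite_borel_measure N1" "finite_borel_measure N2"
    by (unfold_locales) (simp_all add: sets)
  have sp: "space N1 = UNIV" "space N2 = UNIV" using sets_eq_imp_space_eq[OF sets(1)] sets_eq_imp_space_eq[OF sets(2)] by auto
  have "measure N {..x} = measure N UNIV - measure N {x<..}" if "finite_measure N" "sets N = sets borel" "space N = UNIV" for N and x :: real
    using finite_measure.finite_measure_compl[OF that(1), of "{x<..}"] that by (simp add: Compl_eq_Diff_UNIV[symmetric])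
  then show "cdf N1 = cdf N2"
    using sp sets eq mass by (simp add: fun_eq_iff cdf_def measure_def assms(1,2))
qed

text \<open>Open half-lines are increasing unions of closed ones. The closed form suits the inverse
  local time, for which \<open>t \<le> \<tau>\<^sub>1\<close> is the accessible event.\<close>

lemma finite_borel_measure_eqI_atLeast:
  fixes N1 N2 :: "real measure"
  assumes fin: "finite_measure N1" "finite_measure N2" and sets: "sets N1 = sets borel" "sets N2 = sets borel"
    and mass: "emeasure N1 UNIV = emeasure N2 UNIV"
    and eq: "\<And>x. emeasure N1 {x..} = emeasure N2 {x..}"
  shows "N1 = N2"
proof (rule finite_borel_measure_eqI_greaterThan[OF fin sets mass])
  fix x :: real
  have "emeasure N {x<..} = (SUP n. emeasure N {x + 1 / real (Suc n)..})" if "sets N = sets borel" for N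
  proof -
    have UN: "(\<Union>n. {x + 1 / real (Suc n)..}) = {x<..}"
    proof safe
      fix y n assume "x + 1 / real (Suc n) \<le> y"
      moreover have "0 < 1 / real (Suc n)" by simp
      ultimately show "x < y" by linarith
    next
      fix y assume "x < y"
      then obtain n where "inverse (real (Suc n)) < y - x" using reals_Archimedean[of "y - x"] by auto
      then show "y \<in> (\<Union>n. {x + 1 / real (Suc n)..})" by (intro UN_I[of n]) (auto simp: field_simps)
    qed
    have inc: "incseq (\<lambda>n. {x + 1 / real (Suc n)..})"
      by (auto simp: incseq_def intro: order_trans[rotated] divide_left_mono)
    have "range (\<lambda>n. {x + 1 / real (Suc n)..}) \<subseteq> sets N" by (auto simp: that)
    from SUP_emeasure_incseq[OF this inc] show ?thesis by (simp only: UN)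
  qed
  then show "emeasure N1 {x<..} = emeasure N2 {x<..}" by (simp add: sets eq)
qed

text \<open>Ramps of slope \<open>n\<close> increase to the indicator of \<open>{x<..}\<close>.
  Lipschitz test functions are those for which the transform of \<open>(B t, L t)\<close> is
  computed.\<close>

lemma finite_borel_measure_eqI_Lipschitz:
  fixes N1 N2 :: "real measure"
  assumes fin: "finite_measure N1" "finite_measure N2" and sets: "sets N1 = sets borel" "sets N2 = sets borel"
    and eq: "\<And>\<phi> C. \<phi> \<in> borel_measurable borel \<Longrightarrow> (\<And>x. 0 \<le> \<phi> x) \<Longrightarrow> (\<And>x. \<phi> x \<le> 1) \<Longrightarrow>
       0 \<le> C \<Longrightarrow> (\<And>x y. \<bar>\<phi> x - \<phi> y\<bar> \<le> C * \<bar>x - y\<bar>) \<Longrightarrow>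
       (\<integral>\<^sup>+x. ennreal (\<phi> x) \<partial>N1) = (\<integral>\<^sup>+x. ennreal (\<phi> x) \<partial>N2)"
  shows "N1 = N2"
proof (rule finite_borel_measure_eqI_greaterThan[OF fin sets])
  have sp: "space N1 = UNIV" "space N2 = UNIV"
    using sets_eq_imp_space_eq[OF sets(1)] sets_eq_imp_space_eq[OF sets(2)] by auto
  show "emeasure N1 UNIV = emeasure N2 UNIV"
    using eq[of "\<lambda>_. 1" 0] by (simp add: sp)
  fix x :: real
  let ?\<phi> = "\<lambda>(n::nat) y. min 1 (max 0 (real n * (y - x)))"
  have lim: "emeasure N {x<..} = (SUP n. \<integral>\<^sup>+y. ennreal (?\<phi> n y) \<partial>N)" if [measurable_cong]: "sets N = sets borel" for N
  proof -
    have "incseq (\<lambda>n y. ennreal (?\<phi> n y))"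
    proof (intro monoI le_funI ennreal_leI)
      fix m n :: nat and y assume "m \<le> n"
      then show "?\<phi> m y \<le> ?\<phi> n y"
        using mult_right_mono[of "real m" "real n" "y - x"] by (cases "x \<le> y") (auto simp: mult_nonneg_nonpos)
    qed
    then have "(SUP n. \<integral>\<^sup>+y. ennreal (?\<phi> n y) \<partial>N) = (\<integral>\<^sup>+y. (SUP n. ennreal (?\<phi> n y)) \<partial>N)"
      by (intro nn_integral_monotone_convergence_SUP[symmetric]) auto
    also have "\<dots> = (\<integral>\<^sup>+y. indicator {x<..} y \<partial>N)"
    proof (rule nn_integral_cong)
      fix y
      show "(SUP n. ennreal (?\<phi> n y)) = indicator {x<..} y"
      proof (cases "x < y")
        case True
        then obtain n :: nat where "1 < real n * (y - x)" using reals_Archimedean3[of "y - x"] by auto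
        then have "1 = ennreal (?\<phi> n y)" by simp
        also have "\<dots> \<le> (SUP n. ennreal (?\<phi> n y))" by (rule SUP_upper) simp
        finally have "1 \<le> (SUP n. ennreal (?\<phi> n y))" .
        moreover have "(SUP n. ennreal (?\<phi> n y)) \<le> 1" by (intro SUP_least) simp
        ultimately have "(SUP n. ennreal (?\<phi> n y)) = 1" by (rule antisym[rotated])
        then show ?thesis using True by simp
      next
        case False
        then have "real n * (y - x) \<le> 0" for n by (simp add: mult_nonneg_nonpos)
        then have "?\<phi> n y = 0" for n by (simp add: max_absorb1)
        then show ?thesis using False by simp
      qed
    qed
    finally show ?thesis by simp
  qed
  have "(\<integral>\<^sup>+y. ennreal (?\<phi> n y) \<partial>N1) = (\<integral>\<^sup>+y. ennreal (?\<phi> n y) \<partial>N2)" for n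
  proof (rule eq[of _ "real n"])
    fix y z
    have "\<bar>?\<phi> n y - ?\<phi> n z\<bar> \<le> \<bar>real n * (y - x) - real n * (z - x)\<bar>" by linarith
    also have "\<dots> = real n * \<bar>y - z\<bar>" by (simp add: right_diff_distrib[symmetric] abs_mult)
    finally show "\<bar>?\<phi> n y - ?\<phi> n z\<bar> \<le> real n * \<bar>y - z\<bar>" .
  qed auto
  then show "emeasure N1 {x<..} = emeasure N2 {x<..}" by (simp add: lim sets)
qed

lemma finite_measure_eqI_rectangles:
  assumes "finite_measure N1" and sets: "sets N1 = sets (A \<Otimes>\<^sub>M B)" "sets N2 = sets (A \<Otimes>\<^sub>M B)"
    and eq: "\<And>S T. S \<in> sets A \<Longrightarrow> T \<in> sets B \<Longrightarrow> emeasure N1 (S \<times> T) = emeasure N2 (S \<times> T)"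
  shows "N1 = N2"
proof (rule measure_eqI_generator_eq[OF Int_stable_pair_measure_generator[of A B]])
  show "{a \<times> b |a b. a \<in> sets A \<and> b \<in> sets B} \<subseteq> Pow (space A \<times> space B)"
    using sets.space_closed[of A] sets.space_closed[of B] by auto
  show "sets N1 = sigma_sets (space A \<times> space B) {a \<times> b |a b. a \<in> sets A \<and> b \<in> sets B}"
    "sets N2 = sigma_sets (space A \<times> space B) {a \<times> b |a b. a \<in> sets A \<and> b \<in> sets B}"
    by (simp_all add: sets sets_pair_measure)
  show "range (\<lambda>_::nat. space A \<times> space B) \<subseteq> {a \<times> b |a b. a \<in> sets A \<and> b \<in> sets B}" by auto
  show "emeasure N1 (space A \<times> space B) \<noteq> \<infinity>"
    using finite_measure.emeasure_finite[OF assms(1)] by simp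
qed (use eq in auto)

section \<open>Independence as a product of laws\<close>

lemma (in prob_space) independent_rvs_distr:
  assumes "independent_rvs M N X K Y"
  shows "distr M (N \<Otimes>\<^sub>M K) (\<lambda>\<omega>. (X \<omega>, Y \<omega>)) = distr M N X \<Otimes>\<^sub>M distr M K Y"
proof -
  have [measurable]: "X \<in> measurable M N" "Y \<in> measurable M K"
    and ind: "indep_set (sets (vimage_algebra (space M) X N)) (sets (vimage_algebra (space M) Y K))"
    using assms by (auto simp: independent_rvs_def)
  interpret X: prob_space "distr M N X" by (rule prob_space_distr) simp
  interpret Y: prob_space "distr M K Y" by (rule prob_space_distr) simp
  show ?thesis
  proof (rule pair_measure_eqI[symmetric])
    show "sigma_finite_measure (distr M N X)" "sigma_finite_measure (distr M K Y)" by unfold_locales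
    show "sets (distr M N X \<Otimes>\<^sub>M distr M K Y) = sets (distr M (N \<Otimes>\<^sub>M K) (\<lambda>\<omega>. (X \<omega>, Y \<omega>)))"
      by (simp cong: sets_pair_measure_cong)
    fix A B assume "A \<in> sets (distr M N X)" "B \<in> sets (distr M K Y)"
    then have [measurable]: "A \<in> sets N" "B \<in> sets K" by auto
    have "prob ((X -` A \<inter> space M) \<inter> (Y -` B \<inter> space M)) = prob (X -` A \<inter> space M) * prob (Y -` B \<inter> space M)"
      by (rule indep_setD[OF ind]) (auto intro: in_vimage_algebra)
    moreover have "(X -` A \<inter> space M) \<inter> (Y -` B \<inter> space M) = (\<lambda>\<omega>. (X \<omega>, Y \<omega>)) -` (A \<times> B) \<inter> space M" by auto
    ultimately show "emeasure (distr M N X) A * emeasure (distr M K Y) B = emeasure (distr M (N \<Otimes>\<^sub>M K) (\<lambda>\<omega>. (X \<omega>, Y \<omega>))) (A \<times> B)"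
      by (simp add: emeasure_distr emeasure_eq_measure ennreal_mult'[symmetric])
  qed
qed

text \<open>Serves as conditioning on \<open>X\<close>: the independent argument is integrated
  first, under its own law.\<close>

lemma (in prob_space) nn_integral_independent_rvs:
  assumes ind: "independent_rvs M N X K Y" and [measurable]: "f \<in> borel_measurable (N \<Otimes>\<^sub>M K)"
  shows "(\<integral>\<^sup>+\<omega>. f (X \<omega>, Y \<omega>) \<partial>M) = (\<integral>\<^sup>+\<omega>. (\<integral>\<^sup>+y. f (X \<omega>, y) \<partial>distr M K Y) \<partial>M)"
proof -
  have [measurable]: "X \<in> measurable M N" "Y \<in> measurable M K"
    using ind by (auto simp: independent_rvs_def)
  interpret Y: prob_space "distr M K Y" by (rule prob_space_distr) simp
  have "(\<integral>\<^sup>+\<omega>. f (X \<omega>, Y \<omega>) \<partial>M) = (\<integral>\<^sup>+z. f z \<partial>(distr M N X \<Otimes>\<^sub>M distr M K Y))"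
    by (subst independent_rvs_distr[OF ind, symmetric]) (simp add: nn_integral_distr)
  also have "\<dots> = (\<integral>\<^sup>+x. (\<integral>\<^sup>+y. f (x, y) \<partial>distr M K Y) \<partial>distr M N X)"
    by (rule Y.nn_integral_fst[symmetric]) simp
  also have "\<dots> = (\<integral>\<^sup>+\<omega>. (\<integral>\<^sup>+y. f (X \<omega>, y) \<partial>distr M K Y) \<partial>M)"
    by (simp add: nn_integral_distr)
  finally show ?thesis .
qed

section \<open>Brownian motion with continuous paths\<close>

text \<open>Has countably many values, so that a process evaluated at it is jointly measurable in
  path and time; continuity of paths enters only in the limit of large \<open>n\<close>.\<close>

definition dyadic_floor :: "nat \<Rightarrow> real \<Rightarrow> real" where
  "dyadic_floor n t = real_of_int \<lfloor>t * 2 ^ n\<rfloor> / 2 ^ n"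

lemma dyadic_floor_tendsto: "(\<lambda>n. dyadic_floor n t) \<longlonglongrightarrow> t"
proof -
  have "\<bar>dyadic_floor n t - t\<bar> \<le> (1 / 2) ^ n" for n
  proof -
    have "(t * 2 ^ n - 1) / 2 ^ n \<le> dyadic_floor n t" "dyadic_floor n t \<le> t * 2 ^ n / 2 ^ n"
      unfolding dyadic_floor_def by (intro divide_right_mono; linarith?; simp)+
    then have "t - (1 / 2) ^ n \<le> dyadic_floor n t" "dyadic_floor n t \<le> t"
      by (simp_all add: diff_divide_distrib power_one_over)
    then show ?thesis by simp
  qed
  then have "(\<lambda>n. dyadic_floor n t - t) \<longlonglongrightarrow> 0"
    by (intro Lim_null_comparison[OF _ LIMSEQ_realpow_zero[of "1/2"]] always_eventually) auto
  then show ?thesis by (simp add: LIM_zero_iff)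
qed

text \<open>Evaluation of a path, jointly measurable in the path and the time, that agrees with the path
  itself at all times \<open>t \<ge> 0\<close> if it is continuous.\<close>

definition path_eval :: "(real \<Rightarrow> real) \<Rightarrow> real \<Rightarrow> real" where
  "path_eval w t = lim (\<lambda>n. w (max 0 (dyadic_floor n t)))"

lemma path_eval_measurable' :
  "(\<lambda>p. path_eval (fst p) (snd p)) \<in> borel_measurable (path_algebra \<Otimes>\<^sub>M borel)"
  unfolding path_eval_def
proof (rule borel_measurable_lim_metric)
  fix n
  have *: "(\<lambda>p :: (real \<Rightarrow> real) \<times> real. fst p (max 0 (real_of_int i / 2 ^ n))) \<in> borel_measurable (path_algebra \<Otimes>\<^sub>M borel)" for i
    by (rule measurable_compose[OF measurable_fst measurable_component_singleton]) simp
  have "(\<lambda>p :: (real \<Rightarrow> real) \<times> real. \<lfloor>snd p * 2 ^ n\<rfloor>) \<in> measurable (path_algebra \<Otimes>\<^sub>M borel) (count_space UNIV)"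
    by measurable
  from measurable_compose_countable[OF * this]
  show "(\<lambda>p. fst p (max 0 (dyadic_floor n (snd p)))) \<in> borel_measurable (path_algebra \<Otimes>\<^sub>M borel)"
    by (simp add: dyadic_floor_def)
qed

lemma path_eval_measurable [measurable (raw)]:
  assumes [measurable]: "f \<in> measurable M path_algebra" "g \<in> borel_measurable M"
  shows "(\<lambda>x. path_eval (f x) (g x)) \<in> borel_measurable M"
  using measurable_compose[OF _ path_eval_measurable', of "\<lambda>x. (f x, g x)" M] by simp

lemma path_eval_restrict:
  assumes "continuous_on UNIV f" "0 \<le> t"
  shows "path_eval (restrict f {0..}) t = f t"
proof -
  have "(\<lambda>n. max 0 (dyadic_floor n t)) \<longlonglongrightarrow> max 0 t"
    by (intro tendsto_max tendsto_const dyadic_floor_tendsto)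
  then have "(\<lambda>n. f (max 0 (dyadic_floor n t))) \<longlonglongrightarrow> f t"
    using assms by (intro isCont_tendsto_compose[of _ f]) (auto simp: continuous_on_eq_continuous_at)
  then show ?thesis
    unfolding path_eval_def by (intro limI) simp
qed

lemma continuous_process_measurable:
  fixes X :: "real \<Rightarrow> 'a \<Rightarrow> real"
  assumes [measurable]: "\<And>t. X t \<in> borel_measurable M" and cont: "\<And>\<omega>. continuous_on UNIV (\<lambda>t. X t \<omega>)"
  shows "(\<lambda>p. X (snd p) (fst p)) \<in> borel_measurable (M \<Otimes>\<^sub>M borel)"
proof (rule borel_measurable_LIMSEQ_real)
  fix p :: "'a \<times> real"
  show "(\<lambda>n. X (dyadic_floor n (snd p)) (fst p)) \<longlonglongrightarrow> X (snd p) (fst p)"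
    using cont[of "fst p"]
    by (intro isCont_tendsto_compose[of _ "\<lambda>t. X t (fst p)"] dyadic_floor_tendsto)
       (auto simp: continuous_on_eq_continuous_at)
next
  fix n
  have *: "(\<lambda>p :: 'a \<times> real. X (real_of_int i / 2 ^ n) (fst p)) \<in> borel_measurable (M \<Otimes>\<^sub>M borel)" for i
    by measurable
  have "(\<lambda>p :: 'a \<times> real. \<lfloor>snd p * 2 ^ n\<rfloor>) \<in> measurable (M \<Otimes>\<^sub>M borel) (count_space UNIV)"
    by measurable
  from measurable_compose_countable[OF * this]
  show "(\<lambda>p. X (dyadic_floor n (snd p)) (fst p)) \<in> borel_measurable (M \<Otimes>\<^sub>M borel)"
    by (simp add: dyadic_floor_def)
qed

text \<open>Path properties hold for every \<open>\<omega>\<close>, and the paths are defined and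
  continuous on the whole line. The given process is brought into this form by a modification on a
  null set.\<close>

locale continuous_BM = prob_space M for M :: "'a measure" +
  fixes B :: "real \<Rightarrow> 'a \<Rightarrow> real"
  assumes B_measurable [measurable]: "\<And>t. B t \<in> borel_measurable M"
    and B_continuous: "\<And>\<omega>. continuous_on UNIV (\<lambda>t. B t \<omega>)"
    and B_0 [simp]: "\<And>\<omega>. B 0 \<omega> = 0"
    and B_increment: "\<And>s t. 0 \<le> s \<Longrightarrow> s < t \<Longrightarrow>
      distributed M lborel (\<lambda>\<omega>. B t \<omega> - B s \<omega>) (normal_density 0 (sqrt (t - s)))"
    and B_indep: "\<And>(t :: nat \<Rightarrow> real) n. 0 \<le> t 0 \<Longrightarrow> mono t \<Longrightarrow>
      indep_vars (\<lambda>_. borel) (\<lambda>i \<omega>. B (t (Suc i)) \<omega> - B (t i) \<omega>) {..<n}"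
begin

lemma B_joint_measurable [measurable (raw)]:
  assumes [measurable]: "f \<in> borel_measurable N" "g \<in> measurable N M"
  shows "(\<lambda>x. B (f x) (g x)) \<in> borel_measurable N"
  using measurable_compose[OF _ continuous_process_measurable[OF B_measurable B_continuous], of "\<lambda>x. (g x, f x)" N] by simp

lemma B_path_measurable: "(\<lambda>t. B t \<omega>) \<in> borel_measurable borel"
  using B_continuous by (rule borel_measurable_continuous_onI)

text \<open>The path frozen at time \<open>r\<close>, which keeps it continuous and in the same path
  space.\<close>

definition past :: "real \<Rightarrow> 'a \<Rightarrow> real \<Rightarrow> real" where
  "past r \<omega> = (\<lambda>q\<in>{0..}. B (min q r) \<omega>)"

definition future :: "real \<Rightarrow> 'a \<Rightarrow> real \<Rightarrow> real" where
  "future r \<omega> = (\<lambda>q\<in>{0..}. B (r + q) \<omega> - B r \<omega>)"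

lemma past_measurable [measurable]: "past r \<in> measurable M path_algebra"
  unfolding past_def by (rule measurable_restrict) measurable

lemma future_measurable [measurable]: "future r \<in> measurable M path_algebra"
  unfolding future_def by (rule measurable_restrict) measurable

lemma path_eval_past:
  assumes "0 \<le> q" "q \<le> r" shows "path_eval (past r \<omega>) q = B q \<omega>"
  using path_eval_restrict[of "\<lambda>q. B (min q r) \<omega>" q] assms
  by (simp add: past_def continuous_on_compose2[OF B_continuous] continuous_intros)

lemma path_eval_future:
  assumes "0 \<le> q" shows "path_eval (future r \<omega>) q = B (r + q) \<omega> - B r \<omega>"
  using path_eval_restrict[of "\<lambda>q. B (r + q) \<omega> - B r \<omega>" q] assms
  by (simp add: future_def continuous_on_compose2[OF B_continuous] continuous_intros)

text \<open>The sorted enumeration, continued constantly with its last element: independence of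
  increments is assumed along monotone sequences indexed by all natural numbers.\<close>

lemma grid_through_points:
  fixes G :: "real set"
  assumes "finite G" "\<And>g. g \<in> G \<Longrightarrow> 0 \<le> g" "0 \<in> G"
  obtains t :: "nat \<Rightarrow> real" and n where "mono t" "t 0 = 0" "\<And>g. g \<in> G \<Longrightarrow> \<exists>i\<le>n. g = t i"
proof -
  define xs where "xs = sorted_list_of_set G"
  have xs: "set xs = G" "sorted xs" using assms(1) by (simp_all add: xs_def)
  have len: "0 < length xs" using xs(1) assms(3) by auto
  define t where "t i = xs ! min i (length xs - 1)" for i
  have "mono t"
  proof (rule monoI)
    fix i j :: nat assume "i \<le> j"
    then have "min i (length xs - 1) \<le> min j (length xs - 1)" "min j (length xs - 1) < length xs"
      using len by linarith+
    then show "t i \<le> t j" unfolding t_def by (rule sorted_nth_mono[OF xs(2)])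
  qed
  moreover have ex: "\<exists>i\<le>length xs - 1. g = t i" if g: "g \<in> G" for g
  proof -
    obtain i where "i < length xs" "xs ! i = g" using g xs(1) by (metis in_set_conv_nth)
    then show ?thesis by (intro exI[of _ i]) (auto simp: t_def min_def)
  qed
  moreover have "t 0 = 0"
  proof (rule antisym)
    obtain i where "0 = t i" using ex[OF assms(3)] by auto
    then show "t 0 \<le> 0" using monoD[OF \<open>mono t\<close>, of 0 i] by simp
    have "t 0 \<in> G" using len nth_mem[of 0 xs] by (simp add: t_def xs(1))
    then show "0 \<le> t 0" by (rule assms(2))
  qed
  ultimately show ?thesis using that by blast
qed

text \<open>All times are placed on one grid containing \<open>r = t m\<close>. Values up to
  \<open>r\<close> are sums of increments with index below \<open>m\<close>, increments after
  \<open>r\<close> are sums of those from \<open>m\<close> on, and the two blocks are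
  independent.\<close>

lemma cylinder_independence:
  assumes r: "0 \<le> r" and J: "finite J" "J \<subseteq> {0..}" and K: "finite K" "K \<subseteq> {0..}"
    and S: "\<And>j. j \<in> J \<Longrightarrow> S j \<in> sets borel" and T: "\<And>k. k \<in> K \<Longrightarrow> T k \<in> sets borel"
  shows "prob ({\<omega>\<in>space M. \<forall>j\<in>J. B (min j r) \<omega> \<in> S j} \<inter> {\<omega>\<in>space M. \<forall>k\<in>K. B (r + k) \<omega> - B r \<omega> \<in> T k})
    = prob {\<omega>\<in>space M. \<forall>j\<in>J. B (min j r) \<omega> \<in> S j} * prob {\<omega>\<in>space M. \<forall>k\<in>K. B (r + k) \<omega> - B r \<omega> \<in> T k}"
proof -
  define G where "G = {0, r} \<union> (\<lambda>j. min j r) ` J \<union> (\<lambda>k. r + k) ` K"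
  have G: "finite G" "0 \<in> G" "\<And>g. g \<in> G \<Longrightarrow> 0 \<le> g"
    using J K r by (auto simp: G_def)
  obtain t :: "nat \<Rightarrow> real" and n where mono: "mono t" and t0: "t 0 = 0" and ex: "\<And>g. g \<in> G \<Longrightarrow> \<exists>i\<le>n. g = t i"
    using grid_through_points[OF G(1,3,2)] by blast
  obtain m where m: "m \<le> n" "r = t m" using ex[of r] by (auto simp: G_def)
  have "\<exists>i\<le>m. min j r = t i" if "j \<in> J" for j
  proof -
    obtain i where i: "min j r = t i" using ex[of "min j r"] \<open>j \<in> J\<close> by (auto simp: G_def)
    show ?thesis
    \<comment> \<open>An index beyond \<open>m\<close> whose grid point is at most \<open>r\<close>
      forces \<open>t i = t m\<close>, so \<open>m\<close> may replace it.\<close>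
    proof (cases "i \<le> m")
      case False
      then have "t m \<le> t i" using monoD[OF mono, of m i] by simp
      then show ?thesis using i m(2) by (intro exI[of _ m]) auto
    qed (use i in auto)
  qed
  then obtain ij where ij: "\<And>j. j \<in> J \<Longrightarrow> ij j \<le> m" "\<And>j. j \<in> J \<Longrightarrow> min j r = t (ij j)" by metis
  have "\<exists>i\<ge>m. i \<le> n \<and> r + k = t i" if "k \<in> K" for k
  proof -
    obtain i where i: "r + k = t i" "i \<le> n" using ex[of "r + k"] \<open>k \<in> K\<close> by (auto simp: G_def)
    show ?thesis
    proof (cases "m \<le> i")
      case False
      then have "t i \<le> t m" using monoD[OF mono, of i m] by simp
      then show ?thesis using i m K(2) that by (intro exI[of _ m]) force
    qed (use i in auto)
  qed
  then obtain ik where ik: "\<And>k. k \<in> K \<Longrightarrow> m \<le> ik k" "\<And>k. k \<in> K \<Longrightarrow> ik k \<le> n" "\<And>k. k \<in> K \<Longrightarrow> r + k = t (ik k)" by metis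
  let ?D = "\<lambda>i \<omega>. B (t (Suc i)) \<omega> - B (t i) \<omega>"
  have sum: "B (t j) \<omega> - B (t i) \<omega> = (\<Sum>k=i..<j. ?D k \<omega>)" if "i \<le> j" for i j \<omega>
    using that by (induction rule: dec_induct) auto
  have ind: "indep_var (PiM {..<m} (\<lambda>_. borel)) (\<lambda>\<omega>. restrict (\<lambda>i. ?D i \<omega>) {..<m})
      (PiM {m..<n} (\<lambda>_. borel)) (\<lambda>\<omega>. restrict (\<lambda>i. ?D i \<omega>) {m..<n})"
    by (rule indep_var_restrict[OF B_indep[of t n]]) (use t0 mono m in auto)
  define E1 where "E1 = {y \<in> space (PiM {..<m} (\<lambda>_. borel)). \<forall>j\<in>J. (\<Sum>k=0..<ij j. y k) \<in> S j}"
  define E2 where "E2 = {y \<in> space (PiM {m..<n} (\<lambda>_. borel)). \<forall>j\<in>K. (\<Sum>k=m..<ik j. y k) \<in> T j}"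
  have E1: "E1 \<in> sets (PiM {..<m} (\<lambda>_. borel))"
    unfolding E1_def
  proof (rule sets.sets_Collect_finite_All[OF _ J(1)])
    fix j assume j: "j \<in> J"
    have "(\<lambda>y. \<Sum>k=0..<ij j. y k) \<in> borel_measurable (PiM {..<m} (\<lambda>_. borel :: real measure))"
      using ij(1)[OF j] by (intro borel_measurable_sum measurable_component_singleton) auto
    from measurable_sets[OF this S[OF j]]
    show "{y \<in> space (PiM {..<m} (\<lambda>_. borel)). (\<Sum>k=0..<ij j. y k) \<in> S j} \<in> sets (PiM {..<m} (\<lambda>_. borel))"
      by (simp add: vimage_def Int_def conj_commute)
  qed
  have E2: "E2 \<in> sets (PiM {m..<n} (\<lambda>_. borel))"
    unfolding E2_def
  proof (rule sets.sets_Collect_finite_All[OF _ K(1)])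
    fix j assume j: "j \<in> K"
    have "(\<lambda>y. \<Sum>k=m..<ik j. y k) \<in> borel_measurable (PiM {m..<n} (\<lambda>_. borel :: real measure))"
      using ik(1,2)[OF j] by (intro borel_measurable_sum measurable_component_singleton) auto
    from measurable_sets[OF this T[OF j]]
    show "{y \<in> space (PiM {m..<n} (\<lambda>_. borel)). (\<Sum>k=m..<ik j. y k) \<in> T j} \<in> sets (PiM {m..<n} (\<lambda>_. borel))"
      by (simp add: vimage_def Int_def conj_commute)
  qed
  have 1: "(\<lambda>\<omega>. restrict (\<lambda>i. ?D i \<omega>) {..<m}) -` E1 \<inter> space M = {\<omega>\<in>space M. \<forall>j\<in>J. B (min j r) \<omega> \<in> S j}"
  proof -
    have "(\<Sum>k=0..<ij j. restrict (\<lambda>i. ?D i \<omega>) {..<m} k) = B (min j r) \<omega>" if "j \<in> J" for j \<omega>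
    proof -
      have "(\<Sum>k=0..<ij j. restrict (\<lambda>i. ?D i \<omega>) {..<m} k) = (\<Sum>k=0..<ij j. ?D k \<omega>)"
        using ij(1)[OF that] by (intro sum.cong) auto
      also have "\<dots> = B (min j r) \<omega>" using sum[of 0 "ij j" \<omega>] ij(2)[OF that] by (simp add: t0)
      finally show ?thesis .
    qed
    then show ?thesis by (auto simp: E1_def space_PiM)
  qed
  have 2: "(\<lambda>\<omega>. restrict (\<lambda>i. ?D i \<omega>) {m..<n}) -` E2 \<inter> space M = {\<omega>\<in>space M. \<forall>k\<in>K. B (r + k) \<omega> - B r \<omega> \<in> T k}"
  proof -
    have "(\<Sum>k=m..<ik j. restrict (\<lambda>i. ?D i \<omega>) {m..<n} k) = B (r + j) \<omega> - B r \<omega>" if "j \<in> K" for j \<omega>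
    proof -
      have "(\<Sum>k=m..<ik j. restrict (\<lambda>i. ?D i \<omega>) {m..<n} k) = (\<Sum>k=m..<ik j. ?D k \<omega>)"
        using ik(1,2)[OF that] by (intro sum.cong) auto
      also have "\<dots> = B (r + j) \<omega> - B r \<omega>" using sum[of m "ik j" \<omega>] ik[OF that] m(2) by simp
      finally show ?thesis .
    qed
    then show ?thesis by (auto simp: E2_def space_PiM)
  qed
  have "prob ((\<lambda>\<omega>. (restrict (\<lambda>i. ?D i \<omega>) {..<m}, restrict (\<lambda>i. ?D i \<omega>) {m..<n})) -` (E1 \<times> E2) \<inter> space M) =
     prob ((\<lambda>\<omega>. restrict (\<lambda>i. ?D i \<omega>) {..<m}) -` E1 \<inter> space M) * prob ((\<lambda>\<omega>. restrict (\<lambda>i. ?D i \<omega>) {m..<n}) -` E2 \<inter> space M)"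
    by (rule indep_varD[OF ind E1 E2])
  moreover have "(\<lambda>\<omega>. (restrict (\<lambda>i. ?D i \<omega>) {..<m}, restrict (\<lambda>i. ?D i \<omega>) {m..<n})) -` (E1 \<times> E2) \<inter> space M
     = ((\<lambda>\<omega>. restrict (\<lambda>i. ?D i \<omega>) {..<m}) -` E1 \<inter> space M) \<inter> ((\<lambda>\<omega>. restrict (\<lambda>i. ?D i \<omega>) {m..<n}) -` E2 \<inter> space M)"
    by auto
  ultimately show ?thesis by (simp only: 1 2)
qed

lemma sets_vimage_path_algebra:
  assumes "X \<in> measurable M path_algebra"
  shows "sets (vimage_algebra (space M) X path_algebra) =
    sigma_sets (space M) {X -` A \<inter> space M | A. A \<in> prod_algebra {0..} (\<lambda>_. borel)}"
proof -
  have X: "X \<in> space M \<rightarrow> space path_algebra" using assms by (auto dest: measurable_space)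
  then have X': "X \<in> space M \<rightarrow> (\<Pi>\<^sub>E i\<in>{0..}. space borel)" by (simp only: space_PiM)
  have "sets (vimage_algebra (space M) X path_algebra) = {X -` A \<inter> space M | A. A \<in> sets path_algebra}"
    by (rule sets_vimage_algebra2[OF X])
  also have "\<dots> = sigma_sets (space M) {X -` A \<inter> space M | A. A \<in> prod_algebra {0..} (\<lambda>_. borel)}"
    unfolding sets_PiM by (rule sigma_sets_vimage_commute[OF X'])
  finally show ?thesis .
qed

text \<open>Cylinders are stable under intersection and generate the path algebra, so the
  factorisation on cylinders extends to all events of past and future.\<close>

lemma independent_past_future:
  assumes r: "0 \<le> r"
  shows "independent_rvs M path_algebra (past r) path_algebra (future r)"
proof -
  let ?P = "prod_algebra {0::real..} (\<lambda>_. borel :: real measure)"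
  let ?G = "\<lambda>X. {X -` A \<inter> space M | A. A \<in> ?P}"
  have stable: "Int_stable (?G X)" for X :: "'a \<Rightarrow> real \<Rightarrow> real"
  proof (safe intro!: Int_stableI)
    fix A A' assume "A \<in> ?P" "A' \<in> ?P"
    then have "A \<inter> A' \<in> ?P" using Int_stable_prod_algebra by (auto simp: Int_stable_def)
    then show "\<exists>A''. X -` A \<inter> space M \<inter> (X -` A' \<inter> space M) = X -` A'' \<inter> space M \<and> A'' \<in> ?P"
      by (intro exI[of _ "A \<inter> A'"]) auto
  qed
  have sub: "?P \<subseteq> sets path_algebra" unfolding sets_PiM by auto
  have "indep_set (?G (past r)) (?G (future r))"
  proof (rule indep_setI)
    show "?G (past r) \<subseteq> events" "?G (future r) \<subseteq> events"
      using sub by (auto intro: measurable_sets[OF past_measurable] measurable_sets[OF future_measurable])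
    fix a b assume "a \<in> ?G (past r)" "b \<in> ?G (future r)"
    then obtain A A' where A: "a = past r -` A \<inter> space M" "A \<in> ?P" and A': "b = future r -` A' \<inter> space M" "A' \<in> ?P"
      by auto
    from A(2) obtain J S where J: "A = prod_emb {0..} (\<lambda>_. borel) J (Pi\<^sub>E J S)" "finite J" "J \<subseteq> {0..}" "\<And>j. j \<in> J \<Longrightarrow> S j \<in> sets borel"
      by (rule prod_algebraE) auto
    from A'(2) obtain K T where K: "A' = prod_emb {0..} (\<lambda>_. borel) K (Pi\<^sub>E K T)" "finite K" "K \<subseteq> {0..}" "\<And>j. j \<in> K \<Longrightarrow> T j \<in> sets borel"
      by (rule prod_algebraE) auto
    have a: "a = {\<omega>\<in>space M. \<forall>j\<in>J. B (min j r) \<omega> \<in> S j}"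
      using J(3) by (auto simp: A(1) J(1) prod_emb_iff past_def PiE_iff subset_eq)
    have b: "b = {\<omega>\<in>space M. \<forall>k\<in>K. B (r + k) \<omega> - B r \<omega> \<in> T k}"
      using K(3) by (auto simp: A'(1) K(1) prod_emb_iff future_def PiE_iff subset_eq)
    show "prob (a \<inter> b) = prob a * prob b"
      unfolding a b by (rule cylinder_independence[OF r J(2,3) K(2,3) J(4) K(4)])
  qed
  then have "indep_set (sigma_sets (space M) (?G (past r))) (sigma_sets (space M) (?G (future r)))"
    by (rule indep_set_sigma_sets) (rule stable)+
  then show ?thesis
    unfolding independent_rvs_def by (simp add: sets_vimage_path_algebra)
qed

end

section \<open>Regularised local time\<close>

lemma constant_if_quadratic_modulus:
  fixes H :: "real \<Rightarrow> real"
  assumes st: "s \<le> t" and H: "\<And>x y. s \<le> x \<Longrightarrow> x \<le> y \<Longrightarrow> y \<le> t \<Longrightarrow> \<bar>H y - H x\<bar> \<le> C * (y - x)\<^sup>2"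
  shows "H s = H t"
proof -
  have H': "\<bar>H y - H x\<bar> \<le> C * (y - x)\<^sup>2" if "x \<in> {s..t}" "y \<in> {s..t}" for x y
    using H[of x y] H[of y x] that by (cases "x \<le> y") (auto simp: abs_minus_commute power2_commute)
  have "(H has_field_derivative 0) (at x within {s..t})" if x: "x \<in> {s..t}" for x
    unfolding has_field_derivative_iff
  proof (rule Lim_null_comparison)
    show "\<forall>\<^sub>F y in at x within {s..t}. norm ((H y - H x) / (y - x)) \<le> C * \<bar>y - x\<bar>"
      unfolding eventually_at
    proof (intro exI[of _ 1] conjI ballI impI)
      fix y assume y: "y \<in> {s..t}" "y \<noteq> x \<and> dist y x < 1"
      have "\<bar>H y - H x\<bar> \<le> (C * \<bar>y - x\<bar>) * \<bar>y - x\<bar>"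
        using H'[OF x y(1)] by (simp add: power2_eq_square abs_mult[symmetric] mult.assoc)
      then show "norm ((H y - H x) / (y - x)) \<le> C * \<bar>y - x\<bar>"
        using y(2) by (simp add: divide_le_eq)
    qed simp
    show "((\<lambda>y. C * \<bar>y - x\<bar>) \<longlongrightarrow> 0) (at x within {s..t})"
      by (auto intro!: tendsto_eq_intros)
  qed
  then obtain c where "\<And>x. x \<in> {s..t} \<Longrightarrow> H x = c"
    using has_field_derivative_zero_constant[of "{s..t}" H] by auto
  then show ?thesis using st by auto
qed

lemma integrable_if_bounded_interval:
  fixes f :: "real \<Rightarrow> real"
  assumes [measurable]: "f \<in> borel_measurable borel" and bd: "\<And>x. \<bar>f x\<bar> \<le> K"
  shows "integrable lborel (\<lambda>q. if a \<le> q \<and> q \<le> b then f q else 0)"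
proof (rule Bochner_Integration.integrable_bound)
  show "integrable lborel (\<lambda>q. K * indicator {a..b} q :: real)"
    by (intro integrable_mult_right integrable_real_indicator) (auto simp: emeasure_lborel_Icc_eq)
  show "AE q in lborel. norm (if a \<le> q \<and> q \<le> b then f q else 0) \<le> norm (K * indicator {a..b} q)"
    using bd order_trans[OF abs_ge_zero bd] by (intro AE_I2) (auto split: split_indicator intro: order_trans[OF bd])
qed measurable

text \<open>Although \<open>j\<close> need not be continuous, \<open>G r + lam * \<integral>\<^sub>r\<^sup>t j * G\<close> with \<open>G r = exp (- lam * \<integral>\<^sub>r\<^sup>t j)\<close> has a
  quadratic modulus of continuity and hence is constant.\<close>

lemma exp_Duhamel:
  fixes j :: "real \<Rightarrow> real"
  assumes [measurable]: "j \<in> borel_measurable borel" and j: "\<And>x. 0 \<le> j x" "\<And>x. j x \<le> K"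
    and lam: "0 \<le> lam" and st: "s \<le> t"
  defines "I \<equiv> \<lambda>r. LINT q|lborel. (if r \<le> q \<and> q \<le> t then j q else 0)"
  shows "ennreal (exp (- lam * I s)) + ennreal lam * (\<integral>\<^sup>+r\<in>{s..t}. ennreal (j r * exp (- lam * I r)) \<partial>lborel) = 1"
proof -
  let ?int = "\<lambda>(f :: real \<Rightarrow> real) a b. LINT q|lborel. (if a \<le> q \<and> q \<le> b then f q else (0::real))"
  define G where "G r = exp (- lam * I r)" for r
  have K: "0 \<le> K" using j[of 0] by linarith
  have split: "?int f a c = ?int f a b + ?int f b c"
    if "a \<le> b" "b \<le> c" "f \<in> borel_measurable borel" "\<And>x. \<bar>f x\<bar> \<le> K" for f a b c
  proof -
    have i: "integrable lborel (\<lambda>q. if a \<le> q \<and> q \<le> b then f q else 0)" for a b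
      by (rule integrable_if_bounded_interval[of f K]) (use that in auto)
    have "?int f a b + ?int f b c = (LINT q|lborel. (if a \<le> q \<and> q \<le> b then f q else 0) + (if b \<le> q \<and> q \<le> c then f q else 0))"
      by (rule Bochner_Integration.integral_add[OF i i, symmetric])
    also have "\<dots> = ?int f a c"
    proof (rule integral_cong_AE)
      show "AE q in lborel. (if a \<le> q \<and> q \<le> b then f q else 0) + (if b \<le> q \<and> q \<le> c then f q else 0) = (if a \<le> q \<and> q \<le> c then f q else 0)"
        by (rule eventually_mono[OF AE_lborel_singleton[of b]]) (use that in auto)
    qed (use that(3) in measurable)
    finally show ?thesis by simp
  qed
  have const: "?int (\<lambda>_. c) a b = c * (b - a)" if "a \<le> b" for c a b :: real
  proof -
    have "?int (\<lambda>_. c) a b = (LINT q|lborel. c * indicator {a..b} q)"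
      by (intro Bochner_Integration.integral_cong) (auto split: split_indicator)
    also have "\<dots> = c * (b - a)" using that by simp
    finally show ?thesis .
  qed
  have jabs: "\<bar>j x\<bar> \<le> K" for x using j[of x] by simp
  have I_nonneg: "0 \<le> I r" for r unfolding I_def by (intro integral_nonneg_AE) (auto simp: j)
  have G_le: "G r \<le> 1" "0 < G r" for r using I_nonneg lam by (auto simp: G_def)
  have Gm [measurable]: "G \<in> borel_measurable borel" unfolding G_def I_def by measurable
  have jG: "\<bar>j x * G x\<bar> \<le> K" for x
    using mult_mono[OF j(2)[of x] G_le(1)[of x]] G_le[of x] j[of x] K by (simp add: abs_mult)
  define H where "H r = G r + lam * ?int (\<lambda>q. j q * G q) r t" for r
  have "H s = H t"
  proof (rule constant_if_quadratic_modulus[OF st])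
    fix x y assume xy: "s \<le> x" "x \<le> y" "y \<le> t"
    define d where "d = lam * ?int j x y"
    have Ixy: "I x = ?int j x y + I y" unfolding I_def using xy by (intro split jabs) auto
    have d: "0 \<le> d" "d \<le> lam * (K * (y - x))"
    proof -
      have "0 \<le> ?int j x y" by (intro integral_nonneg_AE) (auto simp: j)
      then show "0 \<le> d" using lam by (simp add: d_def)
      have "?int j x y \<le> ?int (\<lambda>_. K) x y"
        by (intro integral_mono integrable_if_bounded_interval[of _ K]) (use jabs K j in auto)
      then show "d \<le> lam * (K * (y - x))" using lam const[of x y K] xy by (simp add: d_def mult_left_mono)
    qed
    have GG: "G y = G x * exp d" unfolding G_def Ixy d_def by (simp add: exp_add[symmetric] algebra_simps)
    have W: "?int (\<lambda>q. j q * G q) x t = ?int (\<lambda>q. j q * G q) x y + ?int (\<lambda>q. j q * G q) y t"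
      using xy by (intro split jG) auto
    have Gmono: "G x \<le> G q" "G q \<le> G y" if "x \<le> q" "q \<le> y" for q
    proof -
      have "I x = ?int j x q + I q" "I q = ?int j q y + I y" unfolding I_def using xy that by (intro split jabs; auto)+
      moreover have "0 \<le> ?int j x q" "0 \<le> ?int j q y" by (intro integral_nonneg_AE; auto simp: j)+
      ultimately show "G x \<le> G q" "G q \<le> G y" using lam by (auto simp: G_def mult_left_mono)
    qed
    \<comment> \<open>Since \<open>G\<close> is increasing, both \<open>G y - G x\<close> and
      \<open>lam * \<integral>\<^sub>x\<^sup>y j * G\<close> lie between \<open>G x * d\<close> and
      \<open>G y * d\<close>. They differ by at most \<open>(G y - G x) * d\<close>, hence by at
      most \<open>d\<^sup>2\<close>, and \<open>d\<close> is at most linear in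
      \<open>y - x\<close>.\<close>
    have W_le: "lam * ?int (\<lambda>q. j q * G q) x y \<le> G y * d"
    proof -
      have "?int (\<lambda>q. j q * G q) x y \<le> (LINT q|lborel. G y * (if x \<le> q \<and> q \<le> y then j q else 0))"
        by (intro integral_mono integrable_mult_right integrable_if_bounded_interval[of _ K] jG jabs)
           (use Gmono j in \<open>auto simp: mult.commute[of "G y"] intro!: mult_left_mono\<close>)
      from mult_left_mono[OF this lam] show ?thesis by (simp add: d_def mult.left_commute)
    qed
    have W_ge: "G x * d \<le> lam * ?int (\<lambda>q. j q * G q) x y"
    proof -
      have "(LINT q|lborel. G x * (if x \<le> q \<and> q \<le> y then j q else 0)) \<le> ?int (\<lambda>q. j q * G q) x y"
        by (intro integral_mono integrable_mult_right integrable_if_bounded_interval[of _ K] jG jabs)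
           (use Gmono j in \<open>auto simp: mult.commute[of "G x"] intro!: mult_left_mono\<close>)
      from mult_left_mono[OF this lam] show ?thesis by (simp add: d_def mult.left_commute)
    qed
    have D_ge: "G x * d \<le> G y - G x"
      using mult_left_mono[OF exp_ge_add_one_self[of d], of "G x"] G_le(2)[of x] by (simp add: GG algebra_simps)
    have D_le: "G y - G x \<le> G y * d"
    proof -
      have "G x = G y * exp (- d)" by (simp add: GG exp_minus)
      then show ?thesis
        using mult_left_mono[OF exp_ge_add_one_self[of "-d"], of "G y"] G_le(2)[of y] by (simp add: algebra_simps)
    qed
    have "\<bar>H y - H x\<bar> = \<bar>(G y - G x) - lam * ?int (\<lambda>q. j q * G q) x y\<bar>"
      unfolding H_def W by (simp add: algebra_simps)
    also have "\<dots> \<le> G y * d - G x * d" using W_le W_ge D_le D_ge by linarith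
    also have "\<dots> = (G y - G x) * d" by (simp add: algebra_simps)
    also have "\<dots> \<le> (1 * d) * d"
      using D_le d(1) mult_right_mono[OF G_le(1)[of y] d(1)] by (intro mult_right_mono) auto
    also have "\<dots> \<le> (lam * (K * (y - x))) * (lam * (K * (y - x)))"
      using mult_mono[OF d(2) d(2)] d order_trans[OF d] by simp
    finally show "\<bar>H y - H x\<bar> \<le> (lam * K)\<^sup>2 * (y - x)\<^sup>2" by (simp add: power2_eq_square ac_simps)
  qed
  moreover have "H t = 1"
  proof -
    have z: "?int f t t = 0" for f
      by (rule integral_eq_zero_AE) (auto intro!: eventually_mono[OF AE_lborel_singleton[of t]])
    show ?thesis unfolding H_def G_def I_def by (simp only: z) simp
  qed
  ultimately have Hs: "G s + lam * ?int (\<lambda>q. j q * G q) s t = 1" by (simp add: H_def)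
  have "(\<integral>\<^sup>+r\<in>{s..t}. ennreal (j r * G r) \<partial>lborel) = (\<integral>\<^sup>+r. ennreal (if s \<le> r \<and> r \<le> t then j r * G r else 0) \<partial>lborel)"
    by (intro nn_integral_cong) (auto split: split_indicator)
  also have "\<dots> = ennreal (?int (\<lambda>q. j q * G q) s t)"
    by (rule nn_integral_eq_integral[OF integrable_if_bounded_interval[OF _ jG]]) (auto simp: j less_imp_le[OF G_le(2)])
  finally have eq: "(\<integral>\<^sup>+r\<in>{s..t}. ennreal (j r * G r) \<partial>lborel) = ennreal (?int (\<lambda>q. j q * G q) s t)" .
  have "0 \<le> ?int (\<lambda>q. j q * G q) s t"
    by (intro integral_nonneg_AE) (auto simp: j less_imp_le[OF G_le(2)])
  then have "ennreal (G s) + ennreal lam * (\<integral>\<^sup>+r\<in>{s..t}. ennreal (j r * G r) \<partial>lborel)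
     = ennreal (G s + lam * ?int (\<lambda>q. j q * G q) s t)"
    using lam G_le(2)[of s] unfolding eq by (subst ennreal_plus) (auto simp: ennreal_mult')
  also have "\<dots> = 1" by (simp only: Hs) simp
  finally show ?thesis by (simp only: G_def)
qed

text \<open>For positive \<epsilon> a probability density, shrinking to the point mass at 0 as
  \<epsilon> tends to 0.\<close>

definition window :: "real \<Rightarrow> real \<Rightarrow> real" where
  "window \<epsilon> x = indicator {- \<epsilon><..<\<epsilon>} x / (2 * \<epsilon>)"

text \<open>From time 0 it is the quotient whose limit defines the local time; the lower end
  \<open>s\<close> allows restarting the path at a later time.\<close>

definition occupation :: "real \<Rightarrow> (real \<Rightarrow> real) \<Rightarrow> real \<Rightarrow> real \<Rightarrow> real" where
  "occupation \<epsilon> f s t = (LINT q|lborel. (if s \<le> q \<and> q \<le> t then window \<epsilon> (f q) else 0))"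

lemma window_measurable [measurable]: "window \<epsilon> \<in> borel_measurable borel"
  unfolding window_def by measurable

lemma window_nonneg: "0 < \<epsilon> \<Longrightarrow> 0 \<le> window \<epsilon> x"
  by (simp add: window_def)

lemma window_le: "0 < \<epsilon> \<Longrightarrow> window \<epsilon> x \<le> 1 / (2 * \<epsilon>)"
  by (auto simp: window_def split: split_indicator)

lemma nn_integral_window: "0 < \<epsilon> \<Longrightarrow> (\<integral>\<^sup>+y. ennreal (window \<epsilon> y) \<partial>lborel) = 1"
proof -
  assume \<epsilon>: "0 < \<epsilon>"
  have "(\<integral>\<^sup>+y. ennreal (window \<epsilon> y) \<partial>lborel) = (\<integral>\<^sup>+y. ennreal (1 / (2 * \<epsilon>)) * indicator {- \<epsilon><..<\<epsilon>} y \<partial>lborel)"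
    by (intro nn_integral_cong) (auto simp: window_def split: split_indicator)
  also have "\<dots> = 1"
    using \<epsilon> by (simp add: nn_integral_cmult ennreal_mult'[symmetric])
  finally show ?thesis .
qed

lemma occupation_nonneg: "0 < \<epsilon> \<Longrightarrow> 0 \<le> occupation \<epsilon> f s t"
  unfolding occupation_def by (intro integral_nonneg_AE) (auto simp: window_nonneg)

lemma occupation_cong:
  assumes "\<And>q. s \<le> q \<Longrightarrow> q \<le> t \<Longrightarrow> f q = g q"
  shows "occupation \<epsilon> f s t = occupation \<epsilon> g s t"
  unfolding occupation_def by (intro Bochner_Integration.integral_cong) (auto simp: assms)

lemma occupation_measurable [measurable (raw)]:
  assumes [measurable]: "(\<lambda>p. f (fst p) (snd p)) \<in> borel_measurable (N \<Otimes>\<^sub>M borel)" "g \<in> borel_measurable N" "h \<in> borel_measurable N"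
  shows "(\<lambda>x. occupation \<epsilon> (f x) (g x) (h x)) \<in> borel_measurable N"
proof -
  have [measurable]: "(\<lambda>p. f (fst p) (snd p)) \<in> borel_measurable (N \<Otimes>\<^sub>M lborel)" by simp
  show ?thesis unfolding occupation_def by measurable
qed

lemma occupation_eq_measure:
  assumes \<epsilon>: "0 < \<epsilon>" and [measurable]: "f \<in> borel_measurable borel"
  shows "occupation \<epsilon> f s t = measure lborel {q \<in> {s..t}. \<bar>f q\<bar> < \<epsilon>} / (2 * \<epsilon>)"
proof -
  have "occupation \<epsilon> f s t = (LINT q|lborel. (1 / (2 * \<epsilon>)) * indicator {q \<in> {s..t}. \<bar>f q\<bar> < \<epsilon>} q)"
    unfolding occupation_def
    by (intro Bochner_Integration.integral_cong) (auto simp: window_def split: split_indicator)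
  also have "\<dots> = measure lborel {q \<in> {s..t}. \<bar>f q\<bar> < \<epsilon>} / (2 * \<epsilon>)"
    by (subst Bochner_Integration.integral_mult_right_zero) (simp add: Int_absorb1)
  finally show ?thesis .
qed

section \<open>The Duhamel equation of the regularised transform\<close>

context continuous_BM
begin

text \<open>The path is at \<open>x\<close> at time \<open>s\<close> and is observed up to time \<open>t\<close>.\<close>

definition reg_transform :: "real \<Rightarrow> real \<Rightarrow> (real \<Rightarrow> real) \<Rightarrow> real \<Rightarrow> real \<Rightarrow> real \<Rightarrow> ennreal" where
  "reg_transform \<epsilon> lam \<phi> t s x =
     (\<integral>\<^sup>+\<omega>. ennreal (\<phi> (x + B t \<omega> - B s \<omega>) * exp (- lam * occupation \<epsilon> (\<lambda>q. x + B q \<omega> - B s \<omega>) s t)) \<partial>M)"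

lemma reg_transform_measurable [measurable (raw)]:
  assumes [measurable]: "\<phi> \<in> borel_measurable borel" "f \<in> borel_measurable N" "g \<in> borel_measurable N"
  shows "(\<lambda>y. reg_transform \<epsilon> lam \<phi> t (f y) (g y)) \<in> borel_measurable N"
  unfolding reg_transform_def by measurable

lemma reg_transform_le_1:
  assumes "0 < \<epsilon>" "0 \<le> lam" "\<And>x. \<phi> x \<le> 1"
  shows "reg_transform \<epsilon> lam \<phi> t s x \<le> 1"
proof -
  have "reg_transform \<epsilon> lam \<phi> t s x \<le> (\<integral>\<^sup>+\<omega>. 1 \<partial>M)"
    unfolding reg_transform_def
  proof (intro nn_integral_mono)
    fix \<omega>
    let ?e = "exp (- lam * occupation \<epsilon> (\<lambda>q. x + B q \<omega> - B s \<omega>) s t)"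
    have "?e \<le> 1" using assms by (simp add: occupation_nonneg)
    moreover have "\<phi> (x + B t \<omega> - B s \<omega>) * ?e \<le> 1 * ?e"
      by (rule mult_right_mono[OF assms(3)]) simp
    ultimately have "\<phi> (x + B t \<omega> - B s \<omega>) * ?e \<le> 1" by linarith
    then show "ennreal (\<phi> (x + B t \<omega> - B s \<omega>) * ?e) \<le> 1" by simp
  qed
  then show ?thesis by (simp add: emeasure_space_1)
qed

text \<open>The position at time \<open>r\<close> enters through an arbitrary functional
  \<open>y\<close> of the past, because the path considered is \<open>x + B q - B s\<close> rather
  than \<open>B\<close> itself. Given the past, what follows \<open>r\<close> is a functional of the
  independent \<open>future r\<close>.\<close>

lemma Markov_reg_transform:
  assumes r: "0 \<le> r" "r \<le> t" and [measurable]: "\<phi> \<in> borel_measurable borel"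
    "a \<in> borel_measurable path_algebra" "y \<in> borel_measurable path_algebra"
  shows "(\<integral>\<^sup>+\<omega>. a (past r \<omega>) * ennreal (\<phi> (y (past r \<omega>) + B t \<omega> - B r \<omega>) *
      exp (- lam * occupation \<epsilon> (\<lambda>q. y (past r \<omega>) + B q \<omega> - B r \<omega>) r t)) \<partial>M) =
    (\<integral>\<^sup>+\<omega>. a (past r \<omega>) * reg_transform \<epsilon> lam \<phi> t r (y (past r \<omega>)) \<partial>M)"
proof -
  let ?\<Psi> = "\<lambda>z w. ennreal (\<phi> (z + path_eval w (t - r)) * exp (- lam * occupation \<epsilon> (\<lambda>q. z + path_eval w (q - r)) r t))"
  have fut: "?\<Psi> z (future r \<omega>) = ennreal (\<phi> (z + B t \<omega> - B r \<omega>) * exp (- lam * occupation \<epsilon> (\<lambda>q. z + B q \<omega> - B r \<omega>) r t))" for z \<omega>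
  proof -
    have "occupation \<epsilon> (\<lambda>q. z + path_eval (future r \<omega>) (q - r)) r t = occupation \<epsilon> (\<lambda>q. z + B q \<omega> - B r \<omega>) r t"
      by (rule occupation_cong) (simp add: path_eval_future add_diff_eq)
    then show ?thesis using r by (simp add: path_eval_future add_diff_eq)
  qed
  have [measurable]: "(\<lambda>p. ?\<Psi> (y (fst p)) (snd p)) \<in> borel_measurable (path_algebra \<Otimes>\<^sub>M path_algebra)"
    by measurable
  have "(\<integral>\<^sup>+\<omega>. a (past r \<omega>) * ?\<Psi> (y (past r \<omega>)) (future r \<omega>) \<partial>M)
     = (\<integral>\<^sup>+\<omega>. (\<integral>\<^sup>+w. a (past r \<omega>) * ?\<Psi> (y (past r \<omega>)) w \<partial>distr M path_algebra (future r)) \<partial>M)"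
    using nn_integral_independent_rvs[OF independent_past_future[OF r(1)], of "\<lambda>p. a (fst p) * ?\<Psi> (y (fst p)) (snd p)"]
    by simp
  also have "\<dots> = (\<integral>\<^sup>+\<omega>. a (past r \<omega>) * reg_transform \<epsilon> lam \<phi> t r (y (past r \<omega>)) \<partial>M)"
    unfolding reg_transform_def fut[symmetric]
    by (intro nn_integral_cong) (simp add: nn_integral_distr nn_integral_cmult)
  finally show ?thesis by (simp only: fut)
qed

lemma nn_integral_increment:
  assumes "0 \<le> s" "s < t" and [measurable]: "f \<in> borel_measurable borel"
  shows "(\<integral>\<^sup>+\<omega>. f (x + B t \<omega> - B s \<omega>) \<partial>M) = (\<integral>\<^sup>+y. ennreal (heat (t - s) (y - x)) * f y \<partial>lborel)"
proof -
  have "(\<integral>\<^sup>+\<omega>. f (x + B t \<omega> - B s \<omega>) \<partial>M) = (\<integral>\<^sup>+y. ennreal (heat (t - s) y) * f (x + y) \<partial>lborel)"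
    using distributed_nn_integral[OF B_increment[OF assms(1,2)], of "\<lambda>y. f (x + y)"] assms(2)
    by (simp add: normal_density_eq_heat add_diff_eq)
  also have "\<dots> = (\<integral>\<^sup>+y. ennreal (heat (t - s) (y - x)) * f y \<partial>lborel)"
    by (subst (2) nn_integral_real_affine[of _ 1 x]) auto
  finally show ?thesis .
qed

text \<open>Along each path \<open>exp_Duhamel\<close> is applied to the bounded rate
  \<open>window \<epsilon>\<close>, multiplied by \<open>\<phi>\<close> at time \<open>t\<close> and
  averaged. The exponential under the integral covers only \<open>[r, t]\<close>, so the Markov
  property at \<open>r\<close> turns it into the transform restarted at \<open>r\<close>.\<close>

lemma reg_transform_Duhamel:
  assumes \<epsilon>: "0 < \<epsilon>" and lam: "0 \<le> lam" and st: "0 \<le> s" "s < t"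
    and [measurable]: "\<phi> \<in> borel_measurable borel" and \<phi>: "\<And>x. 0 \<le> \<phi> x"
  shows "reg_transform \<epsilon> lam \<phi> t s x + ennreal lam *
      (\<integral>\<^sup>+r\<in>{s<..<t}. (\<integral>\<^sup>+y. ennreal (heat (r - s) (y - x) * window \<epsilon> y) * reg_transform \<epsilon> lam \<phi> t r y \<partial>lborel) \<partial>lborel)
    = (\<integral>\<^sup>+y. ennreal (\<phi> y * heat (t - s) (y - x)) \<partial>lborel)"
proof -
  let ?Y = "\<lambda>\<omega> q. x + B q \<omega> - B s \<omega>"
  let ?G = "\<lambda>\<omega> r. exp (- lam * occupation \<epsilon> (?Y \<omega>) r t)"
  have path: "ennreal (\<phi> (?Y \<omega> t)) = ennreal (\<phi> (?Y \<omega> t) * ?G \<omega> s) +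
      ennreal lam * (\<integral>\<^sup>+r. ennreal (window \<epsilon> (?Y \<omega> r)) * ennreal (\<phi> (?Y \<omega> t) * ?G \<omega> r) * indicator {s<..<t} r \<partial>lborel)" for \<omega>
  proof -
    have [measurable]: "?Y \<omega> \<in> borel_measurable borel"
      by (intro borel_measurable_diff borel_measurable_add borel_measurable_const B_path_measurable)
    have "(\<lambda>q. window \<epsilon> (?Y \<omega> q)) \<in> borel_measurable borel" by measurable
    note D = exp_Duhamel[OF this window_nonneg[OF \<epsilon>] window_le[OF \<epsilon>] lam less_imp_le[OF st(2)], folded occupation_def]
    have [measurable]: "?G \<omega> \<in> borel_measurable borel" unfolding occupation_def by measurable
    have "ennreal (\<phi> (?Y \<omega> t)) = ennreal (\<phi> (?Y \<omega> t)) * (ennreal (?G \<omega> s) + ennreal lam * (\<integral>\<^sup>+r\<in>{s..t}. ennreal (window \<epsilon> (?Y \<omega> r) * ?G \<omega> r) \<partial>lborel))"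
      by (simp only: D mult_1_right)
    \<comment> \<open>The end points form a null set; at \<open>r = s\<close> the increment
      \<open>B r - B s\<close> has no density.\<close>
    also have "(\<integral>\<^sup>+r\<in>{s..t}. ennreal (window \<epsilon> (?Y \<omega> r) * ?G \<omega> r) \<partial>lborel) = (\<integral>\<^sup>+r\<in>{s<..<t}. ennreal (window \<epsilon> (?Y \<omega> r) * ?G \<omega> r) \<partial>lborel)"
      by (intro nn_integral_cong_AE eventually_mono[OF eventually_conj[OF AE_lborel_singleton[of s] AE_lborel_singleton[of t]]])
         (auto split: split_indicator)
    also have "ennreal (\<phi> (?Y \<omega> t)) * (ennreal (?G \<omega> s) + ennreal lam * \<dots>) =
       ennreal (\<phi> (?Y \<omega> t) * ?G \<omega> s) + ennreal lam * (ennreal (\<phi> (?Y \<omega> t)) * (\<integral>\<^sup>+r\<in>{s<..<t}. ennreal (window \<epsilon> (?Y \<omega> r) * ?G \<omega> r) \<partial>lborel))"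
      using \<phi> by (simp add: distrib_left ennreal_mult' mult.left_commute)
    also have "ennreal (\<phi> (?Y \<omega> t)) * (\<integral>\<^sup>+r\<in>{s<..<t}. ennreal (window \<epsilon> (?Y \<omega> r) * ?G \<omega> r) \<partial>lborel)
       = (\<integral>\<^sup>+r. ennreal (window \<epsilon> (?Y \<omega> r)) * ennreal (\<phi> (?Y \<omega> t) * ?G \<omega> r) * indicator {s<..<t} r \<partial>lborel)"
      using \<phi> window_nonneg[OF \<epsilon>]
      by (subst nn_integral_cmult[symmetric]) (auto simp: ennreal_mult' ac_simps)
    finally show ?thesis .
  qed
  have "(\<integral>\<^sup>+y. ennreal (\<phi> y * heat (t - s) (y - x)) \<partial>lborel) = (\<integral>\<^sup>+\<omega>. ennreal (\<phi> (?Y \<omega> t)) \<partial>M)"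
    using nn_integral_increment[OF st, of "\<lambda>y. ennreal (\<phi> y)" x] \<phi> by (simp add: ennreal_mult' mult.commute)
  also have "\<dots> = reg_transform \<epsilon> lam \<phi> t s x + ennreal lam * (\<integral>\<^sup>+\<omega>. (\<integral>\<^sup>+r.
      ennreal (window \<epsilon> (?Y \<omega> r)) * ennreal (\<phi> (?Y \<omega> t) * ?G \<omega> r) * indicator {s<..<t} r \<partial>lborel) \<partial>M)"
    unfolding reg_transform_def by (subst path) (simp add: nn_integral_add nn_integral_cmult)
  also have "(\<integral>\<^sup>+\<omega>. (\<integral>\<^sup>+r. ennreal (window \<epsilon> (?Y \<omega> r)) * ennreal (\<phi> (?Y \<omega> t) * ?G \<omega> r) * indicator {s<..<t} r \<partial>lborel) \<partial>M)
     = (\<integral>\<^sup>+r. (\<integral>\<^sup>+\<omega>. ennreal (window \<epsilon> (?Y \<omega> r)) * ennreal (\<phi> (?Y \<omega> t) * ?G \<omega> r) * indicator {s<..<t} r \<partial>M) \<partial>lborel)"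
  proof -
    interpret pair_sigma_finite lborel M by unfold_locales
    show ?thesis by (rule Fubini') measurable
  qed
  also have "\<dots> = (\<integral>\<^sup>+r\<in>{s<..<t}. (\<integral>\<^sup>+y. ennreal (heat (r - s) (y - x) * window \<epsilon> y) * reg_transform \<epsilon> lam \<phi> t r y \<partial>lborel) \<partial>lborel)"
  proof (rule nn_integral_cong)
    fix r :: real
    show "(\<integral>\<^sup>+\<omega>. ennreal (window \<epsilon> (?Y \<omega> r)) * ennreal (\<phi> (?Y \<omega> t) * ?G \<omega> r) * indicator {s<..<t} r \<partial>M)
       = (\<integral>\<^sup>+y. ennreal (heat (r - s) (y - x) * window \<epsilon> y) * reg_transform \<epsilon> lam \<phi> t r y \<partial>lborel) * indicator {s<..<t} r"
    proof (cases "r \<in> {s<..<t}")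
      case True
      \<comment> \<open>The position at \<open>r\<close> as a functional of the path frozen at
        \<open>r\<close>; the time \<open>s\<close> lies before \<open>r\<close> and is seen by it
        as well.\<close>
      let ?y = "\<lambda>w. x + path_eval w r - path_eval w s"
      have y: "?y (past r \<omega>) = ?Y \<omega> r" for \<omega>
        using True st by (simp add: path_eval_past)
      have "(\<integral>\<^sup>+\<omega>. ennreal (window \<epsilon> (?Y \<omega> r)) * ennreal (\<phi> (?Y \<omega> t) * ?G \<omega> r) \<partial>M)
         = (\<integral>\<^sup>+\<omega>. ennreal (window \<epsilon> (?y (past r \<omega>))) * ennreal (\<phi> (?y (past r \<omega>) + B t \<omega> - B r \<omega>) *
      exp (- lam * occupation \<epsilon> (\<lambda>q. ?y (past r \<omega>) + B q \<omega> - B r \<omega>) r t)) \<partial>M)"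
        by (simp only: y) (simp add: algebra_simps)
      also have "\<dots> = (\<integral>\<^sup>+\<omega>. ennreal (window \<epsilon> (?y (past r \<omega>))) * reg_transform \<epsilon> lam \<phi> t r (?y (past r \<omega>)) \<partial>M)"
        by (rule Markov_reg_transform) (use True st in auto)
      also have "\<dots> = (\<integral>\<^sup>+\<omega>. ennreal (window \<epsilon> (?Y \<omega> r)) * reg_transform \<epsilon> lam \<phi> t r (?Y \<omega> r) \<partial>M)"
        by (simp only: y)
      also have "\<dots> = (\<integral>\<^sup>+y. ennreal (heat (r - s) (y - x)) * (ennreal (window \<epsilon> y) * reg_transform \<epsilon> lam \<phi> t r y) \<partial>lborel)"
        by (rule nn_integral_increment) (use True st in auto)
      also have "\<dots> = (\<integral>\<^sup>+y. ennreal (heat (r - s) (y - x) * window \<epsilon> y) * reg_transform \<epsilon> lam \<phi> t r y \<partial>lborel)"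
        using True by (intro nn_integral_cong) (simp add: ennreal_mult' mult.assoc)
      finally show ?thesis using True by simp
    qed simp
  qed
  finally show ?thesis by (rule sym)
qed

end

section \<open>Convergence of the regularised transforms\<close>

lemma set_nn_integral_mono_on:
  assumes "\<And>x. x \<in> A \<Longrightarrow> f x \<le> g x"
  shows "(\<integral>\<^sup>+x\<in>A. f x \<partial>M) \<le> (\<integral>\<^sup>+x\<in>A. g x \<partial>M)"
  using assms by (intro nn_integral_mono) (auto split: split_indicator)

lemma nn_integral_Ioo_shift:
  fixes f :: "real \<Rightarrow> ennreal"
  assumes [measurable]: "f \<in> borel_measurable borel"
  shows "(\<integral>\<^sup>+r\<in>{s<..<t}. f (r - s) \<partial>lborel) = (\<integral>\<^sup>+q\<in>{0<..<t - s}. f q \<partial>lborel)"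
proof -
  have "(\<integral>\<^sup>+r\<in>{s<..<t}. f (r - s) \<partial>lborel) = (\<integral>\<^sup>+q. f q * indicator {s<..<t} (s + q) \<partial>lborel)"
    by (subst nn_integral_real_affine[of _ 1 s]) auto
  also have "\<dots> = (\<integral>\<^sup>+q\<in>{0<..<t - s}. f q \<partial>lborel)"
    by (intro nn_integral_cong) (auto split: split_indicator)
  finally show ?thesis .
qed

lemma heat_convolution_joint_transform_shift:
  assumes [measurable]: "\<phi> \<in> borel_measurable borel"
  shows "(\<integral>\<^sup>+r\<in>{s<..<t}. ennreal (heat (r - s) z) * joint_transform \<phi> lam (t - r) \<partial>lborel) =
    (\<integral>\<^sup>+q\<in>{0<..<t - s}. ennreal (heat q z) * joint_transform \<phi> lam (t - s - q) \<partial>lborel)"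
  using nn_integral_Ioo_shift[of "\<lambda>q. ennreal (heat q z) * joint_transform \<phi> lam (t - s - q)" s t]
  by simp

lemma abs_diff_le_if_ennreal:
  assumes "a \<le> b + ennreal e" "b \<le> a + ennreal e" "a \<le> 1" "b \<le> 1" "0 \<le> e"
  shows "\<bar>enn2real a - enn2real b\<bar> \<le> e"
proof -
  obtain a' b' where ab: "a = ennreal a'" "0 \<le> a'" "b = ennreal b'" "0 \<le> b'"
    using assms(3,4) by (metis ennreal_cases ennreal_one_less_top not_le)
  then show ?thesis
    using assms(1,2,5) by (auto simp: ennreal_plus[symmetric] simp del: ennreal_plus)
qed

lemma ennreal_le_if_abs_diff_le:
  assumes "\<bar>enn2real a - enn2real b\<bar> \<le> e" "a \<le> 1" "b \<le> 1"
  shows "a \<le> b + ennreal e"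
proof -
  obtain a' b' where ab: "a = ennreal a'" "0 \<le> a'" "b = ennreal b'" "0 \<le> b'"
    using assms(2,3) by (metis ennreal_cases ennreal_one_less_top not_le)
  moreover have "0 \<le> e" using assms(1) by linarith
  ultimately show ?thesis
    using assms(1) by (auto simp: ennreal_plus[symmetric] simp del: ennreal_plus)
qed

text \<open>Moving the starting point shifts the argument of \<open>\<phi>\<close>, which costs at
  most \<open>C * \<bar>x - z\<bar>\<close>. This is how Lipschitz continuity of
  \<open>\<phi>\<close> enters the comparison.\<close>

lemma nn_integral_Lipschitz_heat:
  assumes [measurable]: "\<phi> \<in> borel_measurable borel" and \<phi>: "\<And>x. 0 \<le> \<phi> x"
    and C: "0 \<le> C" and Lip: "\<And>x y. \<bar>\<phi> x - \<phi> y\<bar> \<le> C * \<bar>x - y\<bar>" and t: "0 < t"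
  shows "(\<integral>\<^sup>+y. ennreal (\<phi> y * heat t (y - x)) \<partial>lborel) \<le> (\<integral>\<^sup>+y. ennreal (\<phi> y * heat t (y - z)) \<partial>lborel) + ennreal (C * \<bar>x - z\<bar>)"
proof -
  have shift: "(\<integral>\<^sup>+y. ennreal (\<phi> y * heat t (y - a)) \<partial>lborel) = (\<integral>\<^sup>+y. ennreal (\<phi> (a + y) * heat t y) \<partial>lborel)" for a
    by (subst nn_integral_real_affine[of _ 1 a]) auto
  have "(\<integral>\<^sup>+y. ennreal (\<phi> (x + y) * heat t y) \<partial>lborel) \<le> (\<integral>\<^sup>+y. ennreal (\<phi> (z + y) * heat t y) + ennreal (C * \<bar>x - z\<bar>) * ennreal (heat t y) \<partial>lborel)"
  proof (rule nn_integral_mono)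
    fix y
    have "\<phi> (x + y) \<le> \<phi> (z + y) + C * \<bar>x - z\<bar>" using Lip[of "x + y" "z + y"] by simp
    then have "\<phi> (x + y) * heat t y \<le> (\<phi> (z + y) + C * \<bar>x - z\<bar>) * heat t y"
      using t by (intro mult_right_mono) auto
    then show "ennreal (\<phi> (x + y) * heat t y) \<le> ennreal (\<phi> (z + y) * heat t y) + ennreal (C * \<bar>x - z\<bar>) * ennreal (heat t y)"
      using t \<phi> C by (simp add: ennreal_mult'[symmetric] ennreal_plus[symmetric] distrib_right del: ennreal_plus)
  qed
  also have "\<dots> = (\<integral>\<^sup>+y. ennreal (\<phi> (z + y) * heat t y) \<partial>lborel) + ennreal (C * \<bar>x - z\<bar>)"
    using nn_integral_heat[OF t] by (simp add: nn_integral_add nn_integral_cmult)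
  finally show ?thesis by (simp only: shift)
qed

text \<open>The weight splits as
  \<open>exp (\<kappa> * (t - s)) * exp (- \<kappa> * (r - s))\<close>, and the second factor is
  integrated by the Laplace transform of the heat kernel. The Volterra operator therefore gains
  \<open>1 / sqrt (2 * \<kappa>)\<close> in the weighted norm.\<close>

lemma nn_integral_heat_exp_weight:
  assumes st: "s < t" and D: "0 \<le> D" and \<kappa>: "0 < \<kappa>"
  shows "(\<integral>\<^sup>+r\<in>{s<..<t}. ennreal (heat (r - s) 0) * ennreal (exp (\<kappa> * (t - r)) * D) \<partial>lborel)
    \<le> ennreal (exp (\<kappa> * (t - s)) * D / sqrt (2 * \<kappa>))"
proof -
  have "(\<integral>\<^sup>+r\<in>{s<..<t}. ennreal (heat (r - s) 0) * ennreal (exp (\<kappa> * (t - r)) * D) \<partial>lborel)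
     = (\<integral>\<^sup>+r. ennreal (exp (\<kappa> * (t - s)) * D) * (ennreal (heat (r - s) 0 * exp (- \<kappa> * (r - s))) * indicator {s<..<t} r) \<partial>lborel)"
  proof (rule nn_integral_cong)
    fix r
    have "exp (\<kappa> * (t - r)) = exp (\<kappa> * (t - s)) * exp (- \<kappa> * (r - s))"
      by (simp add: exp_add[symmetric] algebra_simps)
    then show "ennreal (heat (r - s) 0) * ennreal (exp (\<kappa> * (t - r)) * D) * indicator {s<..<t} r
      = ennreal (exp (\<kappa> * (t - s)) * D) * (ennreal (heat (r - s) 0 * exp (- \<kappa> * (r - s))) * indicator {s<..<t} r)"
      using D by (auto simp: ennreal_mult'[symmetric] ac_simps split: split_indicator)
  qed
  also have "\<dots> = ennreal (exp (\<kappa> * (t - s)) * D) * (\<integral>\<^sup>+q\<in>{0<..<t - s}. ennreal (heat q 0 * exp (- \<kappa> * q)) \<partial>lborel)"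
    using nn_integral_Ioo_shift[of "\<lambda>q. ennreal (heat q 0 * exp (- \<kappa> * q))" s t] by (simp add: nn_integral_cmult)
  also have "\<dots> \<le> ennreal (exp (\<kappa> * (t - s)) * D) * (\<integral>\<^sup>+q\<in>{0<..}. ennreal (heat q 0 * exp (- \<kappa> * q)) \<partial>lborel)"
    by (intro mult_left_mono nn_integral_mono) (auto split: split_indicator)
  also have "\<dots> = ennreal (exp (\<kappa> * (t - s)) * D / sqrt (2 * \<kappa>))"
    unfolding nn_integral_heat_exp[OF \<kappa>] using D \<kappa> by (simp add: ennreal_mult'[symmetric])
  finally show ?thesis .
qed

section \<open>Stability of the Volterra equation under the regularisation\<close>

context continuous_BM
begin

context
  fixes \<epsilon> lam t C :: real and \<phi> :: "real \<Rightarrow> real"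
  assumes \<epsilon>: "0 < \<epsilon>" and lam: "0 \<le> lam"
    and \<phi>_measurable [measurable]: "\<phi> \<in> borel_measurable borel"
    and \<phi>: "\<And>x. 0 \<le> \<phi> x" "\<And>x. \<phi> x \<le> 1"
    and C: "0 \<le> C" and Lip: "\<And>x y. \<bar>\<phi> x - \<phi> y\<bar> \<le> C * \<bar>x - y\<bar>"
begin

private abbreviation (input) "u \<equiv> reg_transform \<epsilon> lam \<phi> t"
private abbreviation (input) "v \<equiv> \<lambda>r. joint_transform \<phi> lam (t - r)"

text \<open>If \<open>u r y\<close> and \<open>v r\<close> differ by at most \<open>\<eta> r\<close> for small \<open>y\<close>, then the Duhamel equation for \<open>u\<close> is a perturbation
  of the Volterra equation for \<open>c\<close>.\<close>

lemma reg_transform_compare: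
  assumes st: "0 \<le> s" "s < t" and xz: "\<bar>x - z\<bar> \<le> \<epsilon>" and [measurable]: "\<eta> \<in> borel_measurable borel"
    and close: "\<And>r y. s < r \<Longrightarrow> r < t \<Longrightarrow> \<bar>y\<bar> \<le> \<epsilon> \<Longrightarrow> u r y \<le> v r + \<eta> r"
      "\<And>r y. s < r \<Longrightarrow> r < t \<Longrightarrow> \<bar>y\<bar> \<le> \<epsilon> \<Longrightarrow> v r \<le> u r y + \<eta> r"
    and c: "c + ennreal lam * (\<integral>\<^sup>+r\<in>{s<..<t}. ennreal (heat (r - s) z) * v r \<partial>lborel) =
      (\<integral>\<^sup>+y. ennreal (\<phi> y * heat (t - s) (y - z)) \<partial>lborel)"
  defines "err \<equiv> ennreal (C * \<epsilon>) + ennreal lam * ((\<integral>\<^sup>+r\<in>{s<..<t}. ennreal (heat (r - s) 0) * \<eta> r \<partial>lborel) +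
      ennreal (sqrt (2 * \<epsilon>) * (4 * (t - s) powr (1 / 4))))"
  shows "u s x \<le> c + err" "c \<le> u s x + err"
proof -
  let ?W = "\<lambda>y. ennreal (window \<epsilon> y)"
  let ?\<delta> = "\<lambda>r. ennreal (sqrt (2 * \<epsilon>)) * ennreal ((r - s) powr (- 3 / 4))"
  \<comment> \<open>Pointwise error: the term with \<open>\<eta>\<close> for replacing
    \<open>u\<close> by \<open>v\<close>, and \<open>?\<delta>\<close> for moving the argument of
    the heat kernel from \<open>y - x\<close> to \<open>z\<close>.\<close>
  let ?R = "\<lambda>r. ennreal (heat (r - s) 0) * \<eta> r + ?\<delta> r"
  let ?A = "\<lambda>r y. ?W y * (ennreal (heat (r - s) (y - x)) * u r y)"
  let ?V = "\<lambda>r y. ?W y * (ennreal (heat (r - s) z) * v r)"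
  define Iu where "Iu = (\<integral>\<^sup>+r\<in>{s<..<t}. (\<integral>\<^sup>+y. ?A r y \<partial>lborel) \<partial>lborel)"
  define Iv where "Iv = (\<integral>\<^sup>+r\<in>{s<..<t}. ennreal (heat (r - s) z) * v r \<partial>lborel)"
  define ER where "ER = (\<integral>\<^sup>+r\<in>{s<..<t}. ?R r \<partial>lborel)"
  define P where "P a = (\<integral>\<^sup>+y. ennreal (\<phi> y * heat (t - s) (y - a)) \<partial>lborel)" for a
  have ts: "0 < t - s" using st by simp
  have Wint: "(\<integral>\<^sup>+y. ?W y * k \<partial>lborel) = k" for k
    by (simp add: nn_integral_multc nn_integral_window[OF \<epsilon>])
  have Iv: "Iv = (\<integral>\<^sup>+r\<in>{s<..<t}. (\<integral>\<^sup>+y. ?V r y \<partial>lborel) \<partial>lborel)"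
    by (simp add: Iv_def Wint)
  have ER: "ER = (\<integral>\<^sup>+r\<in>{s<..<t}. (\<integral>\<^sup>+y. ?W y * ?R r \<partial>lborel) \<partial>lborel)"
    by (simp add: ER_def Wint)
  have pw: "?W y * a \<le> ?W y * b" if "\<bar>y\<bar> < \<epsilon> \<Longrightarrow> a \<le> b" for a b y
    using that by (cases "\<bar>y\<bar> < \<epsilon>") (auto simp: window_def indicator_def intro!: mult_left_mono)
  have heat_close: "ennreal (heat (r - s) (y - x)) \<le> ennreal (heat (r - s) z) + ?\<delta> r"
      "ennreal (heat (r - s) z) \<le> ennreal (heat (r - s) (y - x)) + ?\<delta> r" if r: "s < r" and y: "\<bar>y\<bar> < \<epsilon>" for r y
  proof -
    \<comment> \<open>The kernel is even, which permits comparison at \<open>- z\<close>: the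
      distance \<open>\<bar>y - (x - z)\<bar>\<close> is at most \<open>2 * \<epsilon>\<close>,
      whereas \<open>y - x\<close> and \<open>z\<close> themselves may be far apart.\<close>
    have "\<bar>heat (r - s) (y - x) - heat (r - s) (- z)\<bar> \<le> sqrt \<bar>(y - x) - (- z)\<bar> * (r - s) powr (- 3 / 4)"
      using r by (intro abs_heat_diff_le) simp
    also have "\<dots> \<le> sqrt (2 * \<epsilon>) * (r - s) powr (- 3 / 4)"
      using xz y by (intro mult_right_mono real_sqrt_le_mono) auto
    finally have "\<bar>heat (r - s) (y - x) - heat (r - s) z\<bar> \<le> sqrt (2 * \<epsilon>) * (r - s) powr (- 3 / 4)"
      by simp
    then have "heat (r - s) (y - x) \<le> heat (r - s) z + sqrt (2 * \<epsilon>) * (r - s) powr (- 3 / 4)"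
      "heat (r - s) z \<le> heat (r - s) (y - x) + sqrt (2 * \<epsilon>) * (r - s) powr (- 3 / 4)" by linarith+
    then show "ennreal (heat (r - s) (y - x)) \<le> ennreal (heat (r - s) z) + ?\<delta> r"
      "ennreal (heat (r - s) z) \<le> ennreal (heat (r - s) (y - x)) + ?\<delta> r"
      using r \<epsilon> by (simp_all add: ennreal_mult'[symmetric] ennreal_plus[symmetric] del: ennreal_plus)
  qed
  have h0: "ennreal (heat (r - s) (y - x)) \<le> ennreal (heat (r - s) 0)" if "s < r" for r y
    using that by (intro ennreal_leI heat_le) simp
  have v1: "v r \<le> 1" if "r < t" for r
    using that by (intro joint_transform_le_1 \<phi> lam) auto
  have AV: "?A r y \<le> ?V r y + ?W y * ?R r" if r: "s < r" "r < t" for r y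
    unfolding distrib_left[symmetric]
  proof (rule pw)
    assume y: "\<bar>y\<bar> < \<epsilon>"
    have "ennreal (heat (r - s) (y - x)) * u r y \<le> ennreal (heat (r - s) (y - x)) * (v r + \<eta> r)"
      using close(1)[OF r, of y] y by (intro mult_left_mono) auto
    also have "\<dots> \<le> (ennreal (heat (r - s) z) + ?\<delta> r) * v r + ennreal (heat (r - s) 0) * \<eta> r"
      unfolding distrib_left using heat_close(1)[OF r(1) y] h0[OF r(1)] by (intro add_mono mult_right_mono) auto
    also have "\<dots> \<le> ennreal (heat (r - s) z) * v r + ?\<delta> r * 1 + ennreal (heat (r - s) 0) * \<eta> r"
      unfolding distrib_right using v1[OF r(2)] by (intro add_mono mult_left_mono) auto
    finally show "ennreal (heat (r - s) (y - x)) * u r y \<le> ennreal (heat (r - s) z) * v r + ?R r"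
      by (simp add: ac_simps)
  qed
  have VA: "?V r y \<le> ?A r y + ?W y * ?R r" if r: "s < r" "r < t" for r y
    unfolding distrib_left[symmetric]
  proof (rule pw)
    assume y: "\<bar>y\<bar> < \<epsilon>"
    have "ennreal (heat (r - s) z) * v r \<le> (ennreal (heat (r - s) (y - x)) + ?\<delta> r) * v r"
      using heat_close(2)[OF r(1) y] by (intro mult_right_mono) auto
    also have "\<dots> \<le> ennreal (heat (r - s) (y - x)) * (u r y + \<eta> r) + ?\<delta> r * 1"
      unfolding distrib_right using v1[OF r(2)] close(2)[OF r, of y] y by (intro add_mono mult_left_mono) auto
    also have "\<dots> \<le> ennreal (heat (r - s) (y - x)) * u r y + ennreal (heat (r - s) 0) * \<eta> r + ?\<delta> r * 1"
      unfolding distrib_left using h0[OF r(1)] by (intro add_mono mult_right_mono) auto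
    finally show "ennreal (heat (r - s) z) * v r \<le> ennreal (heat (r - s) (y - x)) * u r y + ?R r"
      by (simp add: ac_simps)
  qed
  have IuIv: "Iu \<le> Iv + ER"
  proof -
    have "Iu \<le> (\<integral>\<^sup>+r\<in>{s<..<t}. (\<integral>\<^sup>+y. ?V r y + ?W y * ?R r \<partial>lborel) \<partial>lborel)"
      unfolding Iu_def by (rule set_nn_integral_mono_on, rule nn_integral_mono, rule AV) auto
    then show ?thesis by (simp add: Iv ER nn_integral_add distrib_right)
  qed
  have IvIu: "Iv \<le> Iu + ER"
  proof -
    have "Iv \<le> (\<integral>\<^sup>+r\<in>{s<..<t}. (\<integral>\<^sup>+y. ?A r y + ?W y * ?R r \<partial>lborel) \<partial>lborel)"
      unfolding Iv by (rule set_nn_integral_mono_on, rule nn_integral_mono, rule VA) auto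
    then show ?thesis by (simp add: Iu_def ER nn_integral_add distrib_right)
  qed
  have ER_le: "ER \<le> (\<integral>\<^sup>+r\<in>{s<..<t}. ennreal (heat (r - s) 0) * \<eta> r \<partial>lborel) + ennreal (sqrt (2 * \<epsilon>) * (4 * (t - s) powr (1 / 4)))"
  proof -
    have "(\<integral>\<^sup>+r\<in>{s<..<t}. ?\<delta> r \<partial>lborel) = ennreal (sqrt (2 * \<epsilon>)) * (\<integral>\<^sup>+r\<in>{s<..<t}. ennreal ((r - s) powr (- 3 / 4)) \<partial>lborel)"
      by (simp add: nn_integral_cmult mult.assoc)
    also have "(\<integral>\<^sup>+r\<in>{s<..<t}. ennreal ((r - s) powr (- 3 / 4)) \<partial>lborel) = (\<integral>\<^sup>+q\<in>{0<..<t - s}. ennreal (q powr (- 3 / 4)) \<partial>lborel)"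
      by (rule nn_integral_Ioo_shift) measurable
    also have "\<dots> \<le> ennreal (4 * (t - s) powr (1 / 4))"
      using ts by (intro nn_integral_powr_Ioo) simp
    finally have "(\<integral>\<^sup>+r\<in>{s<..<t}. ?\<delta> r \<partial>lborel) \<le> ennreal (sqrt (2 * \<epsilon>) * (4 * (t - s) powr (1 / 4)))"
      using \<epsilon> by (simp add: ennreal_mult' mult_left_mono)
    then show ?thesis
      unfolding ER_def by (simp add: nn_integral_add distrib_right add_left_mono)
  qed
  have err: "ennreal (C * \<epsilon>) + ennreal lam * ER \<le> err"
    unfolding err_def using ER_le by (intro add_left_mono mult_left_mono) auto
  have Du: "u s x + ennreal lam * Iu = P x"
    using reg_transform_Duhamel[OF \<epsilon> lam st \<phi>_measurable \<phi>(1), of x]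
    unfolding P_def Iu_def using st
    by (simp add: ennreal_mult'' window_nonneg[OF \<epsilon>] mult.assoc mult.left_commute
         ennreal_mult' cong: nn_integral_cong)
  have Dv: "c + ennreal lam * Iv = P z" using c by (simp add: P_def Iv_def)
  have Pxz: "P x \<le> P z + ennreal (C * \<epsilon>)" "P z \<le> P x + ennreal (C * \<epsilon>)"
  proof -
    have "ennreal (C * \<bar>x - z\<bar>) \<le> ennreal (C * \<epsilon>)" "ennreal (C * \<bar>z - x\<bar>) \<le> ennreal (C * \<epsilon>)"
      using C xz by (auto intro!: ennreal_leI mult_left_mono simp: abs_minus_commute)
    then show "P x \<le> P z + ennreal (C * \<epsilon>)" "P z \<le> P x + ennreal (C * \<epsilon>)"
      unfolding P_def using nn_integral_Lipschitz_heat[OF \<phi>_measurable \<phi>(1) C Lip ts]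
      by (meson add_left_mono order_trans)+
  qed
  have P1: "P a \<le> 1" for a unfolding P_def by (rule nn_integral_mult_heat_le_1[OF _ \<phi> ts]) simp
  \<comment> \<open>Cancelling the integral terms in the extended nonnegative reals requires them to
    be finite.\<close>
  have fin: "ennreal lam * Iu \<noteq> \<top>" "ennreal lam * Iv \<noteq> \<top>"
    using P1[of x] P1[of z] Du Dv by (auto simp: top_unique)
  have "ennreal lam * Iu + u s x \<le> ennreal lam * Iu + (c + err)"
  proof -
    have "ennreal lam * Iu + u s x \<le> (c + ennreal lam * Iv) + ennreal (C * \<epsilon>)"
      using Du Dv Pxz(1) by (simp add: add.commute)
    also have "\<dots> \<le> (c + ennreal lam * (Iu + ER)) + ennreal (C * \<epsilon>)"
      using IvIu by (intro add_right_mono add_left_mono mult_left_mono) auto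
    also have "\<dots> = ennreal lam * Iu + (c + (ennreal (C * \<epsilon>) + ennreal lam * ER))"
      by (simp add: distrib_left ac_simps)
    also have "\<dots> \<le> ennreal lam * Iu + (c + err)"
      using err by (intro add_left_mono)
    finally show ?thesis .
  qed
  then show "u s x \<le> c + err" using fin(1) by (simp add: ennreal_add_left_cancel_le)
  have "ennreal lam * Iv + c \<le> ennreal lam * Iv + (u s x + err)"
  proof -
    have "ennreal lam * Iv + c \<le> (u s x + ennreal lam * Iu) + ennreal (C * \<epsilon>)"
      using Du Dv Pxz(2) by (simp add: add.commute)
    also have "\<dots> \<le> (u s x + ennreal lam * (Iv + ER)) + ennreal (C * \<epsilon>)"
      using IuIv by (intro add_right_mono add_left_mono mult_left_mono) auto
    also have "\<dots> = ennreal lam * Iv + (u s x + (ennreal (C * \<epsilon>) + ennreal lam * ER))"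
      by (simp add: distrib_left ac_simps)
    also have "\<dots> \<le> ennreal lam * Iv + (u s x + err)"
      using err by (intro add_left_mono)
    finally show ?thesis .
  qed
  then show "c \<le> u s x + err" using fin(2) by (simp add: ennreal_add_left_cancel_le)
qed

text \<open>With the weight \<open>exp (- \<kappa> * (t - s))\<close> the Volterra operator is a contraction by \<open>1 / 2\<close>.\<close>

lemma reg_transform_stability:
  defines "\<kappa> \<equiv> 2 * lam\<^sup>2 + 1" and "\<delta> \<equiv> 2 * (C * \<epsilon> + lam * (sqrt (2 * \<epsilon>) * (4 * t powr (1 / 4))))"
  assumes s: "0 \<le> s" "s < t" and x: "\<bar>x\<bar> \<le> \<epsilon>"
  shows "\<bar>enn2real (u s x) - enn2real (v s)\<bar> \<le> exp (\<kappa> * (t - s)) * \<delta>"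
proof -
  define S where "S = {exp (- \<kappa> * (t - s)) * \<bar>enn2real (u s x) - enn2real (v s)\<bar> | s x. 0 \<le> s \<and> s < t \<and> \<bar>x\<bar> \<le> \<epsilon>}"
  define D where "D = Sup S"
  have \<kappa>: "0 < \<kappa>" by (simp add: \<kappa>_def add_nonneg_pos)
  \<comment> \<open>\<open>\<kappa>\<close> is chosen such that \<open>2 * \<kappa>\<close> exceeds
    \<open>(2 * lam)\<^sup>2\<close>; the summand 1 keeps it positive for
    \<open>lam = 0\<close>.\<close>
  have lam\<kappa>: "lam / sqrt (2 * \<kappa>) \<le> 1 / 2"
  proof -
    have "2 * lam \<le> sqrt (2 * \<kappa>)" by (rule real_le_rsqrt) (simp add: \<kappa>_def power2_eq_square)
    then show ?thesis using \<kappa> by (simp add: divide_le_eq)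
  qed
  have u1: "u s x \<le> 1" for s x by (rule reg_transform_le_1[OF \<epsilon> lam \<phi>(2)])
  have v1: "v s \<le> 1" if "s < t" for s using that by (intro joint_transform_le_1 \<phi> lam) auto
  have le1: "\<bar>enn2real (u s x) - enn2real (v s)\<bar> \<le> 1" if "s < t" for s x
  proof -
    have "enn2real (u s x) \<le> 1" "enn2real (v s) \<le> 1"
      using u1[of s x] v1[OF that] by (auto intro!: enn2real_leI)
    then show ?thesis using enn2real_nonneg[of "u s x"] enn2real_nonneg[of "v s"] by linarith
  qed
  \<comment> \<open>The supremum must be finite, since \<open>D / 2\<close> is absorbed on the left
    at the end.\<close>
  have bdd: "bdd_above S"
  proof (rule bdd_aboveI[of _ 1])
    fix z assume "z \<in> S"
    then obtain s x where z: "z = exp (- \<kappa> * (t - s)) * \<bar>enn2real (u s x) - enn2real (v s)\<bar>" "s < t" by (auto simp: S_def)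
    have "exp (- \<kappa> * (t - s)) \<le> 1" using z(2) \<kappa> by simp
    then show "z \<le> 1" unfolding z(1) using le1[OF z(2), of x] by (intro mult_le_one) auto
  qed
  have D: "\<bar>enn2real (u s x) - enn2real (v s)\<bar> \<le> exp (\<kappa> * (t - s)) * D" if "0 \<le> s" "s < t" "\<bar>x\<bar> \<le> \<epsilon>" for s x
  proof -
    have "exp (- \<kappa> * (t - s)) * \<bar>enn2real (u s x) - enn2real (v s)\<bar> \<le> D"
      unfolding D_def by (rule cSup_upper[OF _ bdd]) (use that in \<open>auto simp: S_def\<close>)
    from mult_left_mono[OF this, of "exp (\<kappa> * (t - s))"]
    show ?thesis by (simp add: mult.assoc[symmetric] exp_add[symmetric])
  qed
  have D0: "0 \<le> D"
    using order_trans[OF abs_ge_zero D[OF s x]] by (simp add: zero_le_mult_iff)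
  \<comment> \<open>Inserting the bound \<open>D\<close> into the perturbed equation returns at most
    half of it; taking the supremum over \<open>S\<close> then yields
    \<open>D \<le> \<delta>\<close>.\<close>
  have "z \<le> \<delta> / 2 + D / 2" if "z \<in> S" for z
  proof -
    from that obtain s x where z: "z = exp (- \<kappa> * (t - s)) * \<bar>enn2real (u s x) - enn2real (v s)\<bar>"
      and s: "0 \<le> s" "s < t" and x: "\<bar>x\<bar> \<le> \<epsilon>" by (auto simp: S_def)
    define \<eta> where "\<eta> r = ennreal (exp (\<kappa> * (t - r)) * D)" for r
    have [measurable]: "\<eta> \<in> borel_measurable borel" unfolding \<eta>_def by measurable
    have close: "u r y \<le> v r + \<eta> r" "v r \<le> u r y + \<eta> r" if "s < r" "r < t" "\<bar>y\<bar> \<le> \<epsilon>" for r y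
      unfolding \<eta>_def using D[of r y] that s u1 v1
      by (auto intro!: ennreal_le_if_abs_diff_le simp: abs_minus_commute)
    \<comment> \<open>The comparison is made with \<open>z = 0\<close>, for which the unperturbed
      equation is the Volterra equation of \<open>v\<close> itself.\<close>
    have c: "v s + ennreal lam * (\<integral>\<^sup>+r\<in>{s<..<t}. ennreal (heat (r - s) 0) * v r \<partial>lborel) =
      (\<integral>\<^sup>+y. ennreal (\<phi> y * heat (t - s) (y - 0)) \<partial>lborel)"
      using joint_transform_Volterra[OF \<phi>_measurable \<phi>(1) _ lam, of "t - s"] s
      by (simp add: heat_convolution_joint_transform_shift)
    \<comment> \<open>\<open>t\<close> in place of \<open>t - s\<close> in the last term makes the
      perturbation uniform in \<open>s\<close>.\<close>
    define e where "e = C * \<epsilon> + lam * (exp (\<kappa> * (t - s)) * D / sqrt (2 * \<kappa>) + sqrt (2 * \<epsilon>) * (4 * t powr (1 / 4)))"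
    have e0: "0 \<le> e" using C lam \<epsilon> D0 \<kappa> by (simp add: e_def)
    have "ennreal (C * \<epsilon>) + ennreal lam * ((\<integral>\<^sup>+r\<in>{s<..<t}. ennreal (heat (r - s) 0) * \<eta> r \<partial>lborel) +
      ennreal (sqrt (2 * \<epsilon>) * (4 * (t - s) powr (1 / 4)))) \<le>
      ennreal (C * \<epsilon>) + ennreal lam * (ennreal (exp (\<kappa> * (t - s)) * D / sqrt (2 * \<kappa>)) + ennreal (sqrt (2 * \<epsilon>) * (4 * t powr (1 / 4))))"
      unfolding \<eta>_def using s \<epsilon>
      by (intro add_left_mono mult_left_mono add_mono nn_integral_heat_exp_weight D0 \<kappa> ennreal_leI powr_mono2) auto
    also have "\<dots> = ennreal e"
      using C lam \<epsilon> D0 \<kappa> by (simp add: e_def ennreal_mult'[symmetric] ennreal_plus[symmetric] del: ennreal_plus)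
    finally have le: "ennreal (C * \<epsilon>) + ennreal lam * ((\<integral>\<^sup>+r\<in>{s<..<t}. ennreal (heat (r - s) 0) * \<eta> r \<partial>lborel) +
      ennreal (sqrt (2 * \<epsilon>) * (4 * (t - s) powr (1 / 4)))) \<le> ennreal e" .
    have "u s x \<le> v s + ennreal e" "v s \<le> u s x + ennreal e"
      using reg_transform_compare[OF s _ _ close c, of x] x le by (auto intro: order_trans add_left_mono)
    then have "\<bar>enn2real (u s x) - enn2real (v s)\<bar> \<le> e"
      using u1 v1[OF s(2)] e0 by (intro abs_diff_le_if_ennreal)
    then have "z \<le> exp (- \<kappa> * (t - s)) * e" unfolding z by (intro mult_left_mono) auto
    also have "\<dots> = exp (- \<kappa> * (t - s)) * (\<delta> / 2) + (lam / sqrt (2 * \<kappa>)) * D"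
    proof -
      have "exp (- \<kappa> * (t - s)) * exp (\<kappa> * (t - s)) = 1" by (simp add: exp_add[symmetric])
      then show ?thesis unfolding e_def \<delta>_def by (simp add: algebra_simps)
    qed
    also have "\<dots> \<le> 1 * (\<delta> / 2) + (1 / 2) * D"
      using s \<kappa> C \<epsilon> lam D0 lam\<kappa> by (intro add_mono mult_right_mono) (auto simp: \<delta>_def)
    finally show ?thesis by simp
  qed
  then have "D \<le> \<delta> / 2 + D / 2"
    unfolding D_def by (intro cSup_least) (use s x in \<open>auto simp: S_def\<close>)
  then have "D \<le> \<delta>" by simp
  then show ?thesis using D[OF s x] by (meson exp_ge_zero mult_left_mono order_trans)
qed

end

text \<open>Stability covers only starting points within \<epsilon> of 0. One further comparison,
  now with \<open>z = x\<close>, carries the estimate to an arbitrary start, because under the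
  integral of the Duhamel equation the restart always happens near 0.\<close>

lemma reg_transform_tendsto:
  assumes lam: "0 \<le> lam" and [measurable]: "\<phi> \<in> borel_measurable borel"
    and \<phi>: "\<And>x. 0 \<le> \<phi> x" "\<And>x. \<phi> x \<le> 1"
    and C: "0 \<le> C" and Lip: "\<And>x y. \<bar>\<phi> x - \<phi> y\<bar> \<le> C * \<bar>x - y\<bar>"
    and s: "0 \<le> s" "s < t"
    and c: "c + ennreal lam * (\<integral>\<^sup>+q\<in>{0<..<t - s}. ennreal (heat q x) * joint_transform \<phi> lam (t - s - q) \<partial>lborel) =
      (\<integral>\<^sup>+y. ennreal (\<phi> y * heat (t - s) (y - x)) \<partial>lborel)"
  shows "(\<lambda>n. reg_transform (1 / real (Suc n)) lam \<phi> t s x) \<longlonglongrightarrow> c"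
proof -
  define \<kappa> where "\<kappa> = 2 * lam\<^sup>2 + 1"
  define \<delta> where "\<delta> \<epsilon> = 2 * (C * \<epsilon> + lam * (sqrt (2 * \<epsilon>) * (4 * t powr (1 / 4))))" for \<epsilon>
  define e where "e \<epsilon> = C * \<epsilon> + lam * (exp (\<kappa> * (t - s)) * \<delta> \<epsilon> / sqrt (2 * \<kappa>) + sqrt (2 * \<epsilon>) * (4 * (t - s) powr (1 / 4)))" for \<epsilon>
  have \<kappa>: "0 < \<kappa>" by (simp add: \<kappa>_def add_nonneg_pos)
  let ?v = "\<lambda>r. joint_transform \<phi> lam (t - r)"
  have v1: "?v s \<le> 1" if "s < t" for s using that by (intro joint_transform_le_1 \<phi> lam) auto
  have c1: "c \<le> 1"
  proof -
    have "c \<le> (\<integral>\<^sup>+y. ennreal (\<phi> y * heat (t - s) (y - x)) \<partial>lborel)" by (subst c[symmetric]) simp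
    also have "\<dots> \<le> 1" by (rule nn_integral_mult_heat_le_1[OF _ \<phi>]) (use s in auto)
    finally show ?thesis .
  qed
  have bound: "\<bar>enn2real (reg_transform \<epsilon> lam \<phi> t s x) - enn2real c\<bar> \<le> e \<epsilon>" if \<epsilon>: "0 < \<epsilon>" for \<epsilon>
  proof -
    let ?u = "reg_transform \<epsilon> lam \<phi> t"
    have u1: "?u s x \<le> 1" for s x by (rule reg_transform_le_1[OF \<epsilon> lam \<phi>(2)])
    have \<delta>0: "0 \<le> \<delta> \<epsilon>" using C lam \<epsilon> by (simp add: \<delta>_def)
    have e0: "0 \<le> e \<epsilon>" using C lam \<epsilon> \<kappa> \<delta>0 by (simp add: e_def)
    define \<eta> where "\<eta> r = ennreal (exp (\<kappa> * (t - r)) * \<delta> \<epsilon>)" for r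
    have [measurable]: "\<eta> \<in> borel_measurable borel" unfolding \<eta>_def by measurable
    have stab: "\<bar>enn2real (?u r y) - enn2real (?v r)\<bar> \<le> exp (\<kappa> * (t - r)) * \<delta> \<epsilon>" if "s < r" "r < t" "\<bar>y\<bar> \<le> \<epsilon>" for r y
      unfolding \<kappa>_def \<delta>_def by (rule reg_transform_stability[OF \<epsilon> lam _ \<phi> C Lip]) (use that s in auto)
    have close: "?u r y \<le> ?v r + \<eta> r" "?v r \<le> ?u r y + \<eta> r" if "s < r" "r < t" "\<bar>y\<bar> \<le> \<epsilon>" for r y
      unfolding \<eta>_def using stab[OF that] that u1 v1
      by (auto intro!: ennreal_le_if_abs_diff_le simp: abs_minus_commute)
    have "ennreal (C * \<epsilon>) + ennreal lam * ((\<integral>\<^sup>+r\<in>{s<..<t}. ennreal (heat (r - s) 0) * \<eta> r \<partial>lborel) +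
      ennreal (sqrt (2 * \<epsilon>) * (4 * (t - s) powr (1 / 4)))) \<le>
      ennreal (C * \<epsilon>) + ennreal lam * (ennreal (exp (\<kappa> * (t - s)) * \<delta> \<epsilon> / sqrt (2 * \<kappa>)) + ennreal (sqrt (2 * \<epsilon>) * (4 * (t - s) powr (1 / 4))))"
      unfolding \<eta>_def using s
      by (intro add_left_mono mult_left_mono add_mono order_refl nn_integral_heat_exp_weight \<delta>0 \<kappa>) auto
    also have "\<dots> = ennreal (e \<epsilon>)"
      using C lam \<epsilon> \<delta>0 \<kappa> by (simp add: e_def ennreal_mult'[symmetric] ennreal_plus[symmetric] del: ennreal_plus)
    finally have le: "ennreal (C * \<epsilon>) + ennreal lam * ((\<integral>\<^sup>+r\<in>{s<..<t}. ennreal (heat (r - s) 0) * \<eta> r \<partial>lborel) +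
      ennreal (sqrt (2 * \<epsilon>) * (4 * (t - s) powr (1 / 4)))) \<le> ennreal (e \<epsilon>)" .
    have c': "c + ennreal lam * (\<integral>\<^sup>+r\<in>{s<..<t}. ennreal (heat (r - s) x) * ?v r \<partial>lborel) =
      (\<integral>\<^sup>+y. ennreal (\<phi> y * heat (t - s) (y - x)) \<partial>lborel)"
      using c by (simp add: heat_convolution_joint_transform_shift)
    note cmp = reg_transform_compare[OF \<epsilon> lam _ \<phi> C Lip s _ _ close c', of x]
    have "?u s x \<le> c + ennreal (e \<epsilon>)" "c \<le> ?u s x + ennreal (e \<epsilon>)"
      using cmp \<epsilon> le by (auto intro: order_trans add_left_mono)
    then show ?thesis using u1 c1 e0 by (intro abs_diff_le_if_ennreal)
  qed
  have "(\<lambda>n. e (1 / real (Suc n))) \<longlonglongrightarrow> C * 0 + lam * (exp (\<kappa> * (t - s)) * (2 * (C * 0 + lam * (sqrt (2 * 0) * (4 * t powr (1 / 4))))) / sqrt (2 * \<kappa>) + sqrt (2 * 0) * (4 * (t - s) powr (1 / 4)))"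
    unfolding e_def \<delta>_def using \<kappa>
    by (intro tendsto_intros LIMSEQ_Suc[OF lim_1_over_n]) auto
  then have "(\<lambda>n. e (1 / real (Suc n))) \<longlonglongrightarrow> 0" by simp
  then have "(\<lambda>n. enn2real (reg_transform (1 / real (Suc n)) lam \<phi> t s x) - enn2real c) \<longlonglongrightarrow> 0"
    by (rule Lim_null_comparison[rotated]) (use bound in \<open>auto intro!: always_eventually\<close>)
  then have "(\<lambda>n. enn2real (reg_transform (1 / real (Suc n)) lam \<phi> t s x)) \<longlonglongrightarrow> enn2real c"
    by (simp add: LIM_zero_iff)
  from tendsto_ennrealI[OF this]
  have "(\<lambda>n. ennreal (enn2real (reg_transform (1 / real (Suc n)) lam \<phi> t s x))) \<longlonglongrightarrow> ennreal (enn2real c)" .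
  moreover have "ennreal (enn2real z) = z" if "z \<le> 1" for z
    using that by (intro ennreal_enn2real) (auto simp: less_top intro: le_less_trans)
  ultimately show ?thesis
    using c1 reg_transform_le_1[OF _ lam \<phi>(2)] by simp
qed

end

section \<open>The joint law of position and local time\<close>

lemma occupation_split:
  assumes \<epsilon>: "0 < \<epsilon>" and [measurable]: "f \<in> borel_measurable borel" and "a \<le> b" "b \<le> c"
  shows "occupation \<epsilon> f a c = occupation \<epsilon> f a b + occupation \<epsilon> f b c"
proof -
  let ?w = "\<lambda>q. window \<epsilon> (f q)"
  have i: "integrable lborel (\<lambda>q. if a \<le> q \<and> q \<le> b then ?w q else 0)" for a b
    by (rule integrable_if_bounded_interval[of _ "1 / (2 * \<epsilon>)"])
       (use window_nonneg[OF \<epsilon>] window_le[OF \<epsilon>] in auto)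
  have "occupation \<epsilon> f a b + occupation \<epsilon> f b c =
     (LINT q|lborel. (if a \<le> q \<and> q \<le> b then ?w q else 0) + (if b \<le> q \<and> q \<le> c then ?w q else 0))"
    unfolding occupation_def by (rule Bochner_Integration.integral_add[OF i i, symmetric])
  also have "\<dots> = occupation \<epsilon> f a c"
    unfolding occupation_def
  proof (rule integral_cong_AE)
    show "AE q in lborel. (if a \<le> q \<and> q \<le> b then ?w q else 0) + (if b \<le> q \<and> q \<le> c then ?w q else 0) = (if a \<le> q \<and> q \<le> c then ?w q else 0)"
      by (rule eventually_mono[OF AE_lborel_singleton[of b]]) (use assms in auto)
  qed measurable
  finally show ?thesis by simp
qed

lemma occupation_same [simp]: "occupation \<epsilon> f a a = 0"
  unfolding occupation_def
  by (rule integral_eq_zero_AE) (auto intro!: eventually_mono[OF AE_lborel_singleton[of a]])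

text \<open>An unspecified value if the limit does not exist; for Brownian paths it exists almost surely.\<close>

definition path_local_time :: "(real \<Rightarrow> real) \<Rightarrow> real \<Rightarrow> real" where
  "path_local_time w t = lim (\<lambda>n. occupation (1 / real (Suc n)) (path_eval w) 0 t)"

lemma path_local_time_measurable [measurable (raw)]:
  assumes [measurable]: "f \<in> measurable N path_algebra" "g \<in> borel_measurable N"
  shows "(\<lambda>x. path_local_time (f x) (g x)) \<in> borel_measurable N"
  unfolding path_local_time_def by (rule borel_measurable_lim_metric) measurable

lemma emeasure_distr_eq_nn_integral:
  assumes [measurable]: "X \<in> measurable N K" "D \<in> sets K"
  shows "emeasure (distr N K X) D = (\<integral>\<^sup>+\<omega>. indicator D (X \<omega>) \<partial>N)"
proof -
  have "emeasure (distr N K X) D = (\<integral>\<^sup>+x. indicator D x \<partial>distr N K X)" by simp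
  also have "\<dots> = (\<integral>\<^sup>+\<omega>. indicator D (X \<omega>) \<partial>N)" by (rule nn_integral_distr) measurable
  finally show ?thesis .
qed

text \<open>The limit is taken along a sequence, so that the local time can be written as a
  measurable functional of the path.\<close>

locale BM_local_time = continuous_BM M B for M :: "'a measure" and B +
  fixes L :: "real \<Rightarrow> 'a \<Rightarrow> real"
  assumes L_measurable [measurable]: "\<And>t. L t \<in> borel_measurable M"
    and L_continuous: "\<And>\<omega>. continuous_on UNIV (\<lambda>t. L t \<omega>)"
    and L_limit: "AE \<omega> in M. \<forall>t\<ge>0. (\<lambda>n. occupation (1 / real (Suc n)) (\<lambda>q. B q \<omega>) 0 t) \<longlonglongrightarrow> L t \<omega>"
begin

lemma L_joint_measurable [measurable (raw)]:
  assumes [measurable]: "f \<in> borel_measurable N" "g \<in> measurable N M"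
  shows "(\<lambda>x. L (f x) (g x)) \<in> borel_measurable N"
  using measurable_compose[OF _ continuous_process_measurable[OF L_measurable L_continuous], of "\<lambda>x. (g x, f x)" N] by simp

lemma L_mono_AE: "AE \<omega> in M. L 0 \<omega> = 0 \<and> (\<forall>s t. 0 \<le> s \<longrightarrow> s \<le> t \<longrightarrow> L s \<omega> \<le> L t \<omega>)"
  using L_limit
proof eventually_elim
  case (elim \<omega>)
  have "(\<lambda>n. occupation (1 / real (Suc n)) (\<lambda>q. B q \<omega>) 0 0) \<longlonglongrightarrow> L 0 \<omega>" using elim by blast
  then have "L 0 \<omega> = 0" by (simp add: LIMSEQ_const_iff)
  moreover have "L s \<omega> \<le> L t \<omega>" if "0 \<le> s" "s \<le> t" for s t
  proof (rule LIMSEQ_le)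
    show "(\<lambda>n. occupation (1 / real (Suc n)) (\<lambda>q. B q \<omega>) 0 s) \<longlonglongrightarrow> L s \<omega>"
      "(\<lambda>n. occupation (1 / real (Suc n)) (\<lambda>q. B q \<omega>) 0 t) \<longlonglongrightarrow> L t \<omega>"
      using elim that by auto
    show "\<exists>N. \<forall>n\<ge>N. occupation (1 / real (Suc n)) (\<lambda>q. B q \<omega>) 0 s \<le> occupation (1 / real (Suc n)) (\<lambda>q. B q \<omega>) 0 t"
      using that by (auto simp: occupation_split[OF _ B_path_measurable that] intro!: occupation_nonneg)
  qed
  ultimately show ?case by blast
qed

lemma L_nonneg_AE: "0 \<le> t \<Longrightarrow> AE \<omega> in M. 0 \<le> L t \<omega>"
  using L_mono_AE by eventually_elim (metis order_refl)

text \<open>Up to a null set \<open>L s\<close> is a functional of the past, as the Markov property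
  at \<open>s\<close> requires.\<close>

lemma path_local_time_past_AE: "0 \<le> s \<Longrightarrow> AE \<omega> in M. path_local_time (past s \<omega>) s = L s \<omega>"
  using L_limit
proof eventually_elim
  case (elim \<omega>)
  have "occupation e (path_eval (past s \<omega>)) 0 s = occupation e (\<lambda>q. B q \<omega>) 0 s" for e
    by (rule occupation_cong) (simp add: path_eval_past)
  then show ?case unfolding path_local_time_def using elim by (simp add: limI)
qed

text \<open>The regularised transforms started at 0 converge to both sides: by stability to the
  Volterra solution, and by dominated convergence to the expectation.\<close>

lemma Laplace_transform_L:
  assumes t: "0 < t" and lam: "0 \<le> lam" and [measurable]: "\<phi> \<in> borel_measurable borel"
    and \<phi>: "\<And>x. 0 \<le> \<phi> x" "\<And>x. \<phi> x \<le> 1"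
    and C: "0 \<le> C" and Lip: "\<And>x y. \<bar>\<phi> x - \<phi> y\<bar> \<le> C * \<bar>x - y\<bar>"
  shows "(\<integral>\<^sup>+\<omega>. ennreal (\<phi> (B t \<omega>) * exp (- lam * L t \<omega>)) \<partial>M) = joint_transform \<phi> lam t"
proof (rule LIMSEQ_unique)
  show "(\<lambda>n. reg_transform (1 / real (Suc n)) lam \<phi> t 0 0) \<longlonglongrightarrow> joint_transform \<phi> lam t"
    by (rule reg_transform_tendsto[OF lam _ \<phi> C Lip])
       (use joint_transform_Volterra[OF _ \<phi>(1) t lam] t in auto)
  show "(\<lambda>n. reg_transform (1 / real (Suc n)) lam \<phi> t 0 0) \<longlonglongrightarrow> (\<integral>\<^sup>+\<omega>. ennreal (\<phi> (B t \<omega>) * exp (- lam * L t \<omega>)) \<partial>M)"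
    unfolding reg_transform_def
  proof (rule nn_integral_dominated_convergence[where w="\<lambda>_. 1"])
    show "AE \<omega> in M. ennreal (\<phi> (0 + B t \<omega> - B 0 \<omega>) * exp (- lam * occupation (1 / real (Suc n)) (\<lambda>q. 0 + B q \<omega> - B 0 \<omega>) 0 t)) \<le> 1" for n
      using \<phi> lam by (intro AE_I2) (auto intro!: mult_le_one mult_nonneg_nonneg occupation_nonneg)
    show "AE \<omega> in M. (\<lambda>n. ennreal (\<phi> (0 + B t \<omega> - B 0 \<omega>) * exp (- lam * occupation (1 / real (Suc n)) (\<lambda>q. 0 + B q \<omega> - B 0 \<omega>) 0 t)))
        \<longlonglongrightarrow> ennreal (\<phi> (B t \<omega>) * exp (- lam * L t \<omega>))"
      using L_limit
    proof eventually_elim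
      case (elim \<omega>)
      then have "(\<lambda>n. occupation (1 / real (Suc n)) (\<lambda>q. B q \<omega>) 0 t) \<longlonglongrightarrow> L t \<omega>" using t by auto
      then have "(\<lambda>n. ennreal (\<phi> (B t \<omega>) * exp (- lam * occupation (1 / real (Suc n)) (\<lambda>q. B q \<omega>) 0 t)))
          \<longlonglongrightarrow> ennreal (\<phi> (B t \<omega>) * exp (- lam * L t \<omega>))"
        by (intro tendsto_ennrealI tendsto_intros)
      then show ?case by simp
    qed
  qed (auto simp: emeasure_space_1)
qed

text \<open>The transform is inverted one variable at a time. For fixed Lipschitz
  \<open>\<phi>\<close> the Laplace transform determines the law of \<open>L t\<close> weighted by
  \<open>\<phi> (B t)\<close>; then \<open>\<phi>\<close> varies while the set for
  \<open>L t\<close> stays fixed.\<close>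

lemma joint_law:
  assumes t: "0 < t" and f [measurable]: "f \<in> borel_measurable (borel \<Otimes>\<^sub>M borel)"
  shows "(\<integral>\<^sup>+\<omega>. f (B t \<omega>, L t \<omega>) \<partial>M) =
    (\<integral>\<^sup>+x. (\<integral>\<^sup>+l\<in>{0..}. ennreal (hit t (\<bar>x\<bar> + l)) * f (x, l) \<partial>lborel) \<partial>lborel)"
proof -
  let ?g = "\<lambda>p :: real \<times> real. ennreal (hit t (\<bar>fst p\<bar> + snd p)) * indicator {0..} (snd p)"
  define N where "N = density (lborel \<Otimes>\<^sub>M lborel) ?g"
  have sets_N [measurable_cong]: "sets N = sets (borel \<Otimes>\<^sub>M borel)"
    by (simp add: N_def cong: sets_pair_measure_cong)
  have nn_N: "(\<integral>\<^sup>+p. h p \<partial>N) = (\<integral>\<^sup>+x. (\<integral>\<^sup>+l\<in>{0..}. ennreal (hit t (\<bar>x\<bar> + l)) * h (x, l) \<partial>lborel) \<partial>lborel)"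
    if [measurable]: "h \<in> borel_measurable (borel \<Otimes>\<^sub>M borel)" for h
  proof -
    have [measurable]: "h \<in> borel_measurable (lborel \<Otimes>\<^sub>M lborel)"
      using that by (simp cong: measurable_cong_sets sets_pair_measure_cong)
    show ?thesis unfolding N_def
      by (subst nn_integral_density) (simp_all add: lborel.nn_integral_fst[symmetric] ac_simps)
  qed
  have trans: "(\<integral>\<^sup>+p. ennreal (\<phi> (fst p) * exp (- lam * snd p)) \<partial>N) = joint_transform \<phi> lam t"
    if [measurable]: "\<phi> \<in> borel_measurable borel" and "\<And>x. 0 \<le> \<phi> x" for \<phi> lam
    using that(2) t unfolding joint_transform_def
    by (subst nn_N) (auto intro!: nn_integral_cong simp: ennreal_mult'[symmetric] ac_simps split: split_indicator)
  have "emeasure N UNIV = joint_transform (\<lambda>_. 1) 0 t"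
    using trans[of "\<lambda>_. 1" 0] by (simp add: N_def space_pair_measure)
  also have "\<dots> \<le> 1" by (rule joint_transform_le_1) (use t in auto)
  finally have N1: "emeasure N UNIV \<le> 1" .
  have space_N [simp]: "space N = UNIV" by (simp add: N_def space_pair_measure)
  have UNIV_N [simp]: "UNIV \<in> sets N" using sets.top[of N] by simp
  have fin_N: "finite_measure N"
    using N1 by (intro finite_measureI) (auto simp: top_unique)
  have finM: "finite_measure (density M h)" if "h \<in> borel_measurable M" "\<And>\<omega>. h \<omega> \<le> 1" for h
  proof (rule finite_measureI)
    have "emeasure (density M h) (space M) = (\<integral>\<^sup>+\<omega>. h \<omega> * indicator (space M) \<omega> \<partial>M)"
      by (rule emeasure_density) (use that in auto)
    also have "\<dots> \<le> (\<integral>\<^sup>+\<omega>. 1 \<partial>M)"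
      by (rule nn_integral_mono) (use that in \<open>auto split: split_indicator\<close>)
    finally have "emeasure (density M h) (space M) \<le> (\<integral>\<^sup>+\<omega>. 1 \<partial>M)" .
    then show "emeasure (density M h) (space (density M h)) \<noteq> \<infinity>" by (auto simp: emeasure_space_1 top_unique)
  qed
  have finN: "finite_measure (density N h)" if "h \<in> borel_measurable N" "\<And>p. h p \<le> 1" for h
  proof (rule finite_measureI)
    have "emeasure (density N h) (space N) = (\<integral>\<^sup>+p. h p * indicator (space N) p \<partial>N)"
      by (rule emeasure_density) (use that in auto)
    also have "\<dots> \<le> (\<integral>\<^sup>+p. 1 \<partial>N)"
      by (rule nn_integral_mono) (use that in \<open>auto split: split_indicator\<close>)
    finally have "emeasure (density N h) (space N) \<le> (\<integral>\<^sup>+p. 1 \<partial>N)" .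
    then show "emeasure (density N h) (space (density N h)) \<noteq> \<infinity>" using N1 by (auto simp: top_unique)
  qed
  have 1: "(\<integral>\<^sup>+\<omega>. ennreal (\<phi> (B t \<omega>)) * indicator D (L t \<omega>) \<partial>M) = (\<integral>\<^sup>+p. ennreal (\<phi> (fst p)) * indicator D (snd p) \<partial>N)"
    if [measurable]: "\<phi> \<in> borel_measurable borel" and \<phi>: "\<And>x. 0 \<le> \<phi> x" "\<And>x. \<phi> x \<le> 1"
      and C: "0 \<le> C" and Lip: "\<And>x y. \<bar>\<phi> x - \<phi> y\<bar> \<le> C * \<bar>x - y\<bar>" and [measurable]: "D \<in> sets borel" for \<phi> C D
  proof -
    have "distr (density M (\<lambda>\<omega>. ennreal (\<phi> (B t \<omega>)))) borel (L t) = distr (density N (\<lambda>p. ennreal (\<phi> (fst p)))) borel snd"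
    proof (rule distr_eqI_Laplace)
      show "finite_measure (density M (\<lambda>\<omega>. ennreal (\<phi> (B t \<omega>))))" "finite_measure (density N (\<lambda>p. ennreal (\<phi> (fst p))))"
        by (intro finM finN; simp add: \<phi>)+
      show "AE \<omega> in density M (\<lambda>\<omega>. ennreal (\<phi> (B t \<omega>))). 0 \<le> L t \<omega>"
        using L_nonneg_AE[of t] t by (simp add: AE_density) (auto elim: eventually_mono)
      have "AE p in N. 0 \<le> snd p" unfolding N_def by (simp add: AE_density indicator_def)
      then show "AE p in density N (\<lambda>p. ennreal (\<phi> (fst p))). 0 \<le> snd p"
        by (simp add: AE_density) (auto elim: eventually_mono)
      fix n :: nat
      have "(\<integral>\<^sup>+\<omega>. ennreal (exp (- real n * L t \<omega>)) \<partial>density M (\<lambda>\<omega>. ennreal (\<phi> (B t \<omega>)))) =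
          (\<integral>\<^sup>+\<omega>. ennreal (\<phi> (B t \<omega>) * exp (- real n * L t \<omega>)) \<partial>M)"
        using \<phi> by (simp add: nn_integral_density ennreal_mult')
      also have "\<dots> = joint_transform \<phi> (real n) t"
        by (rule Laplace_transform_L[OF t _ _ \<phi> C Lip]) auto
      also have "\<dots> = (\<integral>\<^sup>+p. ennreal (exp (- real n * snd p)) \<partial>density N (\<lambda>p. ennreal (\<phi> (fst p))))"
        using \<phi> by (simp add: nn_integral_density trans[symmetric] ennreal_mult')
      finally show "(\<integral>\<^sup>+\<omega>. ennreal (exp (- real n * L t \<omega>)) \<partial>density M (\<lambda>\<omega>. ennreal (\<phi> (B t \<omega>)))) = \<dots>" .
    qed (simp_all cong: measurable_cong_sets)
    then have "emeasure (distr (density M (\<lambda>\<omega>. ennreal (\<phi> (B t \<omega>)))) borel (L t)) D = emeasure (distr (density N (\<lambda>p. ennreal (\<phi> (fst p)))) borel snd) D"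
      by simp
    then show ?thesis
      by (subst (asm) (1 2) emeasure_distr_eq_nn_integral) (simp_all add: nn_integral_density cong: measurable_cong_sets)
  qed
  have 2: "distr (density M (\<lambda>\<omega>. indicator D (L t \<omega>))) borel (B t) = distr (density N (\<lambda>p. indicator D (snd p))) borel fst"
    if [measurable]: "D \<in> sets borel" for D
  proof (rule finite_borel_measure_eqI_Lipschitz)
    show "finite_measure (distr (density M (\<lambda>\<omega>. indicator D (L t \<omega>))) borel (B t))"
      by (intro finite_measure.finite_measure_distr finM) (auto split: split_indicator)
    show "finite_measure (distr (density N (\<lambda>p. indicator D (snd p))) borel fst)"
      by (intro finite_measure.finite_measure_distr finN) (auto split: split_indicator)
    fix \<phi> :: "real \<Rightarrow> real" and C assume "\<phi> \<in> borel_measurable borel" "\<And>x. 0 \<le> \<phi> x" "\<And>x. \<phi> x \<le> 1" "0 \<le> C" "\<And>x y. \<bar>\<phi> x - \<phi> y\<bar> \<le> C * \<bar>x - y\<bar>"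
    note [measurable] = this(1) and * = 1[OF this that]
    show "(\<integral>\<^sup>+x. ennreal (\<phi> x) \<partial>distr (density M (\<lambda>\<omega>. indicator D (L t \<omega>))) borel (B t)) =
       (\<integral>\<^sup>+x. ennreal (\<phi> x) \<partial>distr (density N (\<lambda>p. indicator D (snd p))) borel fst)"
      using * by (simp add: nn_integral_distr nn_integral_density mult.commute)
  qed auto
  have "distr M (borel \<Otimes>\<^sub>M borel) (\<lambda>\<omega>. (B t \<omega>, L t \<omega>)) = N"
  proof (rule finite_measure_eqI_rectangles)
    show "finite_measure (distr M (borel \<Otimes>\<^sub>M borel) (\<lambda>\<omega>. (B t \<omega>, L t \<omega>)))"
      by (rule finite_measure_distr) simp
    fix S D :: "real set" assume [measurable]: "S \<in> sets borel" "D \<in> sets borel"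
    have "emeasure (distr M (borel \<Otimes>\<^sub>M borel) (\<lambda>\<omega>. (B t \<omega>, L t \<omega>))) (S \<times> D) = (\<integral>\<^sup>+\<omega>. indicator D (L t \<omega>) * indicator S (B t \<omega>) \<partial>M)"
      by (subst emeasure_distr_eq_nn_integral) (auto simp: indicator_times mult.commute)
    also have "\<dots> = emeasure (distr (density M (\<lambda>\<omega>. indicator D (L t \<omega>))) borel (B t)) S"
      by (subst emeasure_distr_eq_nn_integral) (auto simp: nn_integral_density)
    also have "\<dots> = emeasure (distr (density N (\<lambda>p. indicator D (snd p))) borel fst) S"
      by (simp add: 2)
    also have "\<dots> = (\<integral>\<^sup>+p. indicator D (snd p) * indicator S (fst p) \<partial>N)"
      by (subst emeasure_distr_eq_nn_integral) (auto simp: nn_integral_density)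
    also have "\<dots> = (\<integral>\<^sup>+p. indicator (S \<times> D) p \<partial>N)"
      by (intro nn_integral_cong) (auto split: split_indicator)
    also have "\<dots> = emeasure N (S \<times> D)" by (simp add: sets_N)
    finally show "emeasure (distr M (borel \<Otimes>\<^sub>M borel) (\<lambda>\<omega>. (B t \<omega>, L t \<omega>))) (S \<times> D) = emeasure N (S \<times> D)" .
  qed (simp_all add: sets_N)
  note N_eq = this
  have "(\<integral>\<^sup>+p. f p \<partial>N) = (\<integral>\<^sup>+\<omega>. f (B t \<omega>, L t \<omega>) \<partial>M)"
    unfolding N_eq[symmetric] by (rule nn_integral_distr) measurable
  then show ?thesis by (simp add: nn_N)
qed

section \<open>Local time at a later time, given position and local time at \<open>s\<close>\<close>

text \<open>\<open>exp (- lam * L t)\<close> factors into \<open>exp (- lam * L s)\<close>, a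
  functional of the past, and the contribution after \<open>s\<close>, whose conditional mean is a
  limit of regularised transforms started at \<open>B s\<close>. For \<open>\<phi> = 1\<close> that
  limit is explicit for every start.\<close>

lemma Laplace_transform_L_later:
  assumes s: "0 < s" "s < t" and lam: "0 \<le> lam" and S [measurable]: "S \<in> sets (borel \<Otimes>\<^sub>M borel)"
  shows "(\<integral>\<^sup>+\<omega>. indicator S (B s \<omega>, L s \<omega>) * ennreal (exp (- lam * L t \<omega>)) \<partial>M) =
    (\<integral>\<^sup>+x. (\<integral>\<^sup>+l\<in>{0..}. ennreal (hit s (\<bar>x\<bar> + l)) * (indicator S (x, l) *
      (\<integral>\<^sup>+z. ennreal (heat (t - s) z * exp (- lam * (l + max 0 (\<bar>z\<bar> - \<bar>x\<bar>)))) \<partial>lborel)) \<partial>lborel) \<partial>lborel)"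
proof -
  define c where "c x = (\<integral>\<^sup>+z. ennreal (heat (t - s) z * exp (- lam * max 0 (\<bar>z\<bar> - \<bar>x\<bar>))) \<partial>lborel)" for x
  have [measurable]: "c \<in> borel_measurable borel" unfolding c_def by measurable
  \<comment> \<open>\<open>max 0\<close> keeps \<open>a\<close> bounded by 1 also on those paths
    where the limit defining \<open>path_local_time\<close> does not exist.\<close>
  define a where "a w = indicator S (path_eval w s, path_local_time w s) * ennreal (exp (- lam * max 0 (path_local_time w s)))" for w
  have [measurable]: "a \<in> borel_measurable path_algebra" unfolding a_def by measurable
  have a_le: "a w \<le> 1" for w
    using lam by (auto simp: a_def split: split_indicator)
  have a_past: "AE \<omega> in M. a (past s \<omega>) = indicator S (B s \<omega>, L s \<omega>) * ennreal (exp (- lam * L s \<omega>))"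
    using path_local_time_past_AE[OF less_imp_le[OF s(1)]] L_nonneg_AE[OF less_imp_le[OF s(1)]]
    by eventually_elim (use s in \<open>simp add: a_def path_eval_past\<close>)
  let ?occ = "\<lambda>k \<omega>. occupation (1 / real (Suc k)) (\<lambda>q. B s \<omega> + B q \<omega> - B s \<omega>) s t"
  let ?u = "\<lambda>k. reg_transform (1 / real (Suc k)) lam (\<lambda>_. 1) t s"
  have u_le: "?u k x \<le> 1" for k x by (rule reg_transform_le_1) (use lam in auto)
  have Markov: "(\<integral>\<^sup>+\<omega>. a (past s \<omega>) * ennreal (exp (- lam * ?occ k \<omega>)) \<partial>M) = (\<integral>\<^sup>+\<omega>. a (past s \<omega>) * ?u k (B s \<omega>) \<partial>M)" for k
    using Markov_reg_transform[of s t "\<lambda>_. 1" a "\<lambda>w. path_eval w s" lam "1 / real (Suc k)"] s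
    by (simp add: path_eval_past)
  have "(\<lambda>k. \<integral>\<^sup>+\<omega>. a (past s \<omega>) * ennreal (exp (- lam * ?occ k \<omega>)) \<partial>M) \<longlonglongrightarrow>
      (\<integral>\<^sup>+\<omega>. indicator S (B s \<omega>, L s \<omega>) * ennreal (exp (- lam * L t \<omega>)) \<partial>M)"
  proof (rule nn_integral_dominated_convergence[where w="\<lambda>_. 1"])
    show "AE \<omega> in M. a (past s \<omega>) * ennreal (exp (- lam * ?occ k \<omega>)) \<le> 1" for k
    proof (rule AE_I2)
      fix \<omega>
      have "ennreal (exp (- lam * ?occ k \<omega>)) \<le> 1" using lam by (simp add: occupation_nonneg)
      then show "a (past s \<omega>) * ennreal (exp (- lam * ?occ k \<omega>)) \<le> 1"
        using mult_mono[OF a_le[of "past s \<omega>"], of "ennreal (exp (- lam * ?occ k \<omega>))" 1] by simp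
    qed
    show "AE \<omega> in M. (\<lambda>k. a (past s \<omega>) * ennreal (exp (- lam * ?occ k \<omega>))) \<longlonglongrightarrow>
        indicator S (B s \<omega>, L s \<omega>) * ennreal (exp (- lam * L t \<omega>))"
      using a_past L_limit
    proof eventually_elim
      case (elim \<omega>)
      have "?occ k \<omega> = occupation (1 / real (Suc k)) (\<lambda>q. B q \<omega>) 0 t - occupation (1 / real (Suc k)) (\<lambda>q. B q \<omega>) 0 s" for k
        using s by (simp add: occupation_split[OF _ B_path_measurable, of _ 0 s t])
      moreover have "(\<lambda>k. occupation (1 / real (Suc k)) (\<lambda>q. B q \<omega>) 0 t - occupation (1 / real (Suc k)) (\<lambda>q. B q \<omega>) 0 s) \<longlonglongrightarrow> L t \<omega> - L s \<omega>"
        using elim(2) s by (intro tendsto_diff) auto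
      ultimately have "(\<lambda>k. ?occ k \<omega>) \<longlonglongrightarrow> L t \<omega> - L s \<omega>" by simp
      then have "(\<lambda>k. ennreal (exp (- lam * L s \<omega>) * exp (- lam * ?occ k \<omega>))) \<longlonglongrightarrow> ennreal (exp (- lam * L s \<omega>) * exp (- lam * (L t \<omega> - L s \<omega>)))"
        by (intro tendsto_ennrealI tendsto_intros)
      also have "exp (- lam * L s \<omega>) * exp (- lam * (L t \<omega> - L s \<omega>)) = exp (- lam * L t \<omega>)"
        by (simp add: exp_add[symmetric] algebra_simps)
      finally show ?case
        unfolding elim(1) by (auto simp: ennreal_mult' split: split_indicator)
    qed
  qed (auto simp: emeasure_space_1)
  moreover have "(\<lambda>k. \<integral>\<^sup>+\<omega>. a (past s \<omega>) * ?u k (B s \<omega>) \<partial>M) \<longlonglongrightarrow> (\<integral>\<^sup>+\<omega>. a (past s \<omega>) * c (B s \<omega>) \<partial>M)"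
  proof (rule nn_integral_dominated_convergence[where w="\<lambda>_. 1"])
    show "AE \<omega> in M. a (past s \<omega>) * ?u k (B s \<omega>) \<le> 1" for k
      using mult_mono[OF a_le u_le] by (intro AE_I2) simp
    show "AE \<omega> in M. (\<lambda>k. a (past s \<omega>) * ?u k (B s \<omega>)) \<longlonglongrightarrow> a (past s \<omega>) * c (B s \<omega>)"
    proof (intro AE_I2 ennreal_tendsto_cmult)
      show "a (past s \<omega>) < \<top>" for \<omega> using a_le[of "past s \<omega>"] by (auto simp: less_top[symmetric] top_unique)
      show "(\<lambda>k. ?u k (B s \<omega>)) \<longlonglongrightarrow> c (B s \<omega>)" for \<omega>
      proof (rule reg_transform_tendsto[where C=0, OF lam])
        show "c (B s \<omega>) + ennreal lam * (\<integral>\<^sup>+q\<in>{0<..<t - s}. ennreal (heat q (B s \<omega>)) * joint_transform (\<lambda>_. 1) lam (t - s - q) \<partial>lborel) =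
          (\<integral>\<^sup>+y. ennreal (1 * heat (t - s) (y - B s \<omega>)) \<partial>lborel)"
          using joint_transform_1_Volterra[of "t - s" lam "B s \<omega>"] nn_integral_heat_shift[of "t - s" "B s \<omega>"] s lam
          by (simp add: c_def)
      qed (use s in auto)
    qed
  qed (auto simp: emeasure_space_1)
  ultimately have "(\<integral>\<^sup>+\<omega>. indicator S (B s \<omega>, L s \<omega>) * ennreal (exp (- lam * L t \<omega>)) \<partial>M) = (\<integral>\<^sup>+\<omega>. a (past s \<omega>) * c (B s \<omega>) \<partial>M)"
    unfolding Markov by (rule LIMSEQ_unique)
  also have "\<dots> = (\<integral>\<^sup>+\<omega>. (\<lambda>p. indicator S p * ennreal (exp (- lam * snd p)) * c (fst p)) (B s \<omega>, L s \<omega>) \<partial>M)"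
    by (rule nn_integral_cong_AE) (use a_past in eventually_elim, simp)
  also have "\<dots> = (\<integral>\<^sup>+x. (\<integral>\<^sup>+l\<in>{0..}. ennreal (hit s (\<bar>x\<bar> + l)) * (indicator S (x, l) * ennreal (exp (- lam * l)) * c x) \<partial>lborel) \<partial>lborel)"
    by (subst joint_law[OF s(1)]) simp_all
  also have "\<dots> = (\<integral>\<^sup>+x. (\<integral>\<^sup>+l\<in>{0..}. ennreal (hit s (\<bar>x\<bar> + l)) * (indicator S (x, l) *
      (\<integral>\<^sup>+z. ennreal (heat (t - s) z * exp (- lam * (l + max 0 (\<bar>z\<bar> - \<bar>x\<bar>)))) \<partial>lborel)) \<partial>lborel) \<partial>lborel)"
  proof -
    have "ennreal (exp (- lam * l)) * c x = (\<integral>\<^sup>+z. ennreal (heat (t - s) z * exp (- lam * (l + max 0 (\<bar>z\<bar> - \<bar>x\<bar>)))) \<partial>lborel)" for x l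
    proof -
      have "exp (- lam * (l + max 0 (\<bar>z\<bar> - \<bar>x\<bar>))) = exp (- lam * l) * exp (- lam * max 0 (\<bar>z\<bar> - \<bar>x\<bar>))" for z
        by (simp only: distrib_left exp_add)
      then show ?thesis
        unfolding c_def using s
        by (subst nn_integral_cmult[symmetric])
           (auto simp: ennreal_mult'[symmetric] ac_simps intro!: nn_integral_cong)
    qed
    then show ?thesis by (simp add: mult.assoc)
  qed
  finally show ?thesis .
qed

text \<open>Laplace inversion for fixed \<open>S\<close>: on that event the law of
  \<open>L t\<close> is the law of \<open>l + max 0 (\<bar>z\<bar> - \<bar>x\<bar>)\<close>,
  realised as a function \<open>X\<close> on an explicit measure \<open>N\<close>.\<close>

lemma law_L_later_less:
  assumes s: "0 < s" "s < t" and S [measurable]: "S \<in> sets (borel \<Otimes>\<^sub>M borel)"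
  shows "(\<integral>\<^sup>+\<omega>. indicator S (B s \<omega>, L s \<omega>) * indicator {..1} (L t \<omega>) \<partial>M) =
    (\<integral>\<^sup>+x. (\<integral>\<^sup>+l\<in>{0..}. ennreal (hit s (\<bar>x\<bar> + l)) * (indicator S (x, l) *
      (\<integral>\<^sup>+z. ennreal (heat (t - s) z) * indicator {..1} (l + max 0 (\<bar>z\<bar> - \<bar>x\<bar>)) \<partial>lborel)) \<partial>lborel) \<partial>lborel)"
proof -
  have S' [measurable]: "S \<in> sets (lborel \<Otimes>\<^sub>M lborel)" using S by (simp cong: sets_pair_measure_cong)
  define X where "X p = fst (snd p) + max 0 (\<bar>snd (snd p)\<bar> - \<bar>fst p\<bar>)" for p :: "real \<times> real \<times> real"
  let ?g = "\<lambda>p :: real \<times> real \<times> real. ennreal (hit s (\<bar>fst p\<bar> + fst (snd p))) *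
    (indicator S (fst p, fst (snd p)) * ennreal (heat (t - s) (snd (snd p)))) * indicator {0..} (fst (snd p))"
  define N where "N = density (lborel \<Otimes>\<^sub>M (lborel \<Otimes>\<^sub>M lborel)) ?g"
  have X [measurable]: "X \<in> borel_measurable N" unfolding X_def N_def by measurable
  have nn_N: "(\<integral>\<^sup>+p. h (X p) \<partial>N) = (\<integral>\<^sup>+x. (\<integral>\<^sup>+l\<in>{0..}. ennreal (hit s (\<bar>x\<bar> + l)) * (indicator S (x, l) *
      (\<integral>\<^sup>+z. ennreal (heat (t - s) z) * h (l + max 0 (\<bar>z\<bar> - \<bar>x\<bar>)) \<partial>lborel)) \<partial>lborel) \<partial>lborel)"
    if [measurable]: "h \<in> borel_measurable borel" for h
  proof -
    have P: "sigma_finite_measure (lborel \<Otimes>\<^sub>M lborel :: (real \<times> real) measure)"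
      by (rule lborel_pair.sigma_finite_measure_axioms)
    have "(\<integral>\<^sup>+p. h (X p) \<partial>N) = (\<integral>\<^sup>+x. (\<integral>\<^sup>+l. (\<integral>\<^sup>+z. ?g (x, l, z) * h (X (x, l, z)) \<partial>lborel) \<partial>lborel) \<partial>lborel)"
      unfolding N_def X_def
      by (subst nn_integral_density)
         (simp_all add: sigma_finite_measure.nn_integral_fst[OF P, symmetric] lborel.nn_integral_fst[symmetric])
    also have "\<dots> = (\<integral>\<^sup>+x. (\<integral>\<^sup>+l. (\<integral>\<^sup>+z. (ennreal (hit s (\<bar>x\<bar> + l)) * indicator S (x, l) * indicator {0..} l) *
        (ennreal (heat (t - s) z) * h (l + max 0 (\<bar>z\<bar> - \<bar>x\<bar>))) \<partial>lborel) \<partial>lborel) \<partial>lborel)"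
      by (intro nn_integral_cong) (simp add: X_def ac_simps)
    also have "\<dots> = (\<integral>\<^sup>+x. (\<integral>\<^sup>+l. (ennreal (hit s (\<bar>x\<bar> + l)) * indicator S (x, l) * indicator {0..} l) *
        (\<integral>\<^sup>+z. ennreal (heat (t - s) z) * h (l + max 0 (\<bar>z\<bar> - \<bar>x\<bar>)) \<partial>lborel) \<partial>lborel) \<partial>lborel)"
      by (rule nn_integral_cong, rule nn_integral_cong, rule nn_integral_cmult) measurable
    finally show ?thesis by (simp add: ac_simps)
  qed
  have Lap: "(\<integral>\<^sup>+\<omega>. indicator S (B s \<omega>, L s \<omega>) * ennreal (exp (- lam * L t \<omega>)) \<partial>M) = (\<integral>\<^sup>+p. ennreal (exp (- lam * X p)) \<partial>N)"
    if "0 \<le> lam" for lam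
  proof -
    have *: "ennreal (heat (t - s) z * e) = ennreal (heat (t - s) z) * ennreal e" for z e
      using s by (simp add: ennreal_mult')
    show ?thesis
      using nn_N[of "\<lambda>y. ennreal (exp (- lam * y))"] unfolding Laplace_transform_L_later[OF s that S] * by simp
  qed
  have le1: "(\<integral>\<^sup>+\<omega>. indicator S (B s \<omega>, L s \<omega>) \<partial>M) \<le> 1"
  proof -
    have "(\<integral>\<^sup>+\<omega>. indicator S (B s \<omega>, L s \<omega>) \<partial>M) \<le> (\<integral>\<^sup>+\<omega>. 1 \<partial>M)"
      by (rule nn_integral_mono) (auto split: split_indicator)
    then show ?thesis by (simp add: emeasure_space_1)
  qed
  have "distr (density M (\<lambda>\<omega>. indicator S (B s \<omega>, L s \<omega>))) borel (L t) = distr N borel X"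
  proof (rule distr_eqI_Laplace)
    show "finite_measure (density M (\<lambda>\<omega>. indicator S (B s \<omega>, L s \<omega>)))"
      using le1 by (intro finite_measureI) (auto simp: emeasure_density top_unique)
    \<comment> \<open>The identity of the transforms at \<open>lam = 0\<close> identifies the mass
      of \<open>N\<close> with a probability.\<close>
    have "emeasure N (space N) \<le> 1"
      using Lap[of 0] le1 by simp
    then show "finite_measure N" by (intro finite_measureI) (auto simp: top_unique)
    show "AE \<omega> in density M (\<lambda>\<omega>. indicator S (B s \<omega>, L s \<omega>)). 0 \<le> L t \<omega>"
      using L_nonneg_AE[of t] s by (simp add: AE_density) (auto elim: eventually_mono)
    show "AE p in N. 0 \<le> X p" unfolding N_def X_def
      by (simp add: AE_density indicator_def)
    show "(\<integral>\<^sup>+\<omega>. ennreal (exp (- real n * L t \<omega>)) \<partial>density M (\<lambda>\<omega>. indicator S (B s \<omega>, L s \<omega>))) = (\<integral>\<^sup>+p. ennreal (exp (- real n * X p)) \<partial>N)" for n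
      using Lap[of "real n"] by (simp add: nn_integral_density)
  qed simp_all
  then have "emeasure (distr (density M (\<lambda>\<omega>. indicator S (B s \<omega>, L s \<omega>))) borel (L t)) {..1} = emeasure (distr N borel X) {..1}"
    by simp
  then have "(\<integral>\<^sup>+\<omega>. indicator S (B s \<omega>, L s \<omega>) * indicator {..1} (L t \<omega>) \<partial>M) = (\<integral>\<^sup>+p. indicator {..1} (X p) \<partial>N)"
    by (subst (asm) (1 2) emeasure_distr_eq_nn_integral) (simp_all add: nn_integral_density)
  then show ?thesis by (simp add: nn_N)
qed

text \<open>The remaining local time \<open>1 - l\<close> is exhausted after a time distributed as the first hitting time
  of the level \<open>\<bar>x\<bar> + 1 - l\<close>.\<close>

lemma law_L_later:
  assumes s: "0 < s" "s \<le> t" and S [measurable]: "S \<in> sets (borel \<Otimes>\<^sub>M borel)"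
  shows "(\<integral>\<^sup>+\<omega>. indicator S (B s \<omega>, L s \<omega>) * indicator {..1} (L t \<omega>) \<partial>M) =
    (\<integral>\<^sup>+x. (\<integral>\<^sup>+l\<in>{0..<1}. ennreal (hit s (\<bar>x\<bar> + l)) * (indicator S (x, l) *
      (\<integral>\<^sup>+r\<in>{0<..}. ennreal (hit r (\<bar>x\<bar> + 1 - l)) * indicator {t - s..} r \<partial>lborel)) \<partial>lborel) \<partial>lborel)"
proof (cases "s < t")
  case True
  \<comment> \<open>For \<open>0 \<le> l < 1\<close> the condition reads
    \<open>\<bar>z\<bar> \<le> \<bar>x\<bar> + 1 - l\<close>, whose probability is the tail of a
    hitting time; for \<open>l > 1\<close> it cannot hold. The point \<open>l = 1\<close> is
    null.\<close>
  have *: "(\<integral>\<^sup>+z. ennreal (heat (t - s) z) * indicator {..1} (l + max 0 (\<bar>z\<bar> - \<bar>x\<bar>)) \<partial>lborel) * indicator {0..} l =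
     (\<integral>\<^sup>+r\<in>{0<..}. ennreal (hit r (\<bar>x\<bar> + 1 - l)) * indicator {t - s..} r \<partial>lborel) * indicator {0..<1} l" if "l \<noteq> 1" for x l :: real
  proof -
    consider "l < 0" | "1 < l" | "0 \<le> l" "l < 1" using \<open>l \<noteq> 1\<close> by linarith
    then show ?thesis
    proof cases
      case 2
      then have "indicator {..1} (l + max 0 (\<bar>z\<bar> - \<bar>x\<bar>)) = (0 :: ennreal)" for z by (auto split: split_indicator)
      then show ?thesis using 2 by simp
    next
      case 3
      have "indicator {..1} (l + max 0 (\<bar>z\<bar> - \<bar>x\<bar>)) = (indicator {- (\<bar>x\<bar> + 1 - l)..\<bar>x\<bar> + 1 - l} z :: ennreal)" for z
        using 3 by (auto split: split_indicator)
      then show ?thesis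
        using nn_integral_hit_time[of "\<bar>x\<bar> + 1 - l" "t - s"] 3 True by simp
    qed simp
  qed
  show ?thesis
    unfolding law_L_later_less[OF s(1) True S]
  proof (rule nn_integral_cong, rule nn_integral_cong_AE, rule eventually_mono[OF AE_lborel_singleton[of 1]])
    fix x l :: real assume "l \<noteq> 1"
    from *[OF this, of x] show "ennreal (hit s (\<bar>x\<bar> + l)) * (indicator S (x, l) *
      (\<integral>\<^sup>+z. ennreal (heat (t - s) z) * indicator {..1} (l + max 0 (\<bar>z\<bar> - \<bar>x\<bar>)) \<partial>lborel)) * indicator {0..} l =
      ennreal (hit s (\<bar>x\<bar> + l)) * (indicator S (x, l) *
      (\<integral>\<^sup>+r\<in>{0<..}. ennreal (hit r (\<bar>x\<bar> + 1 - l)) * indicator {t - s..} r \<partial>lborel)) * indicator {0..<1} l"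
      by (simp only: mult.assoc)
  qed
next
  case False
  \<comment> \<open>At \<open>t = s\<close> there is no heat kernel to integrate; the joint law at
    the single time \<open>s\<close> is used, and the tail of the hitting time from 0 on is
    1.\<close>
  then have ts: "t = s" using s by simp
  have "(\<integral>\<^sup>+\<omega>. indicator S (B s \<omega>, L s \<omega>) * indicator {..1} (L t \<omega>) \<partial>M) =
     (\<integral>\<^sup>+x. (\<integral>\<^sup>+l\<in>{0..}. ennreal (hit s (\<bar>x\<bar> + l)) * (indicator S (x, l) * indicator {..1} l) \<partial>lborel) \<partial>lborel)"
    using joint_law[OF s(1), of "\<lambda>p. indicator S p * indicator {..1} (snd p)"] by (simp add: ts)
  also have "\<dots> = (\<integral>\<^sup>+x. (\<integral>\<^sup>+l\<in>{0..<1}. ennreal (hit s (\<bar>x\<bar> + l)) * (indicator S (x, l) *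
      (\<integral>\<^sup>+r\<in>{0<..}. ennreal (hit r (\<bar>x\<bar> + 1 - l)) * indicator {t - s..} r \<partial>lborel)) \<partial>lborel) \<partial>lborel)"
  proof (rule nn_integral_cong, rule nn_integral_cong_AE, rule eventually_mono[OF AE_lborel_singleton[of 1]])
    fix x l :: real assume "l \<noteq> 1"
    moreover have "(\<integral>\<^sup>+r\<in>{0<..}. ennreal (hit r (\<bar>x\<bar> + 1 - l)) * indicator {t - s..} r \<partial>lborel) = 1" if "l < 1"
      using nn_integral_hit_time[of "\<bar>x\<bar> + 1 - l" 0] that by (simp add: ts)
    ultimately show "ennreal (hit s (\<bar>x\<bar> + l)) * (indicator S (x, l) * indicator {..1} l) * indicator {0..} l =
      ennreal (hit s (\<bar>x\<bar> + l)) * (indicator S (x, l) *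
      (\<integral>\<^sup>+r\<in>{0<..}. ennreal (hit r (\<bar>x\<bar> + 1 - l)) * indicator {t - s..} r \<partial>lborel)) * indicator {0..<1} l"
      by (auto split: split_indicator)
  qed
  finally show ?thesis .
qed

section \<open>Finiteness of the inverse local time and its level sets\<close>

text \<open>The density of \<open>L (real n)\<close> is at most \<open>2 * heat (real n) 0\<close>,
  so that \<open>L (real n) \<le> 1\<close> has probability of order
  \<open>1 / sqrt (real n)\<close>. This makes the set in the definition of
  \<open>inverse_local_time\<close> nonempty almost surely.\<close>

lemma L_unbounded_AE: "AE \<omega> in M. \<exists>n. L (real n) \<omega> > 1"
proof -
  have bound: "emeasure M {\<omega>\<in>space M. \<forall>n. L (real n) \<omega> \<le> 1} \<le> ennreal (2 / sqrt (real n))" if n: "0 < n" for n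
  proof -
    have "emeasure M {\<omega>\<in>space M. \<forall>n. L (real n) \<omega> \<le> 1} \<le> emeasure M {\<omega>\<in>space M. L (real n) \<omega> \<le> 1}"
      by (rule emeasure_mono) auto
    also have "\<dots> = (\<integral>\<^sup>+\<omega>. indicator {..1} (L (real n) \<omega>) \<partial>M)"
      by (subst nn_integral_indicator[symmetric], simp, rule nn_integral_cong) (auto split: split_indicator)
    also have "\<dots> = (\<integral>\<^sup>+x. (\<integral>\<^sup>+l\<in>{0..}. ennreal (hit (real n) (\<bar>x\<bar> + l)) * indicator {..1} l \<partial>lborel) \<partial>lborel)"
      using joint_law[of "real n" "\<lambda>p. indicator {..1} (snd p)"] n by simp
    also have "\<dots> = (\<integral>\<^sup>+l. (\<integral>\<^sup>+x. ennreal (hit (real n) (\<bar>x\<bar> + l)) * indicator {..1} l * indicator {0..} l \<partial>lborel) \<partial>lborel)"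
      by (rule lborel_pair.Fubini') measurable
    also have "\<dots> \<le> (\<integral>\<^sup>+(l::real). ennreal (2 * heat (real n) 0) * indicator {0..1} l \<partial>lborel)"
    proof (rule nn_integral_mono)
      fix l :: real
      show "(\<integral>\<^sup>+x. ennreal (hit (real n) (\<bar>x\<bar> + l)) * indicator {..1} l * indicator {0..} l \<partial>lborel) \<le> ennreal (2 * heat (real n) 0) * indicator {0..1} l"
      proof (cases "l \<in> {0..1}")
        case True
        have "(\<integral>\<^sup>+x. ennreal (hit (real n) (\<bar>x\<bar> + l)) \<partial>lborel) = 2 * (\<integral>\<^sup>+x\<in>{0<..}. ennreal (hit (real n) (\<bar>x\<bar> + l)) \<partial>lborel)"
          by (rule nn_integral_even) auto
        also have "(\<integral>\<^sup>+x\<in>{0<..}. ennreal (hit (real n) (\<bar>x\<bar> + l)) \<partial>lborel) \<le> (\<integral>\<^sup>+x. ennreal (hit (real n) (l + x)) * indicator {l..} (l + x) \<partial>lborel)"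
          by (rule nn_integral_mono) (auto simp: add.commute split: split_indicator)
        also have "\<dots> = (\<integral>\<^sup>+a\<in>{l..}. ennreal (hit (real n) a) \<partial>lborel)"
          by (subst (2) nn_integral_real_affine[of _ 1 l]) auto
        also have "\<dots> = ennreal (heat (real n) l)" by (rule nn_integral_hit_atLeast) (use n True in auto)
        also have "\<dots> \<le> ennreal (heat (real n) 0)" using n by (intro ennreal_leI heat_le) simp
        finally show ?thesis using True by (simp add: mult_left_mono ennreal_mult')
      qed (auto split: split_indicator)
    qed
    also have "\<dots> = ennreal (2 * heat (real n) 0)" by (simp add: nn_integral_cmult)
    also have "\<dots> \<le> ennreal (2 / sqrt (real n))"
      using n pi_gt3 by (intro ennreal_leI) (auto simp: heat_def intro!: divide_left_mono)
    finally show ?thesis .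
  qed
  have "(\<lambda>n. ennreal (2 / sqrt (real (Suc n)))) \<longlonglongrightarrow> ennreal 0"
    by (intro tendsto_ennrealI) real_asymp
  then have "emeasure M {\<omega>\<in>space M. \<forall>n. L (real n) \<omega> \<le> 1} \<le> ennreal 0"
    by (rule LIMSEQ_le_const) (use bound in blast)
  then have "emeasure M {\<omega>\<in>space M. \<forall>n. L (real n) \<omega> \<le> 1} = 0" by simp
  then have "{\<omega>\<in>space M. \<not> (\<exists>n. L (real n) \<omega> > 1)} \<in> null_sets M"
    by (intro null_setsI) (simp_all add: not_less)
  then show ?thesis by (rule AE_I'[where P="\<lambda>\<omega>. \<exists>n. L (real n) \<omega> > 1"]) auto
qed

text \<open>Turns statements about the inverse local time into statements about \<open>L\<close> at
  fixed times. The infimum is over times with \<open>L t > 1\<close>, and by continuity the value at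
  the infimum itself is still at most 1.\<close>

lemma inverse_local_time_AE:
  "AE \<omega> in M. 0 < inverse_local_time L 1 \<omega> \<and> (\<forall>t\<ge>0. t \<le> inverse_local_time L 1 \<omega> \<longleftrightarrow> L t \<omega> \<le> 1)"
  using L_unbounded_AE L_mono_AE
proof eventually_elim
  case (elim \<omega>)
  let ?S = "{t. 0 \<le> t \<and> L t \<omega> > 1}"
  obtain n where n: "L (real n) \<omega> > 1" using elim(1) by blast
  have L0: "L 0 \<omega> = 0" and mono: "\<And>s t. 0 \<le> s \<Longrightarrow> s \<le> t \<Longrightarrow> L s \<omega> \<le> L t \<omega>" using elim(2) by auto
  have ne: "?S \<noteq> {}" using n by (auto intro!: exI[of _ "real n"])
  have bdd: "bdd_below ?S" by (rule bdd_belowI[of _ 0]) simp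
  have cont: "isCont (\<lambda>t. L t \<omega>) t" for t
    using L_continuous[of \<omega>] by (simp add: continuous_on_eq_continuous_at)
  have iff: "t \<le> Inf ?S \<longleftrightarrow> L t \<omega> \<le> 1" if t: "0 \<le> t" for t
  proof
    assume "L t \<omega> \<le> 1"
    then have "t \<le> q" if "q \<in> ?S" for q using mono[of q t] that by (cases "t \<le> q") auto
    then show "t \<le> Inf ?S" by (rule cInf_greatest[OF ne])
  next
    assume le: "t \<le> Inf ?S"
    have below: "L q \<omega> \<le> 1" if "0 \<le> q" "q < t" for q
    proof (rule ccontr)
      assume "\<not> L q \<omega> \<le> 1"
      then have "Inf ?S \<le> q" using that by (intro cInf_lower[OF _ bdd]) simp
      with le that show False by simp
    qed
    show "L t \<omega> \<le> 1"
    proof (cases "t = 0")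
      case False
      \<comment> \<open>Approach from the left: strictly before the infimum \<open>L\<close> cannot
        exceed 1.\<close>
      have "(\<lambda>n. t * (1 - 1 / real (Suc n))) \<longlonglongrightarrow> t * (1 - 0)"
        by (intro tendsto_intros LIMSEQ_Suc[OF lim_1_over_n])
      then have "(\<lambda>n. L (t * (1 - 1 / real (Suc n))) \<omega>) \<longlonglongrightarrow> L t \<omega>"
        by (intro isCont_tendsto_compose[OF cont]) simp
      moreover have "L (t * (1 - 1 / real (Suc n))) \<omega> \<le> 1" for n
        using t False by (intro below) (auto simp: mult_less_cancel_left1)
      ultimately show ?thesis by (intro LIMSEQ_le_const2) auto
    qed (simp add: L0)
  qed
  have "(\<lambda>n. L (1 / real (Suc n)) \<omega>) \<longlonglongrightarrow> L 0 \<omega>"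
    by (rule isCont_tendsto_compose[OF cont LIMSEQ_Suc[OF lim_1_over_n]])
  then have "\<forall>\<^sub>F n in sequentially. L (1 / real (Suc n)) \<omega> < 1"
    by (rule order_tendstoD) (simp add: L0)
  then obtain k where "L (1 / real (Suc k)) \<omega> < 1" by (auto dest: eventually_happens)
  then have "1 / real (Suc k) \<le> Inf ?S" by (subst iff) auto
  moreover have "0 < 1 / real (Suc k)" by simp
  ultimately have "0 < Inf ?S" by linarith
  then show ?case unfolding inverse_local_time_def using iff by blast
qed

end

section \<open>The inverse local time\<close>

text \<open>The local time is at most \<open>1\<close> exactly on \<open>[0, \<tau>\<^sub>1]\<close>, so the Lebesgue measure of these times is \<open>\<tau>\<^sub>1\<close>.
  Unlike the infimum this is visibly a measurable function of the path.\<close>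

definition path_inverse_local_time :: "(real \<Rightarrow> real) \<Rightarrow> real" where
  "path_inverse_local_time w = enn2real (\<integral>\<^sup>+s\<in>{0..}. indicator {..1} (path_local_time w s) \<partial>lborel)"

lemma path_inverse_local_time_measurable [measurable]:
  "path_inverse_local_time \<in> borel_measurable path_algebra"
  unfolding path_inverse_local_time_def by measurable

context BM_local_time
begin

text \<open>A version of the inverse local time that is a measurable function of the path; hence the
  path and \<open>T\<close> together are independent of any \<open>U\<close> that is independent of
  the process.\<close>

definition T :: "'a \<Rightarrow> real" where
  "T \<omega> = path_inverse_local_time (process_map B \<omega>)"

lemma process_map_measurable [measurable]: "process_map B \<in> measurable M path_algebra"
  unfolding process_map_def by (rule measurable_restrict) measurable

lemma T_measurable [measurable]: "T \<in> borel_measurable M"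
  unfolding T_def by measurable

lemma path_eval_process_map: "0 \<le> t \<Longrightarrow> path_eval (process_map B \<omega>) t = B t \<omega>"
  unfolding process_map_def by (rule path_eval_restrict) (rule B_continuous)

lemma path_local_time_process_map_AE: "AE \<omega> in M. \<forall>t\<ge>0. path_local_time (process_map B \<omega>) t = L t \<omega>"
  using L_limit
proof eventually_elim
  case (elim \<omega>)
  have "occupation e (path_eval (process_map B \<omega>)) 0 t = occupation e (\<lambda>q. B q \<omega>) 0 t" for e t
    by (rule occupation_cong) (simp add: path_eval_process_map)
  then show ?case unfolding path_local_time_def using elim by (simp add: limI)
qed

lemma T_AE:
  "AE \<omega> in M. T \<omega> = inverse_local_time L 1 \<omega> \<and> 0 < T \<omega> \<and> (\<forall>t\<ge>0. t \<le> T \<omega> \<longleftrightarrow> L t \<omega> \<le> 1)"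
  using path_local_time_process_map_AE inverse_local_time_AE
proof eventually_elim
  case (elim \<omega>)
  let ?\<tau> = "inverse_local_time L 1 \<omega>"
  have "(\<integral>\<^sup>+s\<in>{0..}. indicator {..1} (path_local_time (process_map B \<omega>) s) \<partial>lborel) = (\<integral>\<^sup>+s. indicator {0..?\<tau>} s \<partial>lborel)"
    by (rule nn_integral_cong) (use elim in \<open>auto split: split_indicator\<close>)
  also have "\<dots> = ennreal ?\<tau>"
  proof -
    have "0 \<le> ?\<tau>" using elim by (intro less_imp_le) blast
    then show ?thesis by simp
  qed
  finally have "T \<omega> = ?\<tau>" using elim by (simp add: T_def path_inverse_local_time_def)
  then show ?case using elim by simp
qed

text \<open>For \<open>s \<le> T\<close> the event \<open>t \<le> T\<close> is
  \<open>L (max s t) \<le> 1\<close>, so \<open>law_L_later\<close> gives the law on all sets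
  \<open>S \<times> {t..}\<close>, and these determine it.\<close>

lemma law_B_L_T:
  assumes s: "0 < s" and f [measurable]: "f \<in> borel_measurable ((borel \<Otimes>\<^sub>M borel) \<Otimes>\<^sub>M borel)"
  shows "(\<integral>\<^sup>+\<omega>. f ((B s \<omega>, L s \<omega>), T \<omega>) * indicator {s..} (T \<omega>) \<partial>M) =
    (\<integral>\<^sup>+x. (\<integral>\<^sup>+l\<in>{0..<1}. (\<integral>\<^sup>+t\<in>{s<..}. ennreal (hit s (\<bar>x\<bar> + l)) * (ennreal (hit (t - s) (\<bar>x\<bar> + 1 - l)) * f ((x, l), t)) \<partial>lborel) \<partial>lborel) \<partial>lborel)"
proof -
  let ?Z = "\<lambda>\<omega>. ((B s \<omega>, L s \<omega>), T \<omega>)"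
  define N1 where "N1 = distr (density M (\<lambda>\<omega>. indicator {s..} (T \<omega>))) ((borel \<Otimes>\<^sub>M borel) \<Otimes>\<^sub>M borel) ?Z"
  let ?g = "\<lambda>p :: (real \<times> real) \<times> real. ennreal (hit s (\<bar>fst (fst p)\<bar> + snd (fst p))) *
     ennreal (hit (snd p - s) (\<bar>fst (fst p)\<bar> + 1 - snd (fst p))) * indicator {s<..} (snd p) * indicator {0..<1} (snd (fst p))"
  define N2 where "N2 = density ((lborel \<Otimes>\<^sub>M lborel) \<Otimes>\<^sub>M lborel) ?g"
  have sets_N1: "sets N1 = sets ((borel \<Otimes>\<^sub>M borel) \<Otimes>\<^sub>M borel)" by (simp add: N1_def)
  have sets_N2 [measurable_cong]: "sets N2 = sets ((borel \<Otimes>\<^sub>M borel) \<Otimes>\<^sub>M borel)"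
    by (simp add: N2_def cong: sets_pair_measure_cong)
  have nn_N1: "(\<integral>\<^sup>+p. h p \<partial>N1) = (\<integral>\<^sup>+\<omega>. h (?Z \<omega>) * indicator {s..} (T \<omega>) \<partial>M)"
    if [measurable]: "h \<in> borel_measurable ((borel \<Otimes>\<^sub>M borel) \<Otimes>\<^sub>M borel)" for h
    unfolding N1_def by (subst nn_integral_distr) (simp_all add: nn_integral_density mult.commute)
  have nn_N2: "(\<integral>\<^sup>+p. h p \<partial>N2) = (\<integral>\<^sup>+x. (\<integral>\<^sup>+l\<in>{0..<1}. (\<integral>\<^sup>+t\<in>{s<..}. ennreal (hit s (\<bar>x\<bar> + l)) * (ennreal (hit (t - s) (\<bar>x\<bar> + 1 - l)) * h ((x, l), t)) \<partial>lborel) \<partial>lborel) \<partial>lborel)"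
    if [measurable]: "h \<in> borel_measurable ((borel \<Otimes>\<^sub>M borel) \<Otimes>\<^sub>M borel)" for h
  proof -
    have [measurable]: "h \<in> borel_measurable ((lborel \<Otimes>\<^sub>M lborel) \<Otimes>\<^sub>M lborel)"
      using that by (simp cong: measurable_cong_sets sets_pair_measure_cong)
    have "(\<integral>\<^sup>+p. h p \<partial>N2) = (\<integral>\<^sup>+x. (\<integral>\<^sup>+l. (\<integral>\<^sup>+t. ?g ((x, l), t) * h ((x, l), t) \<partial>lborel) \<partial>lborel) \<partial>lborel)"
      unfolding N2_def
      by (subst nn_integral_density) (simp_all add: lborel.nn_integral_fst[symmetric])
    also have "\<dots> = (\<integral>\<^sup>+x. (\<integral>\<^sup>+l. (\<integral>\<^sup>+t. (ennreal (hit s (\<bar>x\<bar> + l)) * (ennreal (hit (t - s) (\<bar>x\<bar> + 1 - l)) * h ((x, l), t)) * indicator {s<..} t) * indicator {0..<1} l \<partial>lborel) \<partial>lborel) \<partial>lborel)"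
      by (intro nn_integral_cong) (simp add: ac_simps)
    also have "\<dots> = (\<integral>\<^sup>+x. (\<integral>\<^sup>+l\<in>{0..<1}. (\<integral>\<^sup>+t\<in>{s<..}. ennreal (hit s (\<bar>x\<bar> + l)) * (ennreal (hit (t - s) (\<bar>x\<bar> + 1 - l)) * h ((x, l), t)) \<partial>lborel) \<partial>lborel) \<partial>lborel)"
      by (rule nn_integral_cong, rule nn_integral_cong, rule nn_integral_multc) measurable
    finally show ?thesis .
  qed
  have key: "(\<integral>\<^sup>+p. indicator S (fst p) * indicator {t..} (snd p) \<partial>N1) = (\<integral>\<^sup>+p. indicator S (fst p) * indicator {t..} (snd p) \<partial>N2)"
    if S [measurable]: "S \<in> sets (borel \<Otimes>\<^sub>M borel)" for S t
  proof -
    have "(\<integral>\<^sup>+p. indicator S (fst p) * indicator {t..} (snd p) \<partial>N1) =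
        (\<integral>\<^sup>+\<omega>. indicator S (fst (?Z \<omega>)) * indicator {t..} (snd (?Z \<omega>)) * indicator {s..} (T \<omega>) \<partial>M)"
      by (rule nn_N1) measurable
    also have "\<dots> = (\<integral>\<^sup>+\<omega>. indicator S (B s \<omega>, L s \<omega>) * indicator {..1} (L (max s t) \<omega>) \<partial>M)"
    proof (rule nn_integral_cong_AE)
      show "AE \<omega> in M. indicator S (fst (?Z \<omega>)) * indicator {t..} (snd (?Z \<omega>)) * indicator {s..} (T \<omega>) =
          (indicator S (B s \<omega>, L s \<omega>) * indicator {..1} (L (max s t) \<omega>) :: ennreal)"
        using T_AE
      proof eventually_elim
        case (elim \<omega>)
        have "0 \<le> max s t" using s by simp
        with elim have "max s t \<le> T \<omega> \<longleftrightarrow> L (max s t) \<omega> \<le> 1" by blast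
        then have "indicator {t..} (T \<omega>) * indicator {s..} (T \<omega>) = (indicator {..1} (L (max s t) \<omega>) :: ennreal)"
          by (auto simp: indicator_def)
        then show ?case by (simp only: mult.assoc fst_conv snd_conv)
      qed
    qed
    also have "\<dots> = (\<integral>\<^sup>+x. (\<integral>\<^sup>+l\<in>{0..<1}. ennreal (hit s (\<bar>x\<bar> + l)) * (indicator S (x, l) *
      (\<integral>\<^sup>+r\<in>{0<..}. ennreal (hit r (\<bar>x\<bar> + 1 - l)) * indicator {max s t - s..} r \<partial>lborel)) \<partial>lborel) \<partial>lborel)"
      by (rule law_L_later[OF s _ S]) simp
    also have "\<dots> = (\<integral>\<^sup>+x. (\<integral>\<^sup>+l\<in>{0..<1}. (\<integral>\<^sup>+t'\<in>{s<..}. ennreal (hit s (\<bar>x\<bar> + l)) * (ennreal (hit (t' - s) (\<bar>x\<bar> + 1 - l)) *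
        (indicator S (fst ((x, l), t')) * indicator {t..} (snd ((x, l), t')))) \<partial>lborel) \<partial>lborel) \<partial>lborel)"
    proof (rule nn_integral_cong, rule nn_integral_cong)
      fix x l :: real
      have "(\<integral>\<^sup>+r\<in>{0<..}. ennreal (hit r (\<bar>x\<bar> + 1 - l)) * indicator {max s t - s..} r \<partial>lborel) =
         (\<integral>\<^sup>+r. ennreal (hit (s + r - s) (\<bar>x\<bar> + 1 - l)) * indicator {t..} (s + r) * indicator {s<..} (s + r) \<partial>lborel)"
        by (rule nn_integral_cong) (auto split: split_indicator)
      also have "\<dots> = (\<integral>\<^sup>+t'. ennreal (hit (t' - s) (\<bar>x\<bar> + 1 - l)) * indicator {t..} t' * indicator {s<..} t' \<partial>lborel)"
        by (subst (2) nn_integral_real_affine[of _ 1 s]) auto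
      finally have *: "(\<integral>\<^sup>+r\<in>{0<..}. ennreal (hit r (\<bar>x\<bar> + 1 - l)) * indicator {max s t - s..} r \<partial>lborel) = \<dots>" .
      show "ennreal (hit s (\<bar>x\<bar> + l)) * (indicator S (x, l) *
        (\<integral>\<^sup>+r\<in>{0<..}. ennreal (hit r (\<bar>x\<bar> + 1 - l)) * indicator {max s t - s..} r \<partial>lborel)) * indicator {0..<1} l =
        (\<integral>\<^sup>+t'\<in>{s<..}. ennreal (hit s (\<bar>x\<bar> + l)) * (ennreal (hit (t' - s) (\<bar>x\<bar> + 1 - l)) * (indicator S (fst ((x, l), t')) * indicator {t..} (snd ((x, l), t')))) \<partial>lborel) * indicator {0..<1} l"
        unfolding *
        by (subst nn_integral_cmult[symmetric], measurable, subst nn_integral_cmult[symmetric], measurable)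
           (simp add: ac_simps)
    qed
    also have "\<dots> = (\<integral>\<^sup>+p. indicator S (fst p) * indicator {t..} (snd p) \<partial>N2)"
      by (rule nn_N2[symmetric]) measurable
    finally show ?thesis .
  qed
  have "emeasure N1 UNIV \<le> 1"
  proof -
    have "emeasure N1 UNIV = (\<integral>\<^sup>+\<omega>. indicator {s..} (T \<omega>) \<partial>M)"
      using nn_N1[of "\<lambda>_. 1"] by (simp add: N1_def space_pair_measure)
    also have "\<dots> \<le> (\<integral>\<^sup>+\<omega>. 1 \<partial>M)" by (rule nn_integral_mono) (auto split: split_indicator)
    finally show ?thesis by (simp add: emeasure_space_1)
  qed
  then have fin1: "finite_measure N1"
    by (intro finite_measureI) (auto simp: N1_def space_pair_measure top_unique)
  have AE_N1: "AE p in N1. s \<le> snd p"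
    unfolding N1_def by (subst AE_distr_iff) (simp_all add: AE_density indicator_def)
  have AE_N2: "AE p in N2. s \<le> snd p"
    unfolding N2_def by (simp add: AE_density indicator_def)
  \<comment> \<open>Finiteness of \<open>N2\<close> is inherited from \<open>N1\<close> through the
    test set \<open>{s..}\<close>, on which \<open>N2\<close> is concentrated.\<close>
  have "emeasure N2 UNIV = (\<integral>\<^sup>+p. 1 \<partial>N2)"
    by (simp add: N2_def space_pair_measure)
  also have "\<dots> = (\<integral>\<^sup>+p. indicator UNIV (fst p) * indicator {s..} (snd p) \<partial>N2)"
    by (rule nn_integral_cong_AE) (use AE_N2 in eventually_elim, simp)
  also have "\<dots> = (\<integral>\<^sup>+p. indicator UNIV (fst p) * indicator {s..} (snd p) \<partial>N1)"
    using sets.top[of "borel \<Otimes>\<^sub>M borel :: (real \<times> real) measure"]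
    by (intro key[symmetric]) (simp add: space_pair_measure)
  also have "\<dots> \<le> (\<integral>\<^sup>+p. 1 \<partial>N1)" by (rule nn_integral_mono) (auto split: split_indicator)
  also have "\<dots> \<le> 1" using \<open>emeasure N1 UNIV \<le> 1\<close> by (simp add: N1_def space_pair_measure)
  finally have N2_le: "emeasure N2 UNIV \<le> 1" .
  have fin2: "finite_measure N2"
    using N2_le by (intro finite_measureI) (auto simp: N2_def space_pair_measure top_unique)
  have "N1 = N2"
  proof (rule finite_measure_eqI_rectangles[OF fin1 sets_N1 sets_N2])
    fix S D assume S [measurable]: "S \<in> sets (borel \<Otimes>\<^sub>M borel :: (real \<times> real) measure)" and D [measurable]: "D \<in> sets (borel :: real measure)"
    have [measurable]: "snd \<in> borel_measurable N" "fst \<in> measurable N (borel \<Otimes>\<^sub>M borel)" if "sets N = sets ((borel \<Otimes>\<^sub>M borel) \<Otimes>\<^sub>M borel)" for N :: "((real \<times> real) \<times> real) measure"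
      using measurable_fst measurable_snd by (auto simp: measurable_cong_sets[OF that refl])
    have borel_UNIV: "UNIV \<in> sets (borel :: real measure)" by simp
    define R where "R N = distr (density N (\<lambda>p. indicator S (fst p))) borel snd" for N :: "((real \<times> real) \<times> real) measure"
    have R: "emeasure (R N) E = (\<integral>\<^sup>+p. indicator S (fst p) * indicator E (snd p) \<partial>N)"
      if N [measurable_cong]: "sets N = sets ((borel \<Otimes>\<^sub>M borel) \<Otimes>\<^sub>M borel)" and [measurable]: "E \<in> sets borel" for N E
      unfolding R_def by (subst emeasure_distr_eq_nn_integral) (simp_all add: nn_integral_density)
    have finR: "finite_measure (R N)" if N: "sets N = sets ((borel \<Otimes>\<^sub>M borel) \<Otimes>\<^sub>M borel)" "finite_measure N" for N
    proof (rule finite_measureI)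
      have "emeasure (R N) UNIV \<le> (\<integral>\<^sup>+p. 1 \<partial>N)"
        unfolding R[OF N(1) borel_UNIV] by (rule nn_integral_mono) (auto split: split_indicator)
      then show "emeasure (R N) (space (R N)) \<noteq> \<infinity>"
        using finite_measure.finite_emeasure_space[OF N(2)] by (auto simp: R_def top_unique)
    qed
    have "R N1 = R N2"
    proof (rule finite_borel_measure_eqI_atLeast)
      show "emeasure (R N1) {t..} = emeasure (R N2) {t..}" for t
        using key[OF S, of t] by (simp add: R sets_N1 sets_N2)
      have "emeasure (R N) UNIV = emeasure (R N) {s..}"
        if N: "sets N = sets ((borel \<Otimes>\<^sub>M borel) \<Otimes>\<^sub>M borel)" and "AE p in N. s \<le> snd p" for N
        unfolding R[OF N borel_UNIV] R[OF N atLeast_borel]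
        by (rule nn_integral_cong_AE) (use that(2) in eventually_elim, simp)
      from this[OF sets_N1 AE_N1] this[OF sets_N2 AE_N2]
      show "emeasure (R N1) UNIV = emeasure (R N2) UNIV"
        using key[OF S, of s] by (simp add: R sets_N1 sets_N2)
    qed (use finR[OF sets_N1 fin1] finR[OF sets_N2 fin2] in \<open>auto simp: R_def\<close>)
    then have "emeasure (R N1) D = emeasure (R N2) D" by simp
    then have "(\<integral>\<^sup>+p. indicator (S \<times> D) p \<partial>N1) = (\<integral>\<^sup>+p. indicator (S \<times> D) p \<partial>N2)"
      by (simp add: R sets_N1 sets_N2 indicator_times)
    then show "emeasure N1 (S \<times> D) = emeasure N2 (S \<times> D)"
      by (simp add: sets_N1 sets_N2)
  qed
  then show ?thesis using nn_N1[OF f] nn_N2[OF f] by simp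
qed

end

section \<open>The law at the uniform time\<close>

text \<open>Brownian scaling. The factor \<open>1 / t\<close>, the uniform density on
  \<open>[0, t]\<close>, balances the powers of \<open>c\<close>: \<open>1 / (2 * c)\<close> from
  \<open>x\<close>, \<open>2 / c ^ 3\<close> from \<open>t\<close>, and \<open>c\<^sup>2\<close>
  from each of \<open>hit\<close> and \<open>1 / t\<close> multiply to 1.\<close>

lemma nn_integral_hit_rescale:
  assumes [measurable]: "f \<in> borel_measurable (borel \<Otimes>\<^sub>M borel)"
  shows "(\<integral>\<^sup>+x. (\<integral>\<^sup>+t\<in>{0<..}. ennreal (hit t (2 * \<bar>x\<bar> + 1)) * (ennreal (1 / t) * f (x / sqrt t, 1 / sqrt t)) \<partial>lborel) \<partial>lborel) =
    (\<integral>\<^sup>+y. (\<integral>\<^sup>+c\<in>{0..}. ennreal (hit 1 (\<bar>y\<bar> + c)) * f (y / 2, c) \<partial>lborel) \<partial>lborel)"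
proof -
  let ?F = "\<lambda>x t. ennreal (hit t (2 * \<bar>x\<bar> + 1)) * (ennreal (1 / t) * f (x / sqrt t, 1 / sqrt t))"
  let ?K = "\<lambda>x c. ?F x (1 / c\<^sup>2) * ennreal (2 / c ^ 3) * indicator {0<..} c"
  have img: "(\<lambda>c. 1 / c\<^sup>2) ` {0<..} = {0::real<..}"
  proof safe
    fix y :: real assume "0 < y"
    then show "y \<in> (\<lambda>c. 1 / c\<^sup>2) ` {0<..}"
      by (intro image_eqI[of _ _ "1 / sqrt y"]) (auto simp: power_divide)
  qed auto
  have sub: "(\<integral>\<^sup>+t\<in>{0<..}. ?F x t \<partial>lborel) = (\<integral>\<^sup>+c. ?K x c \<partial>lborel)" for x
  proof -
    have "(\<integral>\<^sup>+t. ?F x t * indicator ((\<lambda>c. 1 / c\<^sup>2) ` {0<..}) t \<partial>lborel) = (\<integral>\<^sup>+c. ?K x c \<partial>lborel)"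
    proof (rule nn_integral_substitution_greaterThan_antimono)
      show "((\<lambda>c. 1 / c\<^sup>2) has_real_derivative - (2 / c ^ 3)) (at c)" if "0 < c" for c :: real
        using that by (auto intro!: derivative_eq_intros simp: power2_eq_square power3_eq_cube field_simps)
      show "continuous_on {0<..} (\<lambda>c::real. 2 / c ^ 3)"
        by (intro continuous_intros) auto
    qed (simp_all add: img)
    then show ?thesis by (simp only: img)
  qed
  have "(\<integral>\<^sup>+x. (\<integral>\<^sup>+t\<in>{0<..}. ?F x t \<partial>lborel) \<partial>lborel) = (\<integral>\<^sup>+x. (\<integral>\<^sup>+c. ?K x c \<partial>lborel) \<partial>lborel)"
    by (simp only: sub)
  also have "\<dots> = (\<integral>\<^sup>+c. (\<integral>\<^sup>+x. ?K x c \<partial>lborel) \<partial>lborel)"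
    by (rule lborel_pair.Fubini') measurable
  also have "\<dots> = (\<integral>\<^sup>+c. (\<integral>\<^sup>+y. ennreal (hit 1 (\<bar>y\<bar> + c)) * f (y / 2, c) * indicator {0..} c \<partial>lborel) \<partial>lborel)"
  proof (rule nn_integral_cong_AE, rule eventually_mono[OF AE_lborel_singleton[of 0]])
    fix c :: real assume "c \<noteq> 0"
    show "(\<integral>\<^sup>+x. ?K x c \<partial>lborel) = (\<integral>\<^sup>+y. ennreal (hit 1 (\<bar>y\<bar> + c)) * f (y / 2, c) * indicator {0..} c \<partial>lborel)"
    proof (cases "0 < c")
      case c: True
      have "(\<integral>\<^sup>+x. ?K x c \<partial>lborel) = ennreal (1 / (2 * c)) * (\<integral>\<^sup>+y. ?K (0 + 1 / (2 * c) * y) c \<partial>lborel)"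
        using c by (subst nn_integral_real_affine[of _ "1 / (2 * c)" 0]) auto
      also have "\<dots> = (\<integral>\<^sup>+y. ennreal (1 / (2 * c)) * ?K (0 + 1 / (2 * c) * y) c \<partial>lborel)"
        by (rule nn_integral_cmult[symmetric]) measurable
      also have "\<dots> = (\<integral>\<^sup>+y. ennreal (hit 1 (\<bar>y\<bar> + c)) * f (y / 2, c) * indicator {0..} c \<partial>lborel)"
      proof (rule nn_integral_cong)
        fix y :: real
        have sq: "sqrt (1 / c\<^sup>2) = 1 / c" using c by (simp add: real_sqrt_divide)
        have arg: "2 * \<bar>0 + 1 / (2 * c) * y\<bar> + 1 = (\<bar>y\<bar> + c) / c"
          using c by (simp add: abs_mult field_simps)
        have heat: "heat (1 / c\<^sup>2) ((\<bar>y\<bar> + c) / c) = c * heat 1 (\<bar>y\<bar> + c)"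
        proof -
          have "sqrt (2 * pi * (1 / c\<^sup>2)) = sqrt (2 * pi) / c" using c by (simp add: real_sqrt_divide)
          moreover have "- (((\<bar>y\<bar> + c) / c)\<^sup>2) / (2 * (1 / c\<^sup>2)) = - ((\<bar>y\<bar> + c)\<^sup>2) / (2 * 1)"
            using c by (simp add: power_divide)
          ultimately show ?thesis unfolding heat_def by simp
        qed
        have h: "hit (1 / c\<^sup>2) ((\<bar>y\<bar> + c) / c) = c\<^sup>2 * hit 1 (\<bar>y\<bar> + c)"
          unfolding hit_def heat using c by (simp add: power2_eq_square)
        have coef: "1 / (2 * c) * (c\<^sup>2 * hit 1 (\<bar>y\<bar> + c) * (1 / (1 / c\<^sup>2)) * (2 / c ^ 3)) = hit 1 (\<bar>y\<bar> + c)"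
          using c by (simp add: power2_eq_square power3_eq_cube)
        have hn: "0 \<le> hit 1 (\<bar>y\<bar> + c)" using c by simp
        have "ennreal (1 / (2 * c)) * ?K (0 + 1 / (2 * c) * y) c =
            ennreal (1 / (2 * c) * (c\<^sup>2 * hit 1 (\<bar>y\<bar> + c) * (1 / (1 / c\<^sup>2)) * (2 / c ^ 3))) * f (y / 2, c)"
        proof -
          have E: "ennreal a * (ennreal b * (ennreal t * z) * ennreal d) = ennreal (a * (b * t * d)) * z"
            if "0 \<le> a" "0 \<le> b" "0 \<le> t" "0 \<le> d" for a b t d z
            using that by (simp add: ennreal_mult ac_simps)
          have arg': "(0 + 1 / (2 * c) * y) / (1 / c) = y / 2" "1 / (1 / c) = c" "indicator {0<..} c = (1 :: ennreal)"
            using c by auto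
          show ?thesis
            unfolding arg h sq arg' mult_1_right using c hn by (intro E) auto
        qed
        then show "ennreal (1 / (2 * c)) * ?K (0 + 1 / (2 * c) * y) c = ennreal (hit 1 (\<bar>y\<bar> + c)) * f (y / 2, c) * indicator {0..} c"
          unfolding coef using c by simp
      qed
      finally show ?thesis .
    qed (use \<open>c \<noteq> 0\<close> in simp)
  qed
  also have "\<dots> = (\<integral>\<^sup>+y. (\<integral>\<^sup>+c. ennreal (hit 1 (\<bar>y\<bar> + c)) * f (y / 2, c) * indicator {0..} c \<partial>lborel) \<partial>lborel)"
    by (rule lborel_pair.Fubini') measurable
  finally show ?thesis .
qed

text \<open>\<open>s\<close> is made the innermost variable, where it occurs only in the convolution
  of two passage densities.\<close>

lemma nn_integral_hit_hit:
  assumes f [measurable]: "f \<in> borel_measurable (borel \<Otimes>\<^sub>M (borel \<Otimes>\<^sub>M borel))"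
  shows "(\<integral>\<^sup>+s\<in>{0<..}. (\<integral>\<^sup>+x. (\<integral>\<^sup>+l\<in>{0..<1}. (\<integral>\<^sup>+t\<in>{s<..}. ennreal (hit s (\<bar>x\<bar> + l)) *
      (ennreal (hit (t - s) (\<bar>x\<bar> + 1 - l)) * f (x, l, t)) \<partial>lborel) \<partial>lborel) \<partial>lborel) \<partial>lborel) =
    (\<integral>\<^sup>+x. (\<integral>\<^sup>+l\<in>{0..<1}. (\<integral>\<^sup>+t\<in>{0<..}. ennreal (hit t (2 * \<bar>x\<bar> + 1)) * f (x, l, t) \<partial>lborel) \<partial>lborel) \<partial>lborel)"
proof -
  let ?h = "\<lambda>s x l t. ennreal (hit s (\<bar>x\<bar> + l) * hit (t - s) (\<bar>x\<bar> + 1 - l)) * indicator {0<..} s * indicator {0<..} (t - s)"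
  let ?K = "\<lambda>s x l t. ?h s x l t * f (x, l, t) * indicator {0..<1} l"
  have [measurable]: "f \<in> borel_measurable (lborel \<Otimes>\<^sub>M (lborel \<Otimes>\<^sub>M lborel))"
    using f by (simp cong: measurable_cong_sets sets_pair_measure_cong)
  have "(\<integral>\<^sup>+s\<in>{0<..}. (\<integral>\<^sup>+x. (\<integral>\<^sup>+l\<in>{0..<1}. (\<integral>\<^sup>+t\<in>{s<..}. ennreal (hit s (\<bar>x\<bar> + l)) *
      (ennreal (hit (t - s) (\<bar>x\<bar> + 1 - l)) * f (x, l, t)) \<partial>lborel) \<partial>lborel) \<partial>lborel) \<partial>lborel)
    = (\<integral>\<^sup>+s. (\<integral>\<^sup>+x. (\<integral>\<^sup>+l. (\<integral>\<^sup>+t. ennreal (hit s (\<bar>x\<bar> + l)) *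
      (ennreal (hit (t - s) (\<bar>x\<bar> + 1 - l)) * f (x, l, t)) * indicator {s<..} t * indicator {0..<1} l * indicator {0<..} s \<partial>lborel) \<partial>lborel) \<partial>lborel) \<partial>lborel)"
    by (simp add: nn_integral_multc)
  also have "\<dots> = (\<integral>\<^sup>+s. (\<integral>\<^sup>+x. (\<integral>\<^sup>+l. (\<integral>\<^sup>+t. ?K s x l t \<partial>lborel) \<partial>lborel) \<partial>lborel) \<partial>lborel)"
    by (intro nn_integral_cong) (auto simp: ennreal_mult' ac_simps split: split_indicator)
  also have "\<dots> = (\<integral>\<^sup>+x. (\<integral>\<^sup>+s. (\<integral>\<^sup>+l. (\<integral>\<^sup>+t. ?K s x l t \<partial>lborel) \<partial>lborel) \<partial>lborel) \<partial>lborel)"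
    by (rule lborel_pair.Fubini') measurable
  also have "\<dots> = (\<integral>\<^sup>+x. (\<integral>\<^sup>+l. (\<integral>\<^sup>+s. (\<integral>\<^sup>+t. ?K s x l t \<partial>lborel) \<partial>lborel) \<partial>lborel) \<partial>lborel)"
    by (rule nn_integral_cong, rule lborel_pair.Fubini') measurable
  also have "\<dots> = (\<integral>\<^sup>+x. (\<integral>\<^sup>+l. (\<integral>\<^sup>+t. (\<integral>\<^sup>+s. ?K s x l t \<partial>lborel) \<partial>lborel) \<partial>lborel) \<partial>lborel)"
    by (rule nn_integral_cong, rule nn_integral_cong, rule lborel_pair.Fubini') measurable
  also have "\<dots> = (\<integral>\<^sup>+x. (\<integral>\<^sup>+l. (\<integral>\<^sup>+t. ennreal (hit t (2 * \<bar>x\<bar> + 1)) * f (x, l, t) * indicator {0<..} t * indicator {0..<1} l \<partial>lborel) \<partial>lborel) \<partial>lborel)"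
  \<comment> \<open>At \<open>x = 0\<close> and \<open>l = 0\<close> the first level vanishes and
    the convolution identity fails.\<close>
  proof (rule nn_integral_cong_AE, rule eventually_mono[OF AE_lborel_singleton[of 0]], rule nn_integral_cong, rule nn_integral_cong)
    fix x l t :: real assume x: "x \<noteq> 0"
    have "(\<integral>\<^sup>+s. ?K s x l t \<partial>lborel) = (\<integral>\<^sup>+s. ?h s x l t \<partial>lborel) * (f (x, l, t) * indicator {0..<1} l)"
      by (subst nn_integral_multc[symmetric]) (auto simp: mult.assoc)
    also have "\<dots> = ennreal (hit t (2 * \<bar>x\<bar> + 1)) * f (x, l, t) * indicator {0<..} t * indicator {0..<1} l"
    proof (cases "l \<in> {0..<1} \<and> 0 < t")
      case True
      have "(\<integral>\<^sup>+s. ?h s x l t \<partial>lborel) = (\<integral>\<^sup>+s\<in>{0<..<t}. ennreal (hit s (\<bar>x\<bar> + l) * hit (t - s) (\<bar>x\<bar> + 1 - l)) \<partial>lborel)"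
        by (rule nn_integral_cong) (auto split: split_indicator)
      also have "\<dots> = ennreal (hit t (\<bar>x\<bar> + l + (\<bar>x\<bar> + 1 - l)))"
        by (rule hit_convolution_hit) (use True x in auto)
      finally show ?thesis using True by (simp add: mult_2[symmetric])
    next
      case False
      then consider "l \<notin> {0..<1}" | "t \<le> 0" by force
      then show ?thesis
      proof cases
        case 2
        have "(\<integral>\<^sup>+s. ?h s x l t \<partial>lborel) = (\<integral>\<^sup>+s. 0 \<partial>(lborel :: real measure))"
          by (rule nn_integral_cong) (use 2 in \<open>auto split: split_indicator\<close>)
        then show ?thesis using 2 by simp
      qed simp
    qed
    finally show "(\<integral>\<^sup>+s. ?K s x l t \<partial>lborel) = \<dots>" .
  qed
  also have "\<dots> = (\<integral>\<^sup>+x. (\<integral>\<^sup>+l\<in>{0..<1}. (\<integral>\<^sup>+t\<in>{0<..}. ennreal (hit t (2 * \<bar>x\<bar> + 1)) * f (x, l, t) \<partial>lborel) \<partial>lborel) \<partial>lborel)"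
    by (simp add: nn_integral_multc)
  finally show ?thesis .
qed

lemma distr_uniform_on_unit_interval:
  assumes "uniform_on_unit_interval M U"
  shows "distr M borel U = density lborel (indicator {0..1})"
proof -
  have "distr M borel U = distr M lborel U" by (rule distr_cong) simp_all
  then show ?thesis
    using assms by (simp add: uniform_on_unit_interval_def distributed_def)
qed

lemma uniform_on_unit_interval_nonneg_AE:
  assumes [measurable]: "U \<in> borel_measurable M" and unif: "uniform_on_unit_interval M U"
  shows "AE \<omega> in M. 0 \<le> U \<omega>"
proof -
  have "AE u in distr M borel U. 0 \<le> u"
    unfolding distr_uniform_on_unit_interval[OF unif] by (simp add: AE_density indicator_def)
  then show ?thesis by (subst (asm) AE_distr_iff) auto
qed

context BM_local_time
begin

lemma law_uniform_time:
  assumes ind: "independent_rvs M path_algebra (process_map B) borel U"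
    and unif: "uniform_on_unit_interval M U"
    and f [measurable]: "f \<in> borel_measurable (borel \<Otimes>\<^sub>M (borel \<Otimes>\<^sub>M borel))"
  shows "(\<integral>\<^sup>+\<omega>. f (B (U \<omega> * T \<omega>) \<omega> / sqrt (T \<omega>), 1 / sqrt (T \<omega>), L (U \<omega> * T \<omega>) \<omega>) \<partial>M) =
    (\<integral>\<^sup>+x. (\<integral>\<^sup>+c\<in>{0..}. (\<integral>\<^sup>+l\<in>{0..1}. ennreal (hit 1 (\<bar>x\<bar> + c)) * f (x / 2, c, l) \<partial>lborel) \<partial>lborel) \<partial>lborel)"
proof -
  have U [measurable]: "U \<in> borel_measurable M" using ind by (simp add: independent_rvs_def)
  \<comment> \<open>Independence concerns the whole path and \<open>U\<close>, so the triple is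
    expressed as a measurable function of these two.\<close>
  define F where "F p = (let \<tau> = path_inverse_local_time (fst p) in
    f (path_eval (fst p) (snd p * \<tau>) / sqrt \<tau>, 1 / sqrt \<tau>, path_local_time (fst p) (snd p * \<tau>)))" for p
  have [measurable]: "F \<in> borel_measurable (path_algebra \<Otimes>\<^sub>M borel)" unfolding F_def Let_def by measurable
  have good: "AE \<omega> in M. 0 < T \<omega> \<and> (\<forall>s\<ge>0. F (process_map B \<omega>, s / T \<omega>) = f (B s \<omega> / sqrt (T \<omega>), 1 / sqrt (T \<omega>), L s \<omega>))"
    using T_AE path_local_time_process_map_AE
  proof eventually_elim
    case (elim \<omega>)
    then show ?case by (simp add: F_def Let_def T_def[symmetric] path_eval_process_map)
  qed
  \<comment> \<open>After \<open>u = s / T \<omega>\<close> the uniform density becomes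
    \<open>1 / T \<omega>\<close> on \<open>0 < s \<le> T \<omega>\<close>; the null set
    \<open>s = 0\<close> is dropped because \<open>(B s, L s)\<close> has no density there.\<close>
  let ?H = "\<lambda>\<omega> s. ennreal (1 / T \<omega>) * f (B s \<omega> / sqrt (T \<omega>), 1 / sqrt (T \<omega>), L s \<omega>) * indicator {0<..} s * indicator {0..} (T \<omega> - s)"
  have "(\<integral>\<^sup>+\<omega>. f (B (U \<omega> * T \<omega>) \<omega> / sqrt (T \<omega>), 1 / sqrt (T \<omega>), L (U \<omega> * T \<omega>) \<omega>) \<partial>M) = (\<integral>\<^sup>+\<omega>. F (process_map B \<omega>, U \<omega>) \<partial>M)"
  proof (rule nn_integral_cong_AE)
    show "AE \<omega> in M. f (B (U \<omega> * T \<omega>) \<omega> / sqrt (T \<omega>), 1 / sqrt (T \<omega>), L (U \<omega> * T \<omega>) \<omega>) = F (process_map B \<omega>, U \<omega>)"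
      using good uniform_on_unit_interval_nonneg_AE[OF U unif]
    proof eventually_elim
      case (elim \<omega>)
      have "0 \<le> U \<omega> * T \<omega>" using elim by simp
      with elim have "F (process_map B \<omega>, (U \<omega> * T \<omega>) / T \<omega>) = f (B (U \<omega> * T \<omega>) \<omega> / sqrt (T \<omega>), 1 / sqrt (T \<omega>), L (U \<omega> * T \<omega>) \<omega>)" by blast
      then show ?case using elim by simp
    qed
  qed
  also have "\<dots> = (\<integral>\<^sup>+\<omega>. (\<integral>\<^sup>+u. F (process_map B \<omega>, u) \<partial>distr M borel U) \<partial>M)"
    by (rule nn_integral_independent_rvs[OF ind]) measurable
  also have "\<dots> = (\<integral>\<^sup>+\<omega>. (\<integral>\<^sup>+s. ?H \<omega> s \<partial>lborel) \<partial>M)"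
  proof (rule nn_integral_cong_AE)
    show "AE \<omega> in M. (\<integral>\<^sup>+u. F (process_map B \<omega>, u) \<partial>distr M borel U) = (\<integral>\<^sup>+s. ?H \<omega> s \<partial>lborel)"
      using good AE_space
    proof eventually_elim
      case (elim \<omega>)
      have T: "0 < T \<omega>" using elim by blast
      have [measurable]: "process_map B \<omega> \<in> space path_algebra"
        using process_map_measurable elim(2) by (rule measurable_space)
      have [measurable]: "(\<lambda>s. f (B s \<omega> / sqrt (T \<omega>), 1 / sqrt (T \<omega>), L s \<omega>)) \<in> borel_measurable borel"
        using B_path_measurable[of \<omega>] borel_measurable_continuous_onI[OF L_continuous[of \<omega>]] by measurable
      have "(\<integral>\<^sup>+u. F (process_map B \<omega>, u) \<partial>distr M borel U) = (\<integral>\<^sup>+u. indicator {0..1} u * F (process_map B \<omega>, u) \<partial>lborel)"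
        unfolding distr_uniform_on_unit_interval[OF unif] by (rule nn_integral_density) measurable
      also have "\<dots> = ennreal (1 / T \<omega>) * (\<integral>\<^sup>+s. indicator {0..1} (0 + 1 / T \<omega> * s) * F (process_map B \<omega>, 0 + 1 / T \<omega> * s) \<partial>lborel)"
        using T by (subst nn_integral_real_affine[of _ "1 / T \<omega>" 0]) auto
      also have "(\<integral>\<^sup>+s. indicator {0..1} (0 + 1 / T \<omega> * s) * F (process_map B \<omega>, 0 + 1 / T \<omega> * s) \<partial>lborel)
          = (\<integral>\<^sup>+s. f (B s \<omega> / sqrt (T \<omega>), 1 / sqrt (T \<omega>), L s \<omega>) * indicator {0<..} s * indicator {0..} (T \<omega> - s) \<partial>lborel)"
      proof (rule nn_integral_cong_AE, rule eventually_mono[OF AE_lborel_singleton[of 0]])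
        fix s :: real assume s: "s \<noteq> 0"
        show "indicator {0..1} (0 + 1 / T \<omega> * s) * F (process_map B \<omega>, 0 + 1 / T \<omega> * s) =
           f (B s \<omega> / sqrt (T \<omega>), 1 / sqrt (T \<omega>), L s \<omega>) * indicator {0<..} s * indicator {0..} (T \<omega> - s)"
        proof (cases "0 \<le> s")
          case True
          then have "F (process_map B \<omega>, 0 + 1 / T \<omega> * s) = f (B s \<omega> / sqrt (T \<omega>), 1 / sqrt (T \<omega>), L s \<omega>)"
            using elim by simp
          moreover have "(0 + 1 / T \<omega> * s \<in> {0..1}) = (0 \<le> T \<omega> - s)" using T True by (simp add: divide_le_eq)
          ultimately show ?thesis using True s by (simp add: indicator_def)
        next
          case False
          then have "0 + 1 / T \<omega> * s \<notin> {0..1}" using T by (simp add: zero_le_divide_iff)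
          then show ?thesis using False by simp
        qed
      qed
      also have "ennreal (1 / T \<omega>) * \<dots> = (\<integral>\<^sup>+s. ?H \<omega> s \<partial>lborel)"
        by (subst nn_integral_cmult[symmetric]) (auto simp: mult.assoc)
      finally show ?case .
    qed
  qed
  also have "\<dots> = (\<integral>\<^sup>+s. (\<integral>\<^sup>+\<omega>. ?H \<omega> s \<partial>M) \<partial>lborel)"
  proof -
    interpret pair_sigma_finite lborel M by unfold_locales
    show ?thesis by (rule Fubini') measurable
  qed
  also have "\<dots> = (\<integral>\<^sup>+s\<in>{0<..}. (\<integral>\<^sup>+x. (\<integral>\<^sup>+l\<in>{0..<1}. (\<integral>\<^sup>+t\<in>{s<..}. ennreal (hit s (\<bar>x\<bar> + l)) *
      (ennreal (hit (t - s) (\<bar>x\<bar> + 1 - l)) * (\<lambda>(x, l, t). ennreal (1 / t) * f (x / sqrt t, 1 / sqrt t, l)) (x, l, t)) \<partial>lborel) \<partial>lborel) \<partial>lborel) \<partial>lborel)"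
  proof (rule nn_integral_cong)
    fix s :: real
    show "(\<integral>\<^sup>+\<omega>. ?H \<omega> s \<partial>M) = (\<integral>\<^sup>+x. (\<integral>\<^sup>+l\<in>{0..<1}. (\<integral>\<^sup>+t\<in>{s<..}. ennreal (hit s (\<bar>x\<bar> + l)) *
      (ennreal (hit (t - s) (\<bar>x\<bar> + 1 - l)) * (\<lambda>(x, l, t). ennreal (1 / t) * f (x / sqrt t, 1 / sqrt t, l)) (x, l, t)) \<partial>lborel) \<partial>lborel) \<partial>lborel) * indicator {0<..} s"
    proof (cases "0 < s")
      case True
      have "(\<integral>\<^sup>+\<omega>. ?H \<omega> s \<partial>M) = (\<integral>\<^sup>+\<omega>. (\<lambda>p. ennreal (1 / snd p) * f (fst (fst p) / sqrt (snd p), 1 / sqrt (snd p), snd (fst p))) ((B s \<omega>, L s \<omega>), T \<omega>) * indicator {s..} (T \<omega>) \<partial>M)"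
        using True by (intro nn_integral_cong) (auto split: split_indicator)
      also have "\<dots> = (\<integral>\<^sup>+x. (\<integral>\<^sup>+l\<in>{0..<1}. (\<integral>\<^sup>+t\<in>{s<..}. ennreal (hit s (\<bar>x\<bar> + l)) * (ennreal (hit (t - s) (\<bar>x\<bar> + 1 - l)) *
          (\<lambda>p. ennreal (1 / snd p) * f (fst (fst p) / sqrt (snd p), 1 / sqrt (snd p), snd (fst p))) ((x, l), t)) \<partial>lborel) \<partial>lborel) \<partial>lborel)"
        by (rule law_B_L_T[OF True]) measurable
      finally show ?thesis using True by simp
    qed simp
  qed
  also have "\<dots> = (\<integral>\<^sup>+x. (\<integral>\<^sup>+l\<in>{0..<1}. (\<integral>\<^sup>+t\<in>{0<..}. ennreal (hit t (2 * \<bar>x\<bar> + 1)) *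
      (\<lambda>(x, l, t). ennreal (1 / t) * f (x / sqrt t, 1 / sqrt t, l)) (x, l, t) \<partial>lborel) \<partial>lborel) \<partial>lborel)"
    by (rule nn_integral_hit_hit) measurable
  also have "\<dots> = (\<integral>\<^sup>+l. (\<integral>\<^sup>+x. (\<integral>\<^sup>+t\<in>{0<..}. ennreal (hit t (2 * \<bar>x\<bar> + 1)) *
      (ennreal (1 / t) * f (x / sqrt t, 1 / sqrt t, l)) \<partial>lborel) * indicator {0..<1} l \<partial>lborel) \<partial>lborel)"
    unfolding prod.case by (rule lborel_pair.Fubini') measurable
  also have "\<dots> = (\<integral>\<^sup>+l. (\<integral>\<^sup>+x. (\<integral>\<^sup>+c. ennreal (hit 1 (\<bar>x\<bar> + c)) * f (x / 2, c, l) * indicator {0..} c * indicator {0..1} l \<partial>lborel) \<partial>lborel) \<partial>lborel)"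
  \<comment> \<open>Away from the null set \<open>l = 1\<close>, the half-open range of local times
    agrees with the closed range of the uniform law.\<close>
  proof (rule nn_integral_cong_AE, rule eventually_mono[OF AE_lborel_singleton[of 1]])
    fix l :: real assume l: "l \<noteq> 1"
    have "(\<integral>\<^sup>+x. (\<integral>\<^sup>+t\<in>{0<..}. ennreal (hit t (2 * \<bar>x\<bar> + 1)) * (ennreal (1 / t) * f (x / sqrt t, 1 / sqrt t, l)) \<partial>lborel) * indicator {0..<1} l \<partial>lborel)
      = (\<integral>\<^sup>+x. (\<integral>\<^sup>+t\<in>{0<..}. ennreal (hit t (2 * \<bar>x\<bar> + 1)) * (ennreal (1 / t) * (\<lambda>p. f (fst p, snd p, l)) (x / sqrt t, 1 / sqrt t)) \<partial>lborel) \<partial>lborel) * indicator {0..<1} l"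
      by (simp add: nn_integral_multc)
    also have "\<dots> = (\<integral>\<^sup>+y. (\<integral>\<^sup>+c\<in>{0..}. ennreal (hit 1 (\<bar>y\<bar> + c)) * (\<lambda>p. f (fst p, snd p, l)) (y / 2, c) \<partial>lborel) \<partial>lborel) * indicator {0..<1} l"
      by (subst nn_integral_hit_rescale) simp_all
    also have "\<dots> = (\<integral>\<^sup>+x. (\<integral>\<^sup>+c. ennreal (hit 1 (\<bar>x\<bar> + c)) * f (x / 2, c, l) * indicator {0..} c * indicator {0..1} l \<partial>lborel) \<partial>lborel)"
    proof -
      have "indicator {0..<1} l = (indicator {0..1} l :: ennreal)" using l by (auto split: split_indicator)
      then show ?thesis by (simp add: nn_integral_multc)
    qed
    finally show "(\<integral>\<^sup>+x. (\<integral>\<^sup>+t\<in>{0<..}. ennreal (hit t (2 * \<bar>x\<bar> + 1)) * (ennreal (1 / t) * f (x / sqrt t, 1 / sqrt t, l)) \<partial>lborel) * indicator {0..<1} l \<partial>lborel) = \<dots>" .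
  qed
  also have "\<dots> = (\<integral>\<^sup>+x. (\<integral>\<^sup>+l. (\<integral>\<^sup>+c. ennreal (hit 1 (\<bar>x\<bar> + c)) * f (x / 2, c, l) * indicator {0..} c * indicator {0..1} l \<partial>lborel) \<partial>lborel) \<partial>lborel)"
    by (rule lborel_pair.Fubini') measurable
  also have "\<dots> = (\<integral>\<^sup>+x. (\<integral>\<^sup>+c. (\<integral>\<^sup>+l. ennreal (hit 1 (\<bar>x\<bar> + c)) * f (x / 2, c, l) * indicator {0..} c * indicator {0..1} l \<partial>lborel) \<partial>lborel) \<partial>lborel)"
    by (rule nn_integral_cong, rule lborel_pair.Fubini') measurable
  also have "\<dots> = (\<integral>\<^sup>+x. (\<integral>\<^sup>+c. (\<integral>\<^sup>+l. (ennreal (hit 1 (\<bar>x\<bar> + c)) * f (x / 2, c, l) * indicator {0..1} l) * indicator {0..} c \<partial>lborel) \<partial>lborel) \<partial>lborel)"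
    by (intro nn_integral_cong) (simp add: ac_simps)
  also have "\<dots> = (\<integral>\<^sup>+x. (\<integral>\<^sup>+c\<in>{0..}. (\<integral>\<^sup>+l\<in>{0..1}. ennreal (hit 1 (\<bar>x\<bar> + c)) * f (x / 2, c, l) \<partial>lborel) \<partial>lborel) \<partial>lborel)"
    by (simp add: nn_integral_multc)
  finally show ?thesis .
qed

lemma law_fixed_time_uniform:
  assumes ind: "independent_rvs M borel (\<lambda>\<omega>. (B 1 \<omega>, L 1 \<omega>)) borel \<Lambda>"
    and unif: "uniform_on_unit_interval M \<Lambda>"
    and f [measurable]: "f \<in> borel_measurable (borel \<Otimes>\<^sub>M (borel \<Otimes>\<^sub>M borel))"
  shows "(\<integral>\<^sup>+\<omega>. f (1 / 2 * B 1 \<omega>, L 1 \<omega>, \<Lambda> \<omega>) \<partial>M) =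
    (\<integral>\<^sup>+x. (\<integral>\<^sup>+c\<in>{0..}. (\<integral>\<^sup>+l\<in>{0..1}. ennreal (hit 1 (\<bar>x\<bar> + c)) * f (x / 2, c, l) \<partial>lborel) \<partial>lborel) \<partial>lborel)"
proof -
  let ?F = "\<lambda>p :: (real \<times> real) \<times> real. f (fst (fst p) / 2, snd (fst p), snd p)"
  have [measurable]: "?F \<in> borel_measurable ((borel :: (real \<times> real) measure) \<Otimes>\<^sub>M borel)"
    unfolding borel_prod[symmetric] by measurable
  have "(\<integral>\<^sup>+\<omega>. f (1 / 2 * B 1 \<omega>, L 1 \<omega>, \<Lambda> \<omega>) \<partial>M) = (\<integral>\<^sup>+\<omega>. ?F ((B 1 \<omega>, L 1 \<omega>), \<Lambda> \<omega>) \<partial>M)" by simp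
  also have "\<dots> = (\<integral>\<^sup>+\<omega>. (\<integral>\<^sup>+l. ?F ((B 1 \<omega>, L 1 \<omega>), l) \<partial>distr M borel \<Lambda>) \<partial>M)"
    by (rule nn_integral_independent_rvs[OF ind]) measurable
  also have "\<dots> = (\<integral>\<^sup>+\<omega>. (\<integral>\<^sup>+l\<in>{0..1}. f (B 1 \<omega> / 2, L 1 \<omega>, l) \<partial>lborel) \<partial>M)"
    unfolding distr_uniform_on_unit_interval[OF unif]
    by (intro nn_integral_cong) (simp add: nn_integral_density mult.commute)
  also have "\<dots> = (\<integral>\<^sup>+\<omega>. (\<lambda>p. \<integral>\<^sup>+l\<in>{0..1}. f (fst p / 2, snd p, l) \<partial>lborel) (B 1 \<omega>, L 1 \<omega>) \<partial>M)" by simp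
  also have "\<dots> = (\<integral>\<^sup>+x. (\<integral>\<^sup>+c\<in>{0..}. ennreal (hit 1 (\<bar>x\<bar> + c)) * (\<integral>\<^sup>+l\<in>{0..1}. f (x / 2, c, l) \<partial>lborel) \<partial>lborel) \<partial>lborel)"
    by (subst joint_law) simp_all
  finally show ?thesis by (simp add: nn_integral_cmult mult.assoc)
qed

end

section \<open>Modification on a null set\<close>

text \<open>Independence of a nonempty family is the product form of its joint law, which is
  insensitive to null sets.\<close>

lemma (in prob_space) indep_vars_cong_AE:
  assumes ind: "indep_vars M' X I" and Y: "\<And>i. i \<in> I \<Longrightarrow> Y i \<in> measurable M (M' i)"
    and eq: "AE \<omega> in M. \<forall>i\<in>I. X i \<omega> = Y i \<omega>"
  shows "indep_vars M' Y I"
proof (cases "I = {}")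
  case True
  then show ?thesis by (simp add: indep_vars_def indep_sets_def)
next
  case False
  have X: "X i \<in> measurable M (M' i)" if "i \<in> I" for i using ind that by (auto simp: indep_vars_def)
  have "distr M (\<Pi>\<^sub>M i\<in>I. M' i) (\<lambda>x. \<lambda>i\<in>I. Y i x) = distr M (\<Pi>\<^sub>M i\<in>I. M' i) (\<lambda>x. \<lambda>i\<in>I. X i x)"
  proof (rule distr_cong_AE)
    show "AE x in M. (\<lambda>i\<in>I. Y i x) = (\<lambda>i\<in>I. X i x)"
      using eq by eventually_elim (auto simp: restrict_def)
  qed (use X Y in \<open>auto intro!: measurable_restrict\<close>)
  also have "\<dots> = (\<Pi>\<^sub>M i\<in>I. distr M (M' i) (X i))"
    using ind by (subst (asm) indep_vars_iff_distr_eq_PiM'[OF False X])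
  also have "\<dots> = (\<Pi>\<^sub>M i\<in>I. distr M (M' i) (Y i))"
  proof (rule PiM_cong[OF refl], rule distr_cong_AE)
    fix i assume "i \<in> I"
    then show "AE x in M. X i x = Y i x" using eq by (auto elim: eventually_mono)
  qed (use X Y in auto)
  finally show ?thesis by (subst indep_vars_iff_distr_eq_PiM'[OF False Y])
qed

lemma (in prob_space) independent_rvs_cong_AE:
  assumes ind: "independent_rvs M N X K Y" and X' [measurable]: "X' \<in> measurable M N"
    and eq: "AE \<omega> in M. X \<omega> = X' \<omega>"
  shows "independent_rvs M N X' K Y"
proof -
  have [measurable]: "X \<in> measurable M N" "Y \<in> measurable M K"
    and I: "indep_set (sets (vimage_algebra (space M) X N)) (sets (vimage_algebra (space M) Y K))"
    using ind by (auto simp: independent_rvs_def)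
  have vim: "sets (vimage_algebra (space M) Z P) = {Z -` A \<inter> space M | A. A \<in> sets P}"
    if "Z \<in> measurable M P" for Z :: "'a \<Rightarrow> 'z" and P
    by (rule sets_vimage_algebra2) (use measurable_space[OF that] in auto)
  have vimY: "sets (vimage_algebra (space M) Y K) = {Y -` A \<inter> space M | A. A \<in> sets K}"
    by (rule sets_vimage_algebra2) (use measurable_space[OF \<open>Y \<in> measurable M K\<close>] in auto)
  have "indep_set (sets (vimage_algebra (space M) X' N)) (sets (vimage_algebra (space M) Y K))"
  proof (rule indep_setI)
    show "sets (vimage_algebra (space M) X' N) \<subseteq> events" by (auto simp: vim)
    show "sets (vimage_algebra (space M) Y K) \<subseteq> events" by (auto simp: vimY)
    fix a b assume "a \<in> sets (vimage_algebra (space M) X' N)" and b: "b \<in> sets (vimage_algebra (space M) Y K)"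
    then obtain A where a: "a = X' -` A \<inter> space M" and A [measurable]: "A \<in> sets N" by (auto simp: vim)
    have [measurable]: "b \<in> events" using b by (auto simp: vimY)
    have "prob (X -` A \<inter> space M \<inter> b) = prob (X -` A \<inter> space M) * prob b"
      by (rule indep_setD[OF I _ b]) (auto simp: in_vimage_algebra)
    moreover have "prob (X -` A \<inter> space M \<inter> b) = prob (a \<inter> b)" unfolding a
      by (rule finite_measure_eq_AE) (use eq in \<open>eventually_elim, auto\<close>, measurable)
    moreover have "prob (X -` A \<inter> space M) = prob a" unfolding a
      by (rule finite_measure_eq_AE) (use eq in \<open>eventually_elim, auto\<close>, measurable)
    ultimately show "prob (a \<inter> b) = prob a * prob b" by simp
  qed
  then show ?thesis by (simp add: independent_rvs_def)
qed

text \<open>Preimages under \<open>X\<close> and \<open>Y\<close> differ by subsets of a null set,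
  which the completion contains. The process at a random time is treated in this way, through its
  modification, which is measurable with respect to \<open>M\<close>.\<close>

lemma completion_modification:
  fixes X Y :: "'a \<Rightarrow> 'b::topological_space"
  assumes Y [measurable]: "Y \<in> borel_measurable M" and eq: "AE \<omega> in M. X \<omega> = Y \<omega>"
  shows "X \<in> borel_measurable (completion M)" and "distr (completion M) borel X = distr M borel Y"
proof -
  have Y': "Y \<in> borel_measurable (completion M)" by (rule measurable_completion[OF Y])
  have eq': "AE \<omega> in completion M. X \<omega> = Y \<omega>" by (rule AE_completion[OF eq])
  show X: "X \<in> borel_measurable (completion M)"
  proof (rule measurableI)
    fix A :: "'b set" assume A: "A \<in> sets borel"
    show "X -` A \<inter> space (completion M) \<in> sets (completion M)"
    proof (rule completion.in_sets_AE)
      show "AE \<omega> in completion M. \<omega> \<in> Y -` A \<inter> space (completion M) \<longleftrightarrow> \<omega> \<in> X -` A \<inter> space (completion M)"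
        using eq' by eventually_elim auto
      show "Y -` A \<inter> space (completion M) \<in> sets (completion M)" by (rule measurable_sets[OF Y' A])
    qed auto
  qed simp
  have "distr (completion M) borel X = distr (completion M) borel Y"
    by (rule distr_cong_AE) (use X Y' eq' in auto)
  also have "\<dots> = distr M borel Y" by (rule distr_completion[OF Y])
  finally show "distr (completion M) borel X = distr M borel Y" .
qed

text \<open>A single null set carries all failures of the path properties. On it both processes are
  set to 0; off it each path is extended to negative times by its value at 0.\<close>

lemma BM_local_time_modification:
  assumes "prob_space M" and BM: "standard_brownian_motion M B" and LT: "local_time_at_0 M B L"
  obtains B' L' where "BM_local_time M B' L'"
    and "AE \<omega> in M. \<forall>t\<ge>0. B' t \<omega> = B t \<omega> \<and> L' t \<omega> = L t \<omega>"
proof -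
  interpret prob_space M by fact
  have B_meas: "\<And>t. 0 \<le> t \<Longrightarrow> B t \<in> borel_measurable M"
    and B_zero: "AE \<omega> in M. B 0 \<omega> = 0" and B_cont: "AE \<omega> in M. continuous_on {0..} (\<lambda>t. B t \<omega>)"
    and B_incr: "\<And>s t. 0 \<le> s \<Longrightarrow> s < t \<Longrightarrow> distributed M lborel (\<lambda>\<omega>. B t \<omega> - B s \<omega>) (normal_density 0 (sqrt (t - s)))"
    and B_indep: "\<And>(t :: nat \<Rightarrow> real) n. 0 \<le> t 0 \<Longrightarrow> mono t \<Longrightarrow>
        indep_vars (\<lambda>_. borel) (\<lambda>i \<omega>. B (t (Suc i)) \<omega> - B (t i) \<omega>) {..<n}"
    using BM by (auto simp: standard_brownian_motion_def)
  have L_meas: "\<And>t. 0 \<le> t \<Longrightarrow> L t \<in> borel_measurable M"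
    and L_cont: "AE \<omega> in M. continuous_on {0..} (\<lambda>t. L t \<omega>)"
    and L_lim: "AE \<omega> in M. \<forall>t\<ge>0. ((\<lambda>\<epsilon>. measure lborel {s \<in> {0..t}. \<bar>B s \<omega>\<bar> < \<epsilon>} / (2 * \<epsilon>)) \<longlongrightarrow> L t \<omega>) (at_right 0)"
    using LT by (auto simp: local_time_at_0_def)
  have "AE \<omega> in M. B 0 \<omega> = 0 \<and> continuous_on {0..} (\<lambda>t. B t \<omega>) \<and> continuous_on {0..} (\<lambda>t. L t \<omega>) \<and>
      (\<forall>t\<ge>0. ((\<lambda>\<epsilon>. measure lborel {s \<in> {0..t}. \<bar>B s \<omega>\<bar> < \<epsilon>} / (2 * \<epsilon>)) \<longlongrightarrow> L t \<omega>) (at_right 0))"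
    using B_zero B_cont L_cont L_lim by eventually_elim auto
  then obtain N where N: "N \<in> null_sets M" and good: "\<And>\<omega>. \<omega> \<in> space M - N \<Longrightarrow> B 0 \<omega> = 0 \<and>
      continuous_on {0..} (\<lambda>t. B t \<omega>) \<and> continuous_on {0..} (\<lambda>t. L t \<omega>) \<and>
      (\<forall>t\<ge>0. ((\<lambda>\<epsilon>. measure lborel {s \<in> {0..t}. \<bar>B s \<omega>\<bar> < \<epsilon>} / (2 * \<epsilon>)) \<longlongrightarrow> L t \<omega>) (at_right 0))"
    by (rule AE_E3) blast
  define G where "G = space M - N"
  have [measurable]: "G \<in> sets M" using N by (auto simp: G_def)
  have G_AE: "AE \<omega> in M. \<omega> \<in> G"
    using AE_not_in[OF N] AE_space by eventually_elim (simp add: G_def)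
  define B' where "B' t \<omega> = (if \<omega> \<in> G then B (max 0 t) \<omega> else 0)" for t \<omega>
  define L' where "L' t \<omega> = (if \<omega> \<in> G then L (max 0 t) \<omega> else 0)" for t \<omega>
  have B'_eq: "B' t \<omega> = B t \<omega>" "L' t \<omega> = L t \<omega>" if "\<omega> \<in> G" "0 \<le> t" for t \<omega>
    using that by (simp_all add: B'_def L'_def)
  have eq_AE: "AE \<omega> in M. \<forall>t\<ge>0. B' t \<omega> = B t \<omega> \<and> L' t \<omega> = L t \<omega>"
    using G_AE by eventually_elim (simp add: B'_eq)
  have B'_meas [measurable]: "B' t \<in> borel_measurable M" for t
    unfolding B'_def using B_meas[of "max 0 t"] by measurable
  have L'_meas [measurable]: "L' t \<in> borel_measurable M" for t
    unfolding L'_def using L_meas[of "max 0 t"] by measurable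
  have cont_max: "continuous_on UNIV (\<lambda>t. h (max 0 t))" if "continuous_on {0..} h" for h :: "real \<Rightarrow> real"
    by (rule continuous_on_compose2[OF that]) (auto intro!: continuous_intros)
  have B'_cont: "continuous_on UNIV (\<lambda>t. B' t \<omega>)" for \<omega>
    using cont_max[of "\<lambda>t. B t \<omega>"] good[of \<omega>] by (cases "\<omega> \<in> G") (auto simp: B'_def G_def)
  have L'_cont: "continuous_on UNIV (\<lambda>t. L' t \<omega>)" for \<omega>
    using cont_max[of "\<lambda>t. L t \<omega>"] good[of \<omega>] by (cases "\<omega> \<in> G") (auto simp: L'_def G_def)
  have "BM_local_time M B' L'"
  proof
    show "B' 0 \<omega> = 0" for \<omega> using good[of \<omega>] by (auto simp: B'_def G_def)
    show "distributed M lborel (\<lambda>\<omega>. B' t \<omega> - B' s \<omega>) (normal_density 0 (sqrt (t - s)))" if "0 \<le> s" "s < t" for s t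
    proof -
      have [measurable]: "(\<lambda>\<omega>. B t \<omega> - B s \<omega>) \<in> borel_measurable M" using B_meas that by simp
      have "distr M lborel (\<lambda>\<omega>. B' t \<omega> - B' s \<omega>) = distr M lborel (\<lambda>\<omega>. B t \<omega> - B s \<omega>)"
        by (rule distr_cong_AE) (use eq_AE that in \<open>auto elim!: eventually_mono\<close>)
      then show ?thesis using B_incr[OF that] by (simp add: distributed_def)
    qed
    show "indep_vars (\<lambda>_. borel) (\<lambda>i \<omega>. B' (t (Suc i)) \<omega> - B' (t i) \<omega>) {..<n}" if t: "0 \<le> t 0" "mono t" for t :: "nat \<Rightarrow> real" and n
    proof (rule indep_vars_cong_AE[OF B_indep[OF t]])
      have t0: "0 \<le> t i" for i using t monoD[OF t(2), of 0 i] by simp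
      show "AE \<omega> in M. \<forall>i\<in>{..<n}. B (t (Suc i)) \<omega> - B (t i) \<omega> = B' (t (Suc i)) \<omega> - B' (t i) \<omega>"
        using eq_AE by eventually_elim (simp add: t0)
    qed measurable
    show "AE \<omega> in M. \<forall>t\<ge>0. (\<lambda>n. occupation (1 / real (Suc n)) (\<lambda>q. B' q \<omega>) 0 t) \<longlonglongrightarrow> L' t \<omega>"
      using G_AE
    proof eventually_elim
      case (elim \<omega>)
      show ?case
      proof (intro allI impI)
        fix t :: real assume t: "0 \<le> t"
        have "((\<lambda>\<epsilon>. measure lborel {s \<in> {0..t}. \<bar>B s \<omega>\<bar> < \<epsilon>} / (2 * \<epsilon>)) \<longlongrightarrow> L t \<omega>) (at_right 0)"
          using good[of \<omega>] elim t by (auto simp: G_def)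
        moreover have "filterlim (\<lambda>n. 1 / real (Suc n)) (at_right 0) sequentially"
          unfolding filterlim_at using LIMSEQ_Suc[OF lim_1_over_n] by simp
        ultimately have "(\<lambda>n. measure lborel {s \<in> {0..t}. \<bar>B s \<omega>\<bar> < 1 / real (Suc n)} / (2 * (1 / real (Suc n)))) \<longlonglongrightarrow> L t \<omega>"
          by (rule filterlim_compose)
        moreover have "occupation e (\<lambda>q. B' q \<omega>) 0 t = measure lborel {s \<in> {0..t}. \<bar>B s \<omega>\<bar> < e} / (2 * e)" if "0 < e" for e
        proof -
          have "{s \<in> {0..t}. \<bar>B' s \<omega>\<bar> < e} = {s \<in> {0..t}. \<bar>B s \<omega>\<bar> < e}" using elim by (auto simp: B'_eq)
          then show ?thesis
            using occupation_eq_measure[OF that borel_measurable_continuous_onI[OF B'_cont[of \<omega>]], of 0 t] by simp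
        qed
        ultimately show "(\<lambda>n. occupation (1 / real (Suc n)) (\<lambda>q. B' q \<omega>) 0 t) \<longlonglongrightarrow> L' t \<omega>"
          using elim t by (simp add: B'_eq)
      qed
    qed
  qed (use B'_cont L'_cont in auto)
  then show ?thesis using that eq_AE by blast
qed

theorem theorem1p1:
  fixes M :: "'a measure"
    and B L :: "real \<Rightarrow> 'a \<Rightarrow> real"
    and U \<Lambda> \<tau>\<^sub>1 :: "'a \<Rightarrow> real"
  assumes "prob_space M"
    and "standard_brownian_motion M B"
    and "local_time_at_0 M B L"
    and "\<tau>\<^sub>1 = inverse_local_time L 1"
    and "uniform_on_unit_interval M U"
    and "independent_rvs M path_algebra (process_map B) borel U"
    and "uniform_on_unit_interval M \<Lambda>"
    and "independent_rvs M borel (\<lambda>\<omega>. (B 1 \<omega>, L 1 \<omega>)) borel \<Lambda>"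
  shows "equal_in_law M
           (\<lambda>\<omega>. (B (U \<omega> * \<tau>\<^sub>1 \<omega>) \<omega> / sqrt (\<tau>\<^sub>1 \<omega>), 1 / sqrt (\<tau>\<^sub>1 \<omega>), L (U \<omega> * \<tau>\<^sub>1 \<omega>) \<omega>))
           (\<lambda>\<omega>. (1 / 2 * B 1 \<omega>, L 1 \<omega>, \<Lambda> \<omega>))"
proof -
  obtain B' L' where BM: "BM_local_time M B' L'"
    and eq: "AE \<omega> in M. \<forall>t\<ge>0. B' t \<omega> = B t \<omega> \<and> L' t \<omega> = L t \<omega>"
    using BM_local_time_modification[OF assms(1-3)] by blast
  interpret BM_local_time M B' L' by fact
  have U [measurable]: "U \<in> borel_measurable M" and [measurable]: "\<Lambda> \<in> borel_measurable M"
    using assms(6,8) by (simp_all add: independent_rvs_def)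
  have indU: "independent_rvs M path_algebra (process_map B') borel U"
  proof (rule independent_rvs_cong_AE[OF assms(6)])
    show "AE \<omega> in M. process_map B \<omega> = process_map B' \<omega>"
      using eq by eventually_elim (auto simp: process_map_def restrict_def)
  qed (rule process_map_measurable)
  have ind\<Lambda>: "independent_rvs M borel (\<lambda>\<omega>. (B' 1 \<omega>, L' 1 \<omega>)) borel \<Lambda>"
  proof (rule independent_rvs_cong_AE[OF assms(8)])
    show "AE \<omega> in M. (B 1 \<omega>, L 1 \<omega>) = (B' 1 \<omega>, L' 1 \<omega>)"
      using eq by eventually_elim simp
  qed measurable
  \<comment> \<open>Versions of the two triples that are measurable with respect to \<open>M\<close>
    and agree almost surely with the given ones.\<close>
  let ?X = "\<lambda>\<omega>. (B' (U \<omega> * T \<omega>) \<omega> / sqrt (T \<omega>), 1 / sqrt (T \<omega>), L' (U \<omega> * T \<omega>) \<omega>)"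
  let ?Y = "\<lambda>\<omega>. (1 / 2 * B' 1 \<omega>, L' 1 \<omega>, \<Lambda> \<omega>)"
  have X [measurable]: "?X \<in> borel_measurable M" and Y [measurable]: "?Y \<in> borel_measurable M"
    by measurable
  have XX: "AE \<omega> in M. (B (U \<omega> * \<tau>\<^sub>1 \<omega>) \<omega> / sqrt (\<tau>\<^sub>1 \<omega>), 1 / sqrt (\<tau>\<^sub>1 \<omega>), L (U \<omega> * \<tau>\<^sub>1 \<omega>) \<omega>) = ?X \<omega>"
    using eq T_AE uniform_on_unit_interval_nonneg_AE[OF U assms(5)]
  proof eventually_elim
    case (elim \<omega>)
    \<comment> \<open>The infimum runs over nonnegative times, where the modified local time agrees
      with the given one.\<close>
    have "{t. 0 \<le> t \<and> 1 < L t \<omega>} = {t. 0 \<le> t \<and> 1 < L' t \<omega>}" using elim(1) by auto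
    then have "\<tau>\<^sub>1 \<omega> = inverse_local_time L' 1 \<omega>" by (simp add: assms(4) inverse_local_time_def)
    then have \<tau>: "\<tau>\<^sub>1 \<omega> = T \<omega>" using elim(2) by simp
    have "0 \<le> U \<omega> * T \<omega>" using elim(2,3) by (intro mult_nonneg_nonneg less_imp_le[of 0 "T \<omega>"]) blast+
    then show ?case unfolding \<tau> using elim(1) by simp
  qed
  have YY: "AE \<omega> in M. (1 / 2 * B 1 \<omega>, L 1 \<omega>, \<Lambda> \<omega>) = ?Y \<omega>"
    using eq by eventually_elim simp
  have "distr M borel ?X = distr M borel ?Y"
  proof (rule measure_eqI)
    fix A assume "A \<in> sets (distr M borel ?X)"
    then have [measurable]: "A \<in> sets borel" by simp
    have borel3: "(borel :: (real \<times> real \<times> real) measure) = borel \<Otimes>\<^sub>M (borel \<Otimes>\<^sub>M borel)"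
      by (simp only: borel_prod)
    have A3 [measurable]: "A \<in> sets (borel \<Otimes>\<^sub>M (borel \<Otimes>\<^sub>M borel))"
      using \<open>A \<in> sets borel\<close> unfolding borel3 .
    have ind_A: "indicator A \<in> borel_measurable (borel \<Otimes>\<^sub>M (borel \<Otimes>\<^sub>M borel))"
      using A3 by (rule borel_measurable_indicator)
    have "emeasure (distr M borel ?X) A = (\<integral>\<^sup>+\<omega>. indicator A (?X \<omega>) \<partial>M)"
      by (rule emeasure_distr_eq_nn_integral) measurable
    \<comment> \<open>Both sides equal the same triple integral: the density of
      \<open>(B 1, L 1)\<close> with the first coordinate halved, times the uniform density in the
      third coordinate.\<close>
    also have "\<dots> = (\<integral>\<^sup>+\<omega>. indicator A (?Y \<omega>) \<partial>M)"
      unfolding law_uniform_time[OF indU assms(5) ind_A] law_fixed_time_uniform[OF ind\<Lambda> assms(7) ind_A] ..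
    also have "\<dots> = emeasure (distr M borel ?Y) A"
      by (rule emeasure_distr_eq_nn_integral[symmetric]) measurable
    finally show "emeasure (distr M borel ?X) A = emeasure (distr M borel ?Y) A" .
  qed simp
  then show ?thesis
    unfolding equal_in_law_def
    using completion_modification[OF X XX] completion_modification[OF Y YY] by simp
qed

end
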